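(* There exists an $\epsilon>0$ such that if the initial condition $\psi$ satisfies $\|\psi\|_2<\epsilon$, then any Leray-Hopf solution $u$ on $[0,T)$ ($0<T\le\infty$) of the Navier-Stokes system on $\mathbb{T}^3$ with initial condition $\psi$ satisfies $$\|u(t)\|_2<\epsilon\qquad\text{for all } t\in(0,T).$$
   Context: $\mathbb{T}^3=[0,1]^3$ with periodic boundary conditions. The Navier-Stokes system is $$u_t-\Delta u+u\cdot\nabla u+\nabla p=0\ \text{ in }\ \mathbb{T}^3\times(0,\infty),\qquad u(x,0)=\psi,\quad \operatorname{div}u=0,$$ for vector fields $u$ with three components. The Fourier expansion of $f$ on $\mathbb{T}^3$ is $\sum_{\mathbf{k}\in\mathbb{Z}^3}f_{\mathbf{k}}\exp(2\pi i\langle x,\mathbf{k}\rangle)$. For $\alpha>0$, $\Phi(\alpha)$ is the space of periodic distributions $f$ on $\mathbb{T}^3$ with $f_0=0$ and $|f_{\mathbf{k}}|\le c/|\mathbf{k}|^\alpha$ for all $\mathbf{k}\ne0$ and some constant $c$, with norm $\|f\|_\alpha=\sup_{\mathbf{k}\in\mathbb{Z}^3\setminus\{0\}}|\mathbf{k}|^\alpha|f_{\mathbf{k}}|$ ($|f_{\mathbf{k}}|$ is the Euclidean norm for vector fields). Thus $\|\cdot\|_2$ is the norm of $\Phi(2)$, not the $L^2$ norm; writing $\|\psi\|_2<\epsilon$ includes $\psi\in\Phi(2)\subset L^2(\mathbb{T}^3)$, in particular $\psi_0=0$. A Leray-Hopf solution with (real-valued, divergence-free) initial data $\psi\in L^2(\mathbb{T}^3)$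 is a (real-valued, divergence-free) function $u:[0,T)\to L^2(\mathbb{T}^3)$ such that: (1) $u$ is weakly continuous; (2) $u\in L^\infty(0,T;L^2(\mathbb{T}^3))\cap L^2(0,T;H^1(\mathbb{T}^3))$; (3) for all divergence-free $\varphi\in C^\infty(\mathbb{T}^3\times[0,T))$ and all $t\in[0,T)$, $$\langle u(t),\varphi(t)\rangle+\int_0^t\Big(-\langle u(\tau),\partial_\tau\varphi(\tau)\rangle+\langle\nabla u(\tau),\nabla\varphi(\tau)\rangle+\langle u\cdot\nabla u,\varphi\rangle\Big)d\tau=\langle\psi,\varphi(0)\rangle;$$ (4) the energy inequality $\|u(t)\|_{L^2(\mathbb{T}^3)}^2+2\int_0^t\|\nabla u(\tau)\|_{L^2(\mathbb{T}^3)}^2\,d\tau\le\|\psi\|_{L^2(\mathbb{T}^3)}^2$ holds for $t\in[0,T)$. *)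

theory Defs
  imports "HOL-Analysis.Analysis"
begin

text \<open>
  Functions on the three-dimensional torus are functions on \<open>real^3\<close>.  For \<open>L\<^sup>2\<close> functions only
  the values almost everywhere on the unit cube matter; smooth test functions are required to
  be \<open>\<int>\<^sup>3\<close>-periodic.  Real-valuedness of vector fields is expressed by the type \<open>real^3\<close>.
\<close>

definition torus :: "(real^3) measure" where
  "torus = lebesgue_on (cbox 0 1)"

definition freq :: "int^3 \<Rightarrow> real^3" where
  "freq k = (\<chi> i. of_int (k $ i))"

definition periodic :: "(real^3 \<Rightarrow> 'b) \<Rightarrow> bool" where
  "periodic f \<longleftrightarrow> (\<forall>x k. f (x + freq k) = f x)"


subsection \<open>Smooth functions\<close>

text \<open>
  Derivatives are taken within \<open>S\<close>.  On \<open>[0,T) \<times> \<real>\<^sup>3\<close> they are one-sided at time \<open>0\<close>, so smoothness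
  there is smoothness up to the initial time.
\<close>

primrec Ck_on :: "nat \<Rightarrow> 'a::euclidean_space set \<Rightarrow> ('a \<Rightarrow> 'b::real_normed_vector) \<Rightarrow> bool" where
  "Ck_on 0 S f \<longleftrightarrow> continuous_on S f"
| "Ck_on (Suc n) S f \<longleftrightarrow>
     (\<exists>D. (\<forall>x\<in>S. (f has_derivative D x) (at x within S)) \<and> (\<forall>v. Ck_on n S (\<lambda>x. D x v)))"

definition smooth_on :: "'a::euclidean_space set \<Rightarrow> ('a \<Rightarrow> 'b::real_normed_vector) \<Rightarrow> bool" where
  "smooth_on S f \<longleftrightarrow> (\<forall>n. Ck_on n S f)"

text \<open>The entry \<open>(i, j)\<close> of the matrix is the derivative of the component \<open>i\<close> in direction \<open>j\<close>.\<close>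

definition grad :: "(real^3 \<Rightarrow> real^3) \<Rightarrow> real^3 \<Rightarrow> real^3^3" where
  "grad f x = jacobian f (at x)"

definition divergence :: "(real^3 \<Rightarrow> real^3) \<Rightarrow> real^3 \<Rightarrow> real" where
  "divergence f x = trace (grad f x)"


subsection \<open>Lebesgue and Sobolev spaces on the torus\<close>

definition torus_L2 :: "(real^3 \<Rightarrow> 'b::euclidean_space) set" where
  "torus_L2 = {f \<in> borel_measurable torus. integrable torus (\<lambda>x. (norm (f x))\<^sup>2)}"

definition torus_inner :: "(real^3 \<Rightarrow> 'b::euclidean_space) \<Rightarrow> (real^3 \<Rightarrow> 'b) \<Rightarrow> real" where
  "torus_inner f g = (LINT x|torus. f x \<bullet> g x)"

definition L2_norm :: "(real^3 \<Rightarrow> 'b::euclidean_space) \<Rightarrow> real" where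
  "L2_norm f = sqrt (torus_inner f f)"

definition weakly_div_free :: "(real^3 \<Rightarrow> real^3) \<Rightarrow> bool" where
  "weakly_div_free f \<longleftrightarrow>
     (\<forall>\<eta>::real^3 \<Rightarrow> real. smooth_on UNIV \<eta> \<and> periodic \<eta> \<longrightarrow>
        (LINT x|torus. frechet_derivative \<eta> (at x) (f x)) = 0)"

text \<open>\<open>G x $ i $ j\<close> is the weak derivative of the component \<open>i\<close> in direction \<open>j\<close>, as for \<^const>\<open>grad\<close>.\<close>

definition is_weak_grad :: "(real^3 \<Rightarrow> real^3) \<Rightarrow> (real^3 \<Rightarrow> real^3^3) \<Rightarrow> bool" where
  "is_weak_grad f G \<longleftrightarrow> G \<in> torus_L2 \<and>
     (\<forall>\<eta>::real^3 \<Rightarrow> real. smooth_on UNIV \<eta> \<and> periodic \<eta> \<longrightarrow>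
        (\<forall>i j. (LINT x|torus. f x $ i * frechet_derivative \<eta> (at x) (axis j 1))
             = - (LINT x|torus. G x $ i $ j * \<eta> x)))"

definition torus_H1 :: "(real^3 \<Rightarrow> real^3) set" where
  "torus_H1 = {f \<in> torus_L2. \<exists>G. is_weak_grad f G}"

text \<open>Weak gradients are unique up to null sets, so integrals do not depend on the choice.\<close>

definition weak_grad :: "(real^3 \<Rightarrow> real^3) \<Rightarrow> real^3 \<Rightarrow> real^3^3" where
  "weak_grad f = (SOME G. is_weak_grad f G)"

text \<open>\<open>(u \<cdot> \<nabla>) u\<close>, whose component \<open>i\<close> is \<open>\<Sum>j. u\<^sub>j \<partial>\<^sub>j u\<^sub>i\<close>.\<close>

definition convection :: "(real^3 \<Rightarrow> real^3) \<Rightarrow> real^3 \<Rightarrow> real^3" where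
  "convection u x = weak_grad u x *v u x"


subsection \<open>Fourier coefficients and the spaces \<open>\<Phi>(\<alpha>)\<close>\<close>

definition fourier_coeff :: "(real^3 \<Rightarrow> real^3) \<Rightarrow> int^3 \<Rightarrow> complex^3" where
  "fourier_coeff f k =
     (\<chi> i. LINT x|torus. of_real (f x $ i) * exp (- 2 * of_real pi * \<i> * of_real (x \<bullet> freq k)))"

text \<open>
  A periodic distribution is identified with its family of Fourier coefficients: families of
  polynomial growth correspond bijectively to periodic distributions, and the bound in \<open>Phi\<close>
  implies polynomial growth.
\<close>

definition Phi :: "real \<Rightarrow> (int^3 \<Rightarrow> complex^3) set" where
  "Phi \<alpha> = {a. a 0 = 0 \<and> (\<exists>c. \<forall>k. k \<noteq> 0 \<longrightarrow> norm (a k) \<le> c / norm (freq k) powr \<alpha>)}"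

definition Phi_norm :: "real \<Rightarrow> (int^3 \<Rightarrow> complex^3) \<Rightarrow> real" where
  "Phi_norm \<alpha> a = (SUP k\<in>-{0}. norm (freq k) powr \<alpha> * norm (a k))"


subsection \<open>Leray--Hopf solutions\<close>

definition times :: "ereal \<Rightarrow> real set" where
  "times T = {t. 0 \<le> t \<and> ereal t < T}"

text \<open>
  \<open>time_deriv T \<phi> t x\<close> is \<open>\<partial>\<^sub>t \<phi>\<close>; on \<open>[0,T)\<close> it is one-sided at \<open>t = 0\<close>.
\<close>

definition time_deriv :: "ereal \<Rightarrow> (real \<Rightarrow> real^3 \<Rightarrow> real^3) \<Rightarrow> real \<Rightarrow> real^3 \<Rightarrow> real^3" where
  "time_deriv T \<phi> t x = vector_derivative (\<lambda>s. \<phi> s x) (at t within times T)"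

definition test_field :: "ereal \<Rightarrow> (real \<Rightarrow> real^3 \<Rightarrow> real^3) \<Rightarrow> bool" where
  "test_field T \<phi> \<longleftrightarrow>
     smooth_on (times T \<times> UNIV) (\<lambda>(t, x). \<phi> t x) \<and>
     (\<forall>t\<in>times T. periodic (\<phi> t) \<and> (\<forall>x. divergence (\<phi> t) x = 0))"

definition weakly_continuous :: "ereal \<Rightarrow> (real \<Rightarrow> real^3 \<Rightarrow> real^3) \<Rightarrow> bool" where
  "weakly_continuous T u \<longleftrightarrow>
     (\<forall>v\<in>torus_L2. continuous_on (times T) (\<lambda>t. torus_inner (u t) v))"

text \<open>
  In the next two definitions, strong measurability of \<open>u\<close> into \<open>L\<^sup>2\<close> and \<open>H\<^sup>1\<close> is not listed:
  the definitions are used only for weakly continuous \<open>u\<close>, for which it follows from the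
  separability of these Hilbert spaces.
\<close>

definition in_Linf_L2 :: "ereal \<Rightarrow> (real \<Rightarrow> real^3 \<Rightarrow> real^3) \<Rightarrow> bool" where
  "in_Linf_L2 T u \<longleftrightarrow> (\<exists>C. AE t in lebesgue. t \<in> times T \<longrightarrow> u t \<in> torus_L2 \<and> L2_norm (u t) \<le> C)"

definition in_L2_H1 :: "ereal \<Rightarrow> (real \<Rightarrow> real^3 \<Rightarrow> real^3) \<Rightarrow> bool" where
  "in_L2_H1 T u \<longleftrightarrow>
     (AE t in lebesgue. t \<in> times T \<longrightarrow> u t \<in> torus_H1) \<and>
     set_integrable lebesgue (times T) (\<lambda>t. (L2_norm (u t))\<^sup>2 + (L2_norm (weak_grad (u t)))\<^sup>2)"

text \<open>The integrands over time are defined almost everywhere, hence the completed measure.\<close>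

definition weak_NS :: "ereal \<Rightarrow> (real^3 \<Rightarrow> real^3) \<Rightarrow> (real \<Rightarrow> real^3 \<Rightarrow> real^3) \<Rightarrow> bool" where
  "weak_NS T \<psi> u \<longleftrightarrow>
     (\<forall>\<phi>. test_field T \<phi> \<longrightarrow> (\<forall>t\<in>times T.
        torus_inner (u t) (\<phi> t) +
        (LINT \<tau>:{0..t}|lebesgue.
           - torus_inner (u \<tau>) (time_deriv T \<phi> \<tau>)
           + torus_inner (weak_grad (u \<tau>)) (grad (\<phi> \<tau>))
           + torus_inner (convection (u \<tau>)) (\<phi> \<tau>))
        = torus_inner \<psi> (\<phi> 0)))"

definition energy_inequality ::
    "ereal \<Rightarrow> (real^3 \<Rightarrow> real^3) \<Rightarrow> (real \<Rightarrow> real^3 \<Rightarrow> real^3) \<Rightarrow> bool" where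
  "energy_inequality T \<psi> u \<longleftrightarrow>
     (\<forall>t\<in>times T. (L2_norm (u t))\<^sup>2
        + 2 * (LINT \<tau>:{0..t}|lebesgue. (L2_norm (weak_grad (u \<tau>)))\<^sup>2) \<le> (L2_norm \<psi>)\<^sup>2)"

definition leray_hopf ::
    "ereal \<Rightarrow> (real^3 \<Rightarrow> real^3) \<Rightarrow> (real \<Rightarrow> real^3 \<Rightarrow> real^3) \<Rightarrow> bool" where
  "leray_hopf T \<psi> u \<longleftrightarrow>
     \<psi> \<in> torus_L2 \<and> weakly_div_free \<psi> \<and>
     (\<forall>t\<in>times T. u t \<in> torus_L2 \<and> weakly_div_free (u t)) \<and>
     weakly_continuous T u \<and>
     in_Linf_L2 T u \<and> in_L2_H1 T u \<and>
     weak_NS T \<psi> u \<and>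
     energy_inequality T \<psi> u"

end

theory Submission
  imports Defs
begin

text \<open>
  Let \<open>a\<close> be the family of Fourier coefficients of \<open>u\<close>, let \<open>v\<^sub>k\<close> be the projection of \<open>a\<^sub>k\<close> to the
  ball of radius \<open>r / \<bar>k\<bar>\<^sup>2\<close>, and let \<open>w = a - v\<close>. The function \<open>\<bar>a\<^sub>k\<bar>\<^sup>2 - \<bar>w\<^sub>k\<bar>\<^sup>2\<close> of \<open>a\<^sub>k\<close> is convex with
  gradient \<open>2 v\<^sub>k\<close>, so the ordinary differential equations for the modes bound its increments from below. Subtracting
  them from the energy inequality gives, up to constants,
  \<open>\<Sum>\<^sub>k \<bar>w\<^sub>k(t)\<bar>\<^sup>2 \<le> \<integral> (T(a, a, v) - \<Sum>\<^sub>k \<bar>k\<bar>\<^sup>2 \<bar>w\<^sub>k\<bar>\<^sup>2 - r \<Sum>\<^sub>k \<bar>w\<^sub>k\<bar>)\<close> with the trilinear form \<open>T\<close> of the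
  convection. The energy inequality thereby replaces the cancellation \<open>T(a, a, a) = 0\<close>, for which \<open>a\<close>
  is not regular enough. The antisymmetry of \<open>T\<close> gives \<open>T(a, a, v) = T(w, w, v) - T(v, v, w)\<close>, which is
  at most \<open>C r \<Sum>\<^sub>k \<bar>k\<bar>\<^sup>2 \<bar>w\<^sub>k\<bar>\<^sup>2 + C r\<^sup>2 \<Sum>\<^sub>k \<bar>w\<^sub>k\<bar>\<close>. Hence \<open>w(t) = 0\<close> if \<open>r\<close> is small.
\<close>

subsection \<open>Lattice sums\<close>

text \<open>The exponent 2 is critical. On the lattice the convolution of |.|^-2 with itself is O(1
  / |k|), so after one derivative T(v, v, w) costs C r^2 |w_k| per mode. On a clipped mode the
  dissipation gains |k|^2 (r / |k|^2) |w_k| = r |w_k|, which is of the same order in k. Hence the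
  size of r alone decides, uniformly in k and in time. For almost every time only one derivative in
  L^2 is available, and truncation makes all sums converge absolutely at that level: v decays like
  |k|^-2 by construction, and w is supported where |k|^2 |a_k| > r, so that r |w_k| <= |k|^2 |a_k|^2
  and w lies in l^1. Clipping multiplies a_k by a nonnegative real number that depends on |k| and
  |a_k| only; this preserves both the reality condition and incompressibility. The latter makes v_k
  admissible in the mode equations without pressure, and it moves the derivative in T onto the
  output frequency. Every ball of radius r <= r0 is invariant, which is why the same bound appears
  before and after.\<close>

lemma freq_simps [simp]:
  "freq 0 = 0" "freq (j + k) = freq j + freq k" "freq (j - k) = freq j - freq k" "freq (- k) = - freq k"
  by (auto simp: freq_def vec_eq_iff)

lemma freq_eq_0_iff [simp]: "freq k = 0 \<longleftrightarrow> k = 0"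
  by (auto simp: freq_def vec_eq_iff)

lemma norm_freq_ge_1: "k \<noteq> 0 \<Longrightarrow> 1 \<le> norm (freq k)"
proof -
  assume "k \<noteq> 0"
  then obtain i where "k $ i \<noteq> 0" by (auto simp: vec_eq_iff)
  then have "1 \<le> \<bar>freq k $ i\<bar>" by (simp add: freq_def flip: of_int_abs)
  also have "\<dots> \<le> norm (freq k)" by (rule component_le_norm_cart)
  finally show ?thesis .
qed

lemma card_vec_components:
  fixes A :: "'a set"
  assumes "finite A"
  shows "finite {k::'a^'n. \<forall>i. k $ i \<in> A}" "card {k::'a^'n. \<forall>i. k $ i \<in> A} = card A ^ CARD('n)"
proof -
  have bij: "bij_betw (\<lambda>k. ($) k) {k::'a^'n. \<forall>i. k $ i \<in> A} (PiE UNIV (\<lambda>_. A))"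
    by (rule bij_betw_byWitness[where f' = "\<lambda>f. \<chi> i. f i"]) (auto simp: PiE_def)
  have "finite (PiE (UNIV::'n set) (\<lambda>_. A))" by (intro finite_PiE assms) auto
  with bij show "finite {k::'a^'n. \<forall>i. k $ i \<in> A}" using bij_betw_finite by blast
  show "card {k::'a^'n. \<forall>i. k $ i \<in> A} = card A ^ CARD('n)"
    using bij_betw_same_card[OF bij] by (simp add: card_PiE)
qed

lemma card_freq_ball:
  fixes R :: real
  assumes "0 \<le> R"
  shows "finite {k. norm (freq k) \<le> R}" "card {k. norm (freq k) \<le> R} \<le> (2 * R + 1) ^ 3"
proof -
  define A where "A = {-\<lfloor>R\<rfloor>..\<lfloor>R\<rfloor>}"
  have sub: "{k. norm (freq k) \<le> R} \<subseteq> {k. \<forall>i. k $ i \<in> A}"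
  proof safe
    fix k i assume "norm (freq k) \<le> R"
    then have "\<bar>freq k $ i\<bar> \<le> R" using component_le_norm_cart order_trans by blast
    then show "k $ i \<in> A" by (auto simp: A_def freq_def le_floor_iff abs_le_iff) linarith
  qed
  have fA: "finite A" by (simp add: A_def)
  show "finite {k. norm (freq k) \<le> R}"
    using finite_subset[OF sub] card_vec_components[OF fA] by blast
  have "card {k. norm (freq k) \<le> R} \<le> card A ^ 3"
    using card_mono[OF _ sub] card_vec_components[OF fA, where 'n=3] by simp
  then have "real (card {k. norm (freq k) \<le> R}) \<le> real (card A) ^ 3"
    by (metis of_nat_le_iff of_nat_power)
  also have "real (card A) \<le> 2 * R + 1"
  proof -
    have "real (card A) = 2 * real_of_int \<lfloor>R\<rfloor> + 1" using assms by (simp add: A_def)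
    then show ?thesis by linarith
  qed
  then have "real (card A) ^ 3 \<le> (2 * R + 1) ^ 3" by (intro power_mono) auto
  finally show "card {k. norm (freq k) \<le> R} \<le> (2 * R + 1) ^ 3" .
qed

text \<open>The summand is dominated by the increments of the bounded function \<open>y \<mapsto> y / (1 + y)\<close>.\<close>

lemma sum_min_geometric:
  fixes q x :: real
  assumes "q > 1" "x > 0"
  shows "(\<Sum>n<N. min (x * q ^ n) (1 / (x * q ^ n))) \<le> 2 * (1 + q) / (q - 1)"
proof -
  \<comment> \<open>The increment of y / (1 + y) from y to q y is (q - 1) y / ((1 + q y) (1 + y)).
    The denominator is at most 2 (1 + q) if y <= 1 and at most 2 (1 + q) y^2 if y > 1; this
    \<open>c\<close> turns the two cases into y and 1 / y.\<close>
  define c where "c = 2 * (1 + q) / (q - 1)"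
  define P where "P = (\<lambda>n. c * (x * q ^ n / (1 + x * q ^ n)))"
  have c: "c > 0" using assms by (simp add: c_def)
  have "min (x * q ^ n) (1 / (x * q ^ n)) \<le> P (Suc n) - P n" for n
  proof -
    define y where "y = x * q ^ n"
    have y: "y > 0" using assms by (simp add: y_def)
    have "P (Suc n) - P n = c * (q * y / (1 + q * y) - y / (1 + y))"
      by (simp add: P_def y_def algebra_simps)
    also have "q * y / (1 + q * y) - y / (1 + y) = (q - 1) * y / ((1 + q * y) * (1 + y))"
    proof -
      have "1 + q * y > 0" "1 + y > 0" using y assms by (auto intro: add_pos_pos)
      then show ?thesis by (simp add: divide_simps) (simp add: algebra_simps)
    qed
    also have "c * \<dots> = 2 * (1 + q) * y / ((1 + q * y) * (1 + y))"
      using assms by (simp add: c_def)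
    finally have eq: "P (Suc n) - P n = 2 * (1 + q) * y / ((1 + q * y) * (1 + y))" .
    have pos: "(1 + q * y) * (1 + y) > 0" using y assms by (simp add: add_pos_pos)
    have "min y (1 / y) \<le> 2 * (1 + q) * y / ((1 + q * y) * (1 + y))"
    proof (cases "y \<le> 1")
      case True
      have "(1 + q * y) * (1 + y) \<le> (1 + q) * 2"
        using True y assms by (intro mult_mono) (auto simp: mult_left_le)
      then have "y * ((1 + q * y) * (1 + y)) \<le> 2 * (1 + q) * y" using y by (simp add: mult.commute)
      then have "y \<le> 2 * (1 + q) * y / ((1 + q * y) * (1 + y))" using pos by (simp add: pos_le_divide_eq)
      then show ?thesis by simp
    next
      case False
      have "(1 + q * y) * (1 + y) \<le> ((1 + q) * y) * (2 * y)"
        using False y assms by (intro mult_mono) (auto simp: algebra_simps)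
      then have "1 * ((1 + q * y) * (1 + y)) \<le> (2 * (1 + q) * y) * y" by (simp add: algebra_simps)
      then have "1 / y \<le> 2 * (1 + q) * y / ((1 + q * y) * (1 + y))" using pos y by (simp add: divide_simps)
      then show ?thesis by simp
    qed
    then show ?thesis unfolding eq y_def .
  qed
  then have "(\<Sum>n<N. min (x * q ^ n) (1 / (x * q ^ n))) \<le> (\<Sum>n<N. P (Suc n) - P n)" by (intro sum_mono)
  also have "\<dots> = P N - P 0" by (rule sum_lessThan_telescope)
  also have "\<dots> \<le> c"
  proof -
    have "x * q ^ N / (1 + x * q ^ N) \<le> 1" using assms by (simp add: divide_simps add_pos_pos)
    then have "P N \<le> c" using c unfolding P_def by (intro mult_left_le) auto
    moreover have "P 0 \<ge> 0" using c assms by (simp add: P_def)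
    ultimately show ?thesis by simp
  qed
  finally show ?thesis unfolding c_def .
qed

text \<open>A dyadic shell of radius 2^m has O(8^m) points, so up to constants it contributes 2^(m
  (3 - a)) R^-b below R and 2^(m (3 - a - b)) above R. The conditions a < 3 and a + b > 3 make both
  progressions geometric, with the peak at 2^m = R.\<close>

lemma lattice_sum_max:
  fixes a b :: real
  assumes ab: "0 < a" "a < 3" "0 < b" "a + b > 3"
  obtains C where "C > 0"
    "\<And>R J. R > 0 \<Longrightarrow> finite J \<Longrightarrow>
      (\<Sum>j\<in>J. norm (freq j) powr -a * max (norm (freq j)) R powr -b) \<le> C * R powr (3 - a - b)"
proof -
  \<comment> \<open>The slower of the two geometric rates, below and above \<open>R\<close>.\<close>
  define s where "s = min (3 - a) (a + b - 3)"
  have s: "s > 0" using ab by (simp add: s_def)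
  define q where "q = 2 powr s"
  have q: "q > 1" using s by (simp add: q_def)
  \<comment> \<open>A shell lies in the ball of radius 2^(m+1), which has at most (2 * 2^(m+1) +
    1)^3 <= 125 * 8^m lattice points; the other factor bounds the geometric sum.\<close>
  define C where "C = 125 * (2 * (1 + q) / (q - 1))"
  have C: "C > 0" using q by (simp add: C_def)
  have F: "y powr (3 - a) * max y 1 powr -b \<le> min (y powr s) (1 / y powr s)" if "y > 0" for y :: real
  proof (cases "y \<le> 1")
    case True
    have "y powr (3 - a) \<le> y powr s" using True that by (intro powr_mono') (auto simp: s_def)
    moreover have "y powr s \<le> 1" using True that s by (simp add: powr_le1)
    then have "y powr s \<le> 1 / y powr s" using that
      using order_trans[of "y powr s" 1 "1 / y powr s"] by (simp add: pos_le_divide_eq)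
    ultimately show ?thesis using True by (simp add: max_def)
  next
    case False
    have "y powr (3 - a) * y powr -b = y powr (3 - a - b)" using that by (simp flip: powr_add)
    also have "\<dots> \<le> y powr (-s)" using False by (intro powr_mono) (auto simp: s_def)
    also have "\<dots> = 1 / y powr s" by (simp add: powr_minus_divide)
    finally have "y powr (3 - a) * y powr -b \<le> 1 / y powr s" .
    moreover have "1 \<le> y powr s" using False s by (simp add: ge_one_powr_ge_zero)
    then have "1 / y powr s \<le> y powr s"
      using order_trans[of "1 / y powr s" 1 "y powr s"] by (simp add: divide_le_eq_1)
    ultimately show ?thesis using False by (simp add: max_def)
  qed
  show thesis
  proof (rule that[OF C])
    fix R :: real and J :: "(int^3) set" assume R: "R > 0" and J: "finite J"
    define J' where "J' = J - {0}"
    have J': "finite J'" using J by (simp add: J'_def)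
    define n where "n = (\<lambda>j. nat \<lfloor>log 2 (norm (freq j))\<rfloor>)"
    define h where "h = (\<lambda>n::nat. ((2::real)^n) powr -a * max (2^n) R powr -b)"
    have n1: "2 ^ n j \<le> norm (freq j)" and n2: "norm (freq j) \<le> 2 ^ Suc (n j)" if "j \<in> J'" for j
    proof -
      have 1: "1 \<le> norm (freq j)" using norm_freq_ge_1 that by (auto simp: J'_def)
      then have l: "0 \<le> log 2 (norm (freq j))" by (subst zero_le_log_cancel_iff) auto
      have "2 ^ n j = 2 powr real (n j)" by (simp add: powr_realpow)
      also have "\<dots> \<le> 2 powr log 2 (norm (freq j))" using l by (intro powr_mono) (auto simp: n_def)
      also have e: "2 powr log 2 (norm (freq j)) = norm (freq j)" using 1 by (intro powr_log_cancel) auto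
      finally show "2 ^ n j \<le> norm (freq j)" .
      have "2 powr log 2 (norm (freq j)) \<le> 2 powr real (Suc (n j))"
        using l by (intro powr_mono) (auto simp: n_def, linarith)
      then have "norm (freq j) \<le> 2 powr real (Suc (n j))" using e by simp
      also have "\<dots> = 2 ^ Suc (n j)" by (rule powr_realpow) simp
      finally show "norm (freq j) \<le> 2 ^ Suc (n j)" .
    qed
    \<comment> \<open>The zero frequency contributes nothing because \<open>0 powr -a\<close> is
      0.\<close>
    have "(\<Sum>j\<in>J. norm (freq j) powr -a * max (norm (freq j)) R powr -b) =
        (\<Sum>j\<in>J'. norm (freq j) powr -a * max (norm (freq j)) R powr -b)"
      using J by (intro sum.mono_neutral_right) (auto simp: J'_def)
    also have "\<dots> \<le> (\<Sum>j\<in>J'. h (n j))"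
      unfolding h_def using n1 ab R
      by (intro sum_mono mult_mono powr_mono2' max.mono) (auto simp: less_max_iff_disj)
    also have "\<dots> = (\<Sum>m\<in>n ` J'. \<Sum>j | j \<in> J' \<and> n j = m. h (n j))"
      by (rule sum.image_gen[OF J'])
    also have "\<dots> = (\<Sum>m\<in>n ` J'. real (card {j \<in> J'. n j = m}) * h m)"
      by (intro sum.cong) auto
    also have "\<dots> \<le> (\<Sum>m\<in>n ` J'. (125 * 8 ^ m) * h m)"
    proof (intro sum_mono mult_right_mono)
      fix m
      have sub: "{j \<in> J'. n j = m} \<subseteq> {j. norm (freq j) \<le> 2 ^ Suc m}" using n2 by blast
      have "real (card {j \<in> J'. n j = m}) \<le> real (card {j. norm (freq j) \<le> (2::real) ^ Suc m})"
        using card_mono[OF card_freq_ball(1) sub] by simp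
      also have "\<dots> \<le> (2 * 2 ^ Suc m + 1) ^ 3" by (rule card_freq_ball) simp
      also have "\<dots> \<le> (5 * 2 ^ m) ^ 3" by (intro power_mono) auto
      also have "\<dots> = 125 * (2 ^ m) ^ 3" by (simp add: power_mult_distrib)
      also have "((2::real) ^ m) ^ 3 = (2 ^ 3) ^ m" by (metis power_mult mult.commute)
      finally show "real (card {j \<in> J'. n j = m}) \<le> 125 * 8 ^ m" by simp
      show "0 \<le> h m" by (simp add: h_def)
    qed
    also have "\<dots> \<le> (\<Sum>m\<in>n ` J'. 125 * (R powr (3 - a - b) * min (R powr -s * q ^ m) (1 / (R powr -s * q ^ m))))"
    proof (intro sum_mono)
      fix m
      \<comment> \<open>Rescaling by \<open>R\<close> extracts the power R^(3 - a - b) and leaves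
        the function estimated in \<open>F\<close>.\<close>
      define y where "y = 2 ^ m / R"
      have y: "y > 0" using R by (simp add: y_def)
      have m2: "2 ^ m = R * y" using R by (simp add: y_def)
      have "((2::real) ^ 3) ^ m = (2 ^ m) ^ 3" by (metis power_mult mult.commute)
      then have "8 ^ m = (2 ^ m :: real) powr 3" by simp
      then have "8 ^ m * h m = (R * y) powr 3 * ((R * y) powr -a * max (R * y) R powr -b)"
        by (simp add: h_def m2)
      also have "max (R * y) R = R * max y 1" using R by (simp add: max_def)
      also have "(R * y) powr 3 * ((R * y) powr -a * (R * max y 1) powr -b)
          = (R powr 3 * R powr -a * R powr -b) * (y powr 3 * y powr -a * max y 1 powr -b)"
        using R y by (simp add: powr_mult)
      also have "\<dots> = R powr (3 - a - b) * (y powr (3 - a) * max y 1 powr -b)"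
        unfolding powr_add[symmetric] by simp
      also have "\<dots> \<le> R powr (3 - a - b) * min (y powr s) (1 / y powr s)"
        using F[OF y] by (intro mult_left_mono) auto
      also have "y powr s = R powr -s * q ^ m"
      proof -
        have "y powr s = (2 ^ m) powr s * R powr -s"
          using R by (simp add: y_def powr_divide powr_minus_divide)
        also have "(2 ^ m) powr s = (2::real) powr (real m * s)" by (simp add: powr_powr flip: powr_realpow)
        also have "\<dots> = q ^ m" by (simp add: q_def powr_powr mult.commute flip: powr_realpow)
        finally show ?thesis by simp
      qed
      finally show "125 * 8 ^ m * h m \<le> 125 * (R powr (3 - a - b) * min (R powr -s * q ^ m) (1 / (R powr -s * q ^ m)))"
        by simp
    qed
    also have "\<dots> \<le> (\<Sum>m<Suc (Max (insert 0 (n ` J'))). 125 * (R powr (3 - a - b) * min (R powr -s * q ^ m) (1 / (R powr -s * q ^ m))))"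
    proof (rule sum_mono2)
      show "n ` J' \<subseteq> {..<Suc (Max (insert 0 (n ` J')))}"
        using J' by (auto simp: less_Suc_eq_le intro!: Max_ge)
    qed (use q in auto)
    also have "\<dots> = 125 * R powr (3 - a - b) * (\<Sum>m<Suc (Max (insert 0 (n ` J'))). min (R powr -s * q ^ m) (1 / (R powr -s * q ^ m)))"
      by (simp only: sum_distrib_left mult.assoc)
    also have "\<dots> \<le> 125 * R powr (3 - a - b) * (2 * (1 + q) / (q - 1))"
      using q R by (intro mult_left_mono sum_min_geometric) auto
    finally show "(\<Sum>j\<in>J. norm (freq j) powr -a * max (norm (freq j)) R powr -b) \<le> C * R powr (3 - a - b)"
      unfolding C_def by (simp only: mult_ac)
  qed
qed

text \<open>The larger of |j| and |k - j| is at least R = |k| / 2, and it dominates the maximum of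
  the smaller one with R. This leaves one sum around 0 and, after j -> k - j, a second one with a
  and b exchanged.\<close>

lemma lattice_convolution:
  fixes a b :: real
  assumes ab: "a < 3" "b < 3" "a + b > 3"
  obtains C where "C > 0"
    "\<And>k J. k \<noteq> 0 \<Longrightarrow> finite J \<Longrightarrow>
      (\<Sum>j\<in>J. norm (freq j) powr -a * norm (freq (k - j)) powr -b) \<le> C * norm (freq k) powr (3 - a - b)"
proof -
  obtain C1 where C1: "C1 > 0" "\<And>R J. R > 0 \<Longrightarrow> finite J \<Longrightarrow>
      (\<Sum>j\<in>J. norm (freq j) powr -a * max (norm (freq j)) R powr -b) \<le> C1 * R powr (3 - a - b)"
    using lattice_sum_max[of a b] ab by auto
  obtain C2 where C2: "C2 > 0" "\<And>R J. R > 0 \<Longrightarrow> finite J \<Longrightarrow>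
      (\<Sum>j\<in>J. norm (freq j) powr -b * max (norm (freq j)) R powr -a) \<le> C2 * R powr (3 - b - a)"
    using lattice_sum_max[of b a] ab by auto
  define C where "C = (C1 + C2) * (1/2) powr (3 - a - b)"
  have "C > 0" using C1 C2 by (simp add: C_def)
  moreover have "(\<Sum>j\<in>J. norm (freq j) powr -a * norm (freq (k - j)) powr -b) \<le> C * norm (freq k) powr (3 - a - b)"
    if k: "k \<noteq> 0" and J: "finite J" for k J
  proof -
    define R where "R = norm (freq k) / 2"
    have R: "R > 0" using norm_freq_ge_1[OF k] unfolding R_def by linarith
    define f where "f = (\<lambda>j. norm (freq j) powr -a * max (norm (freq j)) R powr -b)"
    define g where "g = (\<lambda>j. norm (freq j) powr -b * max (norm (freq j)) R powr -a)"
    have "norm (freq j) powr -a * norm (freq (k - j)) powr -b \<le> f j + g (k - j)" for j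
    proof -
      have tri: "norm (freq k) \<le> norm (freq j) + norm (freq (k - j))"
        using norm_triangle_ineq[of "freq j" "freq (k - j)"] by simp
      have fg: "f j \<ge> 0" "g (k - j) \<ge> 0" by (auto simp: f_def g_def)
      show ?thesis
      proof (cases "norm (freq j) \<le> norm (freq (k - j))")
        case True
        then have "max (norm (freq j)) R \<le> norm (freq (k - j))" using tri by (simp add: R_def)
        then have "norm (freq j) powr -a * norm (freq (k - j)) powr -b \<le> f j"
          unfolding f_def using ab R by (intro mult_left_mono powr_mono2') auto
        then show ?thesis using fg by simp
      next
        case False
        then have "max (norm (freq (k - j))) R \<le> norm (freq j)" using tri by (simp add: R_def)
        then have "norm (freq j) powr -a * norm (freq (k - j)) powr -b \<le> g (k - j)"
          unfolding g_def using ab R by (subst mult.commute, intro mult_left_mono powr_mono2') auto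
        then show ?thesis using fg by simp
      qed
    qed
    then have "(\<Sum>j\<in>J. norm (freq j) powr -a * norm (freq (k - j)) powr -b) \<le> (\<Sum>j\<in>J. f j + g (k - j))"
      by (intro sum_mono)
    also have "\<dots> = sum f J + sum g ((-) k ` J)"
      by (simp add: sum.distrib sum.reindex inj_on_def)
    also have "\<dots> \<le> C1 * R powr (3 - a - b) + C2 * R powr (3 - b - a)"
      unfolding f_def g_def using C1(2)[OF R J] C2(2)[OF R, of "(-) k ` J"] J by (intro add_mono) auto
    also have "\<dots> = (C1 + C2) * R powr (3 - a - b)" by (simp add: algebra_simps)
    also have "R powr (3 - a - b) = (1/2) powr (3 - a - b) * norm (freq k) powr (3 - a - b)"
      by (simp add: R_def powr_divide)
    finally show ?thesis by (simp add: C_def mult_ac)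
  qed
  ultimately show thesis by (rule that)
qed

subsection \<open>The torus as a measure space\<close>

lemma borel_measurable_cnj [measurable (raw)]:
  "f \<in> borel_measurable M \<Longrightarrow> (\<lambda>x. cnj (f x)) \<in> borel_measurable M"
  by (rule borel_measurable_continuous_on[OF continuous_on_cnj[OF continuous_on_id]])

lemma space_torus [simp]: "space torus = cbox 0 1"
  by (simp add: torus_def)

lemma measure_torus [simp]: "measure torus (space torus) = 1"
proof -
  have "measure torus (cbox 0 1) = measure lebesgue (cbox (0::real^3) 1)"
    unfolding torus_def by (subst measure_restrict_space) auto
  also have "\<dots> = 1" by (simp add: content_cbox_if_cart interval_ne_empty_cart)
  finally show ?thesis by simp
qed

lemma finite_measure_torus: "finite_measure torus"
  unfolding torus_def by (intro finite_measure_lebesgue_on) auto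

interpretation torus: finite_measure torus
  by (rule finite_measure_torus)

lemma continuous_measurable_torus:
  fixes f :: "real^3 \<Rightarrow> 'b::euclidean_space"
  shows "continuous_on UNIV f \<Longrightarrow> f \<in> borel_measurable torus"
  unfolding torus_def
  by (rule continuous_imp_measurable_on_sets_lebesgue) (auto elim: continuous_on_subset)

lemma torus_L2_iff:
  "f \<in> torus_L2 \<longleftrightarrow> f \<in> borel_measurable torus \<and> integrable torus (\<lambda>x. (norm (f x))\<^sup>2)"
  by (simp add: torus_L2_def)

lemma torus_L2_I:
  fixes f :: "real^3 \<Rightarrow> 'b::euclidean_space" and g :: "real^3 \<Rightarrow> real"
  assumes f: "f \<in> borel_measurable torus" and g: "integrable torus g"
    and le: "\<And>x. x \<in> cbox 0 1 \<Longrightarrow> (norm (f x))\<^sup>2 \<le> g x"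
  shows "f \<in> torus_L2"
proof -
  note [measurable] = f
  have "integrable torus (\<lambda>x. (norm (f x))\<^sup>2)"
    by (rule Bochner_Integration.integrable_bound[OF g], measurable)
       (use le in \<open>force intro!: AE_I2\<close>)
  with f show ?thesis by (simp add: torus_L2_iff)
qed

lemma torus_L2_measurable: "f \<in> torus_L2 \<Longrightarrow> f \<in> borel_measurable torus"
  by (simp add: torus_L2_def)

lemma torus_L2_dominated:
  fixes f :: "real^3 \<Rightarrow> 'b::euclidean_space" and g :: "real^3 \<Rightarrow> 'c::euclidean_space"
  assumes "f \<in> borel_measurable torus" "g \<in> torus_L2"
    and le: "\<And>x. x \<in> cbox 0 1 \<Longrightarrow> norm (f x) \<le> C * norm (g x)"
  shows "f \<in> torus_L2"
proof (rule torus_L2_I[OF assms(1)])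
  show "integrable torus (\<lambda>x. C\<^sup>2 * (norm (g x))\<^sup>2)" using assms(2) by (simp add: torus_L2_iff)
  show "(norm (f x))\<^sup>2 \<le> C\<^sup>2 * (norm (g x))\<^sup>2" if "x \<in> cbox 0 1" for x
    using power_mono[OF le[OF that], of 2] by (simp add: power_mult_distrib)
qed

lemma torus_L2_bounded:
  fixes f :: "real^3 \<Rightarrow> 'b::euclidean_space"
  assumes "f \<in> borel_measurable torus" "\<And>x. x \<in> cbox 0 1 \<Longrightarrow> norm (f x) \<le> C"
  shows "f \<in> torus_L2"
proof (rule torus_L2_dominated[where C=C and g="\<lambda>_. 1::real"])
  show "(\<lambda>_. 1::real) \<in> torus_L2" by (simp add: torus_L2_iff)
qed (use assms in auto)

lemma torus_L2_add:
  fixes f :: "real^3 \<Rightarrow> 'b::euclidean_space"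
  assumes "f \<in> torus_L2" "g \<in> torus_L2"
  shows "(\<lambda>x. f x + g x) \<in> torus_L2"
proof (rule torus_L2_I)
  note [measurable] = torus_L2_measurable[OF assms(1)] torus_L2_measurable[OF assms(2)]
  show "(\<lambda>x. f x + g x) \<in> borel_measurable torus" by measurable
  show "integrable torus (\<lambda>x. 2 * (norm (f x))\<^sup>2 + 2 * (norm (g x))\<^sup>2)" using assms by (simp add: torus_L2_iff)
  show "(norm (f x + g x))\<^sup>2 \<le> 2 * (norm (f x))\<^sup>2 + 2 * (norm (g x))\<^sup>2" for x
  proof -
    have "(norm (f x + g x))\<^sup>2 \<le> (norm (f x) + norm (g x))\<^sup>2" by (intro power_mono norm_triangle_ineq) auto
    also have "\<dots> \<le> 2 * (norm (f x))\<^sup>2 + 2 * (norm (g x))\<^sup>2"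
      using sum_squares_bound[of "norm (f x)" "norm (g x)"] by (simp add: power2_sum)
    finally show ?thesis .
  qed
qed

lemma torus_L2_mult_bounded:
  fixes f g :: "real^3 \<Rightarrow> complex"
  assumes "f \<in> torus_L2" "g \<in> borel_measurable torus" "\<And>x. x \<in> cbox 0 1 \<Longrightarrow> norm (g x) \<le> C"
  shows "(\<lambda>x. f x * g x) \<in> torus_L2"
proof (rule torus_L2_dominated[OF _ assms(1), where C=C])
  note [measurable] = torus_L2_measurable[OF assms(1)] assms(2)
  show "(\<lambda>x. f x * g x) \<in> borel_measurable torus" by measurable
  show "norm (f x * g x) \<le> C * norm (f x)" if "x \<in> cbox 0 1" for x
    using mult_right_mono[OF assms(3)[OF that] norm_ge_zero[of "f x"]] by (simp add: norm_mult mult.commute)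
qed

lemma torus_L2_cmult:
  fixes f :: "real^3 \<Rightarrow> complex"
  shows "f \<in> torus_L2 \<Longrightarrow> (\<lambda>x. c * f x) \<in> torus_L2"
  using torus_L2_mult_bounded[of f "\<lambda>_. c" "norm c"] by (simp add: mult.commute)

lemma torus_L2_diff:
  fixes f :: "real^3 \<Rightarrow> complex"
  assumes "f \<in> torus_L2" "g \<in> torus_L2"
  shows "(\<lambda>x. f x - g x) \<in> torus_L2"
  using torus_L2_add[OF assms(1) torus_L2_cmult[OF assms(2), of "-1"]] by simp

lemma torus_L2_sum:
  fixes f :: "'i \<Rightarrow> real^3 \<Rightarrow> complex"
  assumes "\<And>i. i \<in> I \<Longrightarrow> f i \<in> torus_L2"
  shows "(\<lambda>x. \<Sum>i\<in>I. f i x) \<in> torus_L2"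
  using assms
proof (induction I rule: infinite_finite_induct)
  case (insert i I)
  then show ?case using torus_L2_add[of "f i" "\<lambda>x. \<Sum>i\<in>I. f i x"] by simp
qed (simp_all add: torus_L2_bounded[where C=0])

lemma integrable_torus_L2_bound:
  fixes f :: "real^3 \<Rightarrow> 'b::euclidean_space" and g :: "real^3 \<Rightarrow> 'c::euclidean_space"
    and h :: "real^3 \<Rightarrow> 'd::{banach,second_countable_topology}"
  assumes "f \<in> torus_L2" "g \<in> torus_L2" "h \<in> borel_measurable torus"
    and "\<And>x. x \<in> cbox 0 1 \<Longrightarrow> norm (h x) \<le> norm (f x) * norm (g x)"
  shows "integrable torus h"
proof (rule Bochner_Integration.integrable_bound[where f = "\<lambda>x. (norm (f x))\<^sup>2 + (norm (g x))\<^sup>2"])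
  show "integrable torus (\<lambda>x. (norm (f x))\<^sup>2 + (norm (g x))\<^sup>2)" using assms by (simp add: torus_L2_iff)
  show "AE x in torus. norm (h x) \<le> norm ((norm (f x))\<^sup>2 + (norm (g x))\<^sup>2)"
  proof (rule AE_I2)
    fix x assume "x \<in> space torus"
    then have "norm (h x) \<le> norm (f x) * norm (g x)" using assms(4) by simp
    also have "\<dots> \<le> (norm (f x))\<^sup>2 + (norm (g x))\<^sup>2"
      using sum_squares_bound[of "norm (f x)" "norm (g x)"] mult_nonneg_nonneg[of "norm (f x)" "norm (g x)"] norm_ge_zero[of "f x"] norm_ge_zero[of "g x"] by linarith
    finally show "norm (h x) \<le> norm ((norm (f x))\<^sup>2 + (norm (g x))\<^sup>2)" by simp
  qed
qed (fact assms)

lemma integrable_torus_mult: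
  fixes f g :: "real^3 \<Rightarrow> complex"
  assumes "f \<in> torus_L2" "g \<in> torus_L2"
  shows "integrable torus (\<lambda>x. f x * g x)" "integrable torus (\<lambda>x. f x * cnj (g x))"
proof -
  note [measurable] = torus_L2_measurable[OF assms(1)] torus_L2_measurable[OF assms(2)]
  show "integrable torus (\<lambda>x. f x * g x)"
    by (rule integrable_torus_L2_bound[OF assms]) (auto simp: norm_mult)
  show "integrable torus (\<lambda>x. f x * cnj (g x))"
    by (rule integrable_torus_L2_bound[OF assms]) (auto simp: norm_mult)
qed

lemma integrable_torus_norm_diff:
  fixes f g :: "real^3 \<Rightarrow> complex"
  assumes "f \<in> torus_L2" "g \<in> torus_L2"
  shows "integrable torus (\<lambda>x. (cmod (f x - g x))\<^sup>2)"
  using torus_L2_diff[OF assms] by (simp add: torus_L2_iff)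

subsection \<open>Characters and Bessel's identity\<close>

definition chr :: "int^3 \<Rightarrow> real^3 \<Rightarrow> complex" where
  "chr k x = cis (2 * pi * (x \<bullet> freq k))"

lemma norm_chr [simp]: "cmod (chr k x) = 1"
  by (simp add: chr_def)

lemma chr_0 [simp]: "chr 0 x = 1"
  by (simp add: chr_def)

lemma chr_add: "chr (j + k) x = chr j x * chr k x"
  by (simp add: chr_def cis_mult inner_add_right algebra_simps)

lemma cnj_chr: "cnj (chr k x) = chr (- k) x"
  by (simp add: chr_def cis_cnj)

lemma chr_diff: "chr (j - k) x = chr j x * cnj (chr k x)"
  using chr_add[of j "- k" x] by (simp add: cnj_chr)

lemma continuous_chr: "continuous_on S (chr k)"
  unfolding chr_def by (intro continuous_intros)

lemma chr_measurable [measurable]: "chr k \<in> borel_measurable torus"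
  by (intro continuous_measurable_torus continuous_chr)

lemma chr_L2: "chr k \<in> torus_L2"
  by (rule torus_L2_bounded[where C=1]) auto

text \<open>\<open>torus\<close> carries the completed measure, whereas the factorisation over
  coordinates lives on \<open>lborel\<close>; for Borel integrands the two integrals agree.\<close>

lemma integral_torus_lborel:
  fixes f :: "real^3 \<Rightarrow> complex"
  assumes "f \<in> borel_measurable borel"
  shows "(LINT x|torus. f x) = (LINT x|lborel. indicator (cbox 0 1) x *\<^sub>R f x)"
proof -
  have "(LINT x|torus. f x) = (LINT x|lebesgue. indicator (cbox 0 1) x *\<^sub>R f x)"
    unfolding torus_def by (rule integral_restrict_space) auto
  also have "\<dots> = (LINT x|lborel. indicator (cbox 0 1) x *\<^sub>R f x)"
    using assms by (intro integral_completion borel_measurable_scaleR borel_measurable_indicator) auto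
  finally show ?thesis .
qed

lemma integral_cis_Icc:
  "(LINT t|lborel. indicator {0..1} t *\<^sub>R cis (2 * pi * (t * of_int n))) = (if n = 0 then 1 else 0)"
proof (cases "n = 0")
  case False
  define c where "c = \<i> * of_real (2 * pi * of_int n)"
  define F where "F = (\<lambda>t::real. exp (c * of_real t) / c)"
  have c: "c \<noteq> 0" using False by (simp add: c_def)
  have cis: "cis (2 * pi * (t * of_int n)) = exp (c * of_real t)" for t
    by (simp add: cis_conv_exp c_def mult_ac)
  have "(LINT t|lborel. indicator {0..1} t *\<^sub>R exp (c * of_real t)) = F 1 - F 0"
  proof (rule integral_FTC_Icc)
    fix x :: real
    have "((\<lambda>z. exp (c * z) / c) has_field_derivative exp (c * of_real x)) (at (of_real x))"
      using c by (auto intro!: derivative_eq_intros)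
    then show "(F has_vector_derivative exp (c * of_real x)) (at x within {0..1})"
      unfolding F_def by (rule has_vector_derivative_real_field)
  qed (auto intro!: continuous_intros)
  also have "F 1 - F 0 = 0"
    using cis[of 1] cis_multiple_2pi[of "of_int n"] by (simp add: F_def)
  finally show ?thesis using False by (simp add: cis)
qed simp

lemma cis_sum: "cis (\<Sum>i\<in>I. f i) = (\<Prod>i\<in>I. cis (f i))"
  by (induction I rule: infinite_finite_induct) (simp_all flip: cis_mult)

text \<open>Fubini: the indicator of the cube and the character both factor over the coordinates,
  which leaves a product of integrals over the unit interval.\<close>

lemma integral_chr: "(LINT x|torus. chr m x) = (if m = 0 then 1 else 0)"
proof -
  interpret product_sigma_finite "\<lambda>_::real^3. lborel :: real measure" ..
  define f where "f = (\<lambda>(b::real^3) t. indicator {0..1} t *\<^sub>R cis (2 * pi * (t * (freq m \<bullet> b))))"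
  have [measurable]: "chr m \<in> borel_measurable borel"
    by (intro borel_measurable_continuous_onI continuous_chr)
  have pt: "indicator (cbox 0 1) x *\<^sub>R chr m x = (\<Prod>b\<in>Basis. f b (x \<bullet> b))" for x
  proof -
    have "x \<bullet> freq m = (\<Sum>b\<in>Basis. (x \<bullet> b) * (freq m \<bullet> b))" by (rule euclidean_inner)
    then have "chr m x = cis (\<Sum>b\<in>Basis. 2 * pi * ((x \<bullet> b) * (freq m \<bullet> b)))"
      by (simp add: chr_def sum_distrib_left)
    also have "\<dots> = (\<Prod>b\<in>Basis. cis (2 * pi * ((x \<bullet> b) * (freq m \<bullet> b))))"
      by (rule cis_sum)
    finally have c: "chr m x = \<dots>" .
    have one: "1 \<bullet> b = 1" if "b \<in> Basis" for b :: "real^3"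
      using that by (auto simp: Basis_vec_def inner_axis)
    have "(indicator (cbox 0 1) x :: real) = (\<Prod>b\<in>Basis. indicator {0..1} (x \<bullet> b))"
    proof (cases "x \<in> cbox 0 1")
      case True
      then show ?thesis using one by (auto simp: mem_box intro!: prod.neutral[symmetric])
    next
      case False
      then obtain b where "b \<in> Basis" "x \<bullet> b \<notin> {0..1}" using one by (auto simp: mem_box)
      then show ?thesis using False by (auto intro!: prod_zero[symmetric] bexI[of _ b])
    qed
    then show ?thesis unfolding f_def c by (simp add: scaleR_conv_of_real prod.distrib)
  qed
  have "(LINT x|torus. chr m x) = (LINT x|lborel. (\<Prod>b\<in>Basis. f b (x \<bullet> b)))"
    by (subst integral_torus_lborel) (auto simp: pt)
  also have "\<dots> = (LINT g|(\<Pi>\<^sub>M b\<in>Basis. lborel). (\<Prod>b\<in>Basis. f b ((\<Sum>b'\<in>Basis. g b' *\<^sub>R b') \<bullet> b)))"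
    by (subst lborel_eq, subst integral_distr) (auto simp flip: pt)
  also have "\<dots> = (LINT g|(\<Pi>\<^sub>M b\<in>Basis. lborel). (\<Prod>b\<in>Basis. f b (g b)))"
    by (intro Bochner_Integration.integral_cong prod.cong refl) (simp add: inner_sum_left_Basis)
  also have "\<dots> = (\<Prod>b\<in>Basis. LINT t|lborel. f b t)"
  proof (rule product_integral_prod)
    fix b :: "real^3"
    show "integrable lborel (f b)" unfolding f_def
      by (intro borel_integrable_compact continuous_intros) auto
  qed auto
  also have "\<dots> = (if m = 0 then 1 else 0)"
  proof -
    have fb: "(LINT t|lborel. f (axis i 1) t) = (if m $ i = 0 then 1 else 0)" for i
      using integral_cis_Icc[of "m $ i"] by (simp add: f_def freq_def inner_axis)
    have B: "(Basis :: (real^3) set) = range (\<lambda>i. axis i 1)" by (auto simp: Basis_vec_def)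
    have inj: "inj (\<lambda>i::3. axis i (1::real))" by (auto simp: inj_on_def axis_eq_axis)
    have "(\<Prod>b\<in>Basis. LINT t|lborel. f b t) = (\<Prod>i\<in>UNIV. LINT t|lborel. f (axis i 1) t)"
      unfolding B by (subst prod.reindex[OF inj]) simp
    also have "\<dots> = (\<Prod>i\<in>UNIV. if m $ i = 0 then 1 else 0)" by (simp add: fb)
    also have "\<dots> = (if m = 0 then 1 else 0)"
      by (auto simp: vec_eq_iff intro!: prod_zero)
    finally show ?thesis .
  qed
  finally show ?thesis .
qed

lemma chr_orthonormal: "(LINT x|torus. chr j x * cnj (chr k x)) = (if j = k then 1 else 0)"
  using integral_chr[of "j - k"] by (simp add: chr_diff)

definition coef :: "(real^3 \<Rightarrow> complex) \<Rightarrow> int^3 \<Rightarrow> complex" where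
  "coef f k = (LINT x|torus. f x * cnj (chr k x))"

text \<open>The coefficients \<open>c\<close> are arbitrary: \<open>c = coef f\<close> gives
  Bessel's inequality, while for any other choice the last sum is nonnegative, which is the best
  approximation property behind Parseval's identity.\<close>

lemma Bessel_identity:
  assumes f: "f \<in> torus_L2" and K: "finite K"
  shows "(LINT x|torus. (cmod (f x - (\<Sum>k\<in>K. c k * chr k x)))\<^sup>2) =
    (LINT x|torus. (cmod (f x))\<^sup>2) - (\<Sum>k\<in>K. (cmod (coef f k))\<^sup>2) + (\<Sum>k\<in>K. (cmod (coef f k - c k))\<^sup>2)"
proof -
  define P where "P = (\<lambda>x. \<Sum>k\<in>K. c k * chr k x)"
  have P: "P \<in> torus_L2" unfolding P_def by (intro torus_L2_sum torus_L2_cmult chr_L2)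
  have i0: "integrable torus (\<lambda>x. f x * cnj (chr k x))" for k
    by (rule integrable_torus_mult[OF f chr_L2])
  have fP: "(LINT x|torus. f x * cnj (P x)) = (\<Sum>k\<in>K. cnj (c k) * coef f k)"
  proof -
    have "(LINT x|torus. f x * cnj (P x)) = (LINT x|torus. (\<Sum>k\<in>K. cnj (c k) * (f x * cnj (chr k x))))"
      by (simp add: P_def sum_distrib_left mult_ac)
    also have "\<dots> = (\<Sum>k\<in>K. cnj (c k) * coef f k)"
      unfolding coef_def using i0 by (subst Bochner_Integration.integral_sum) auto
    finally show ?thesis .
  qed
  have PP: "(LINT x|torus. P x * cnj (P x)) = (\<Sum>k\<in>K. c k * cnj (c k))"
  proof -
    have "(LINT x|torus. P x * cnj (P x)) = (LINT x|torus. (\<Sum>k\<in>K. cnj (c k) * (\<Sum>j\<in>K. c j * (chr j x * cnj (chr k x)))))"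
      by (simp add: P_def sum_product sum_distrib_left mult_ac)
    also have "\<dots> = (\<Sum>k\<in>K. cnj (c k) * (\<Sum>j\<in>K. c j * (if j = k then 1 else 0)))"
      using integrable_torus_mult(2)[OF chr_L2 chr_L2]
      by (subst Bochner_Integration.integral_sum; simp add: chr_orthonormal)
    also have "\<dots> = (\<Sum>k\<in>K. c k * cnj (c k))" using K by (simp add: if_distrib mult.commute cong: if_cong)
    finally show ?thesis .
  qed
  have pt: "of_real ((cmod (f x - P x))\<^sup>2) = of_real ((cmod (f x))\<^sup>2) - (f x * cnj (P x) + cnj (f x * cnj (P x))) + P x * cnj (P x)" for x
    by (simp only: complex_norm_square) (simp add: algebra_simps)
  have "complex_of_real (LINT x|torus. (cmod (f x - P x))\<^sup>2) =
      (LINT x|torus. of_real ((cmod (f x))\<^sup>2) - (f x * cnj (P x) + cnj (f x * cnj (P x))) + P x * cnj (P x))"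
    by (simp only: integral_complex_of_real[symmetric] pt)
  also have "\<dots> = of_real (LINT x|torus. (cmod (f x))\<^sup>2) -
      ((\<Sum>k\<in>K. cnj (c k) * coef f k) + cnj (\<Sum>k\<in>K. cnj (c k) * coef f k)) + (\<Sum>k\<in>K. c k * cnj (c k))"
    using integrable_torus_mult(2)[OF f P] integrable_torus_mult(2)[OF P P] f
    by (simp add: fP PP torus_L2_iff del: complex_cnj_mult of_real_power)
  also have "\<dots> = of_real ((LINT x|torus. (cmod (f x))\<^sup>2) - (\<Sum>k\<in>K. (cmod (coef f k))\<^sup>2) + (\<Sum>k\<in>K. (cmod (coef f k - c k))\<^sup>2))"
    by (simp only: of_real_add of_real_diff of_real_sum complex_norm_square)
       (simp add: algebra_simps sum.distrib sum_subtractf)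
  finally show ?thesis unfolding P_def by (simp only: of_real_eq_iff)
qed

lemma Bessel_inequality:
  assumes f: "f \<in> torus_L2" and K: "finite K"
  shows "(\<Sum>k\<in>K. (cmod (coef f k))\<^sup>2) \<le> (LINT x|torus. (cmod (f x))\<^sup>2)"
proof -
  have "0 \<le> (LINT x|torus. (cmod (f x - (\<Sum>k\<in>K. coef f k * chr k x)))\<^sup>2)"
    by (rule Bochner_Integration.integral_nonneg) simp
  then show ?thesis unfolding Bessel_identity[OF assms] by simp
qed

subsection \<open>Density of trigonometric polynomials\<close>

text \<open>Generated by rules rather than given as finite sums, so that products are handled by
  induction on both factors; \<open>trig_poly_sum_form\<close> recovers the sum.\<close>

inductive trig_poly :: "(real^3 \<Rightarrow> complex) \<Rightarrow> bool" where
  chr: "trig_poly (\<lambda>x. c * chr k x)"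
| add: "trig_poly f \<Longrightarrow> trig_poly g \<Longrightarrow> trig_poly (\<lambda>x. f x + g x)"

lemma trig_poly_mult:
  assumes "trig_poly f" "trig_poly g"
  shows "trig_poly (\<lambda>x. f x * g x)"
  using assms(1)
proof induction
  case f: (chr c k)
  show ?case using assms(2)
  proof induction
    case (chr d j)
    show ?case using trig_poly.chr[of "c * d" "k + j"] by (simp add: chr_add mult_ac)
  next
    case (add f g)
    then show ?case using trig_poly.add by (simp add: distrib_left)
  qed
next
  case (add f h)
  then show ?case using trig_poly.add by (simp add: distrib_right)
qed

lemma trig_poly_const: "trig_poly (\<lambda>x. c)"
  using trig_poly.chr[of c 0] by simp

lemma trig_poly_sum:
  "(\<And>i. i \<in> I \<Longrightarrow> trig_poly (f i)) \<Longrightarrow> trig_poly (\<lambda>x. \<Sum>i\<in>I. f i x)"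
  by (induction I rule: infinite_finite_induct) (auto intro: trig_poly_const trig_poly.add)

lemma trig_poly_L2: "trig_poly f \<Longrightarrow> f \<in> torus_L2"
  by (induction rule: trig_poly.induct) (auto intro: torus_L2_add torus_L2_cmult chr_L2)

lemma trig_poly_sum_form:
  "trig_poly f \<Longrightarrow> \<exists>K c. finite K \<and> f = (\<lambda>x. \<Sum>k\<in>K. c k * chr k x)"
proof (induction rule: trig_poly.induct)
  case (chr c k)
  show ?case by (rule exI[of _ "{k}"], rule exI[of _ "\<lambda>_. c"]) simp
next
  case (add f g)
  then obtain K c L d where KL: "finite K" "f = (\<lambda>x. \<Sum>k\<in>K. c k * chr k x)"
    "finite L" "g = (\<lambda>x. \<Sum>k\<in>L. d k * chr k x)" by blast
  have "f x = (\<Sum>k\<in>K \<union> L. (if k \<in> K then c k else 0) * chr k x)" for x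
    unfolding KL using KL by (intro sum.mono_neutral_cong_left) auto
  moreover have "g x = (\<Sum>k\<in>K \<union> L. (if k \<in> L then d k else 0) * chr k x)" for x
    unfolding KL using KL by (intro sum.mono_neutral_cong_left) auto
  ultimately have "f x + g x = (\<Sum>k\<in>K \<union> L. ((if k \<in> K then c k else 0) + (if k \<in> L then d k else 0)) * chr k x)" for x
    by (simp add: distrib_right sum.distrib)
  then show ?case using KL by (intro exI[of _ "K \<union> L"] exI[of _ "\<lambda>k. (if k \<in> K then c k else 0) + (if k \<in> L then d k else 0)"]) auto
qed

definition trig_closure :: "(real^3 \<Rightarrow> complex) set" where
  "trig_closure = {f \<in> torus_L2. \<forall>\<delta>>0. \<exists>p. trig_poly p \<and> (LINT x|torus. (cmod (f x - p x))\<^sup>2) < \<delta>}"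

lemma integral_torus_norm_triangle:
  fixes f g h :: "real^3 \<Rightarrow> complex"
  assumes "f \<in> torus_L2" "g \<in> torus_L2" "h \<in> torus_L2"
  shows "(LINT x|torus. (cmod (f x - h x))\<^sup>2) \<le>
    2 * (LINT x|torus. (cmod (f x - g x))\<^sup>2) + 2 * (LINT x|torus. (cmod (g x - h x))\<^sup>2)"
proof -
  have "(LINT x|torus. (cmod (f x - h x))\<^sup>2) \<le> (LINT x|torus. 2 * (cmod (f x - g x))\<^sup>2 + 2 * (cmod (g x - h x))\<^sup>2)"
  proof (rule Bochner_Integration.integral_mono)
    show "(cmod (f x - h x))\<^sup>2 \<le> 2 * (cmod (f x - g x))\<^sup>2 + 2 * (cmod (g x - h x))\<^sup>2" for x
    proof -
      have "(cmod (f x - h x))\<^sup>2 \<le> (cmod (f x - g x) + cmod (g x - h x))\<^sup>2"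
        using norm_triangle_ineq[of "f x - g x" "g x - h x"] by (intro power_mono) auto
      then show ?thesis using sum_squares_bound[of "cmod (f x - g x)" "cmod (g x - h x)"] by (simp add: power2_sum)
    qed
  qed (use assms integrable_torus_norm_diff in auto)
  also have "\<dots> = 2 * (LINT x|torus. (cmod (f x - g x))\<^sup>2) + 2 * (LINT x|torus. (cmod (g x - h x))\<^sup>2)"
    using assms by (simp add: integrable_torus_norm_diff)
  finally show ?thesis .
qed

lemma trig_closure_closed:
  assumes f: "f \<in> torus_L2"
    and approx: "\<And>\<delta>. \<delta> > 0 \<Longrightarrow> \<exists>g\<in>trig_closure. (LINT x|torus. (cmod (f x - g x))\<^sup>2) < \<delta>"
  shows "f \<in> trig_closure"
proof -
  have "\<exists>p. trig_poly p \<and> (LINT x|torus. (cmod (f x - p x))\<^sup>2) < \<delta>" if d: "\<delta> > 0" for \<delta>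
  proof -
    obtain g where g: "g \<in> trig_closure" "(LINT x|torus. (cmod (f x - g x))\<^sup>2) < \<delta> / 4"
      using approx[of "\<delta> / 4"] d by auto
    then have g2: "g \<in> torus_L2" by (simp add: trig_closure_def)
    obtain p where p: "trig_poly p" "(LINT x|torus. (cmod (g x - p x))\<^sup>2) < \<delta> / 4"
      using g d unfolding trig_closure_def by (auto dest: spec[of _ "\<delta> / 4"])
    have "(LINT x|torus. (cmod (f x - p x))\<^sup>2) < \<delta>"
      using integral_torus_norm_triangle[OF f g2 trig_poly_L2[OF p(1)]] g(2) p(2) by linarith
    with p show ?thesis by blast
  qed
  with f show ?thesis by (simp add: trig_closure_def)
qed

lemma trig_closure_limit:
  assumes f: "f \<in> torus_L2" and g: "\<And>n. g n \<in> trig_closure"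
    and h: "integrable torus h" "\<And>n x. x \<in> cbox 0 1 \<Longrightarrow> (cmod (f x - g n x))\<^sup>2 \<le> h x"
    and lim: "\<And>x. x \<in> cbox 0 1 \<Longrightarrow> (\<lambda>n. g n x) \<longlonglongrightarrow> f x"
  shows "f \<in> trig_closure"
proof (rule trig_closure_closed[OF f])
  fix \<delta> :: real assume d: "\<delta> > 0"
  have g2: "g n \<in> torus_L2" for n using g[of n] by (simp add: trig_closure_def)
  note [measurable] = torus_L2_measurable[OF f] torus_L2_measurable[OF g2]
  have "(\<lambda>n. LINT x|torus. (cmod (f x - g n x))\<^sup>2) \<longlonglongrightarrow> (LINT x|torus. 0)"
  proof (rule integral_dominated_convergence[OF _ _ h(1)])
    show "AE x in torus. (\<lambda>n. (cmod (f x - g n x))\<^sup>2) \<longlonglongrightarrow> 0"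
    proof (rule AE_I2)
      fix x assume "x \<in> space torus"
      then have "(\<lambda>n. (cmod (f x - g n x))\<^sup>2) \<longlonglongrightarrow> (cmod (f x - f x))\<^sup>2"
        using lim by (intro tendsto_intros) auto
      then show "(\<lambda>n. (cmod (f x - g n x))\<^sup>2) \<longlonglongrightarrow> 0" by simp
    qed
    show "AE x in torus. norm ((cmod (f x - g n x))\<^sup>2) \<le> h x" for n
      using h(2) by (intro AE_I2) auto
  qed measurable
  then have "eventually (\<lambda>n. (LINT x|torus. (cmod (f x - g n x))\<^sup>2) < \<delta>) sequentially"
    using d by (intro order_tendstoD) auto
  then obtain n where "(LINT x|torus. (cmod (f x - g n x))\<^sup>2) < \<delta>"
    by (auto simp: eventually_sequentially)
  then show "\<exists>g\<in>trig_closure. (LINT x|torus. (cmod (f x - g x))\<^sup>2) < \<delta>" using g by blast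
qed

lemma trig_closure_poly: "trig_poly p \<Longrightarrow> p \<in> trig_closure"
  using trig_poly_L2 by (auto simp: trig_closure_def intro!: exI[of _ p])

lemma trig_closure_add:
  assumes "f \<in> trig_closure" "g \<in> trig_closure"
  shows "(\<lambda>x. f x + g x) \<in> trig_closure"
proof -
  have L: "f \<in> torus_L2" "g \<in> torus_L2" using assms by (auto simp: trig_closure_def)
  have "\<exists>p. trig_poly p \<and> (LINT x|torus. (cmod (f x + g x - p x))\<^sup>2) < \<delta>" if d: "\<delta> > 0" for \<delta>
  proof -
    obtain p q where p: "trig_poly p" "(LINT x|torus. (cmod (f x - p x))\<^sup>2) < \<delta> / 4"
      and q: "trig_poly q" "(LINT x|torus. (cmod (g x - q x))\<^sup>2) < \<delta> / 4"
      using assms d unfolding trig_closure_def by (auto dest!: spec[of _ "\<delta> / 4"])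
    have pq: "p \<in> torus_L2" "q \<in> torus_L2" using p q trig_poly_L2 by auto
    have "(LINT x|torus. (cmod (f x + g x - (p x + q x)))\<^sup>2) \<le>
        2 * (LINT x|torus. (cmod ((f x + g x) - (p x + g x)))\<^sup>2) + 2 * (LINT x|torus. (cmod ((p x + g x) - (p x + q x)))\<^sup>2)"
      using L pq by (intro integral_torus_norm_triangle torus_L2_add)
    then have "(LINT x|torus. (cmod (f x + g x - (p x + q x)))\<^sup>2) < \<delta>" using p(2) q(2) by simp
    then show ?thesis using trig_poly.add[OF p(1) q(1)] by blast
  qed
  then show ?thesis using torus_L2_add[OF L] by (simp add: trig_closure_def)
qed

lemma trig_closure_cmult:
  assumes "f \<in> trig_closure"
  shows "(\<lambda>x. c * f x) \<in> trig_closure"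
proof (cases "c = 0")
  case True
  then show ?thesis by (simp add: trig_closure_poly trig_poly_const)
next
  case False
  have L: "f \<in> torus_L2" using assms by (auto simp: trig_closure_def)
  have "\<exists>p. trig_poly p \<and> (LINT x|torus. (cmod (c * f x - p x))\<^sup>2) < \<delta>" if d: "\<delta> > 0" for \<delta>
  proof -
    have "\<delta> / (cmod c)\<^sup>2 > 0" using d False by simp
    then obtain p where p: "trig_poly p" "(LINT x|torus. (cmod (f x - p x))\<^sup>2) < \<delta> / (cmod c)\<^sup>2"
      using assms unfolding trig_closure_def by blast
    have "(LINT x|torus. (cmod (c * f x - c * p x))\<^sup>2) = (LINT x|torus. (cmod c)\<^sup>2 * (cmod (f x - p x))\<^sup>2)"
      by (simp flip: right_diff_distrib add: norm_mult power_mult_distrib)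
    also have "\<dots> < \<delta>" using p(2) False by (simp add: pos_less_divide_eq mult.commute)
    finally show ?thesis using trig_poly_mult[OF trig_poly_const p(1)] by blast
  qed
  then show ?thesis using torus_L2_cmult[OF L] by (simp add: trig_closure_def)
qed

text \<open>The embedding of the torus into \<open>complex^3\<close>. It moves the density question
  to a compact set in a Euclidean space, where the Stone-Weierstrass theorem provides real
  polynomials; these pull back to trigonometric polynomials.\<close>

definition torus_map :: "real^3 \<Rightarrow> complex^3" where
  "torus_map x = (\<chi> i. cis (2 * pi * (x $ i)))"

lemma continuous_torus_map: "continuous_on S torus_map"
  unfolding torus_map_def by (intro continuous_intros)

lemma trig_poly_Re_Im:
  assumes "trig_poly f" "trig_poly (\<lambda>x. cnj (f x))"
  shows "trig_poly (\<lambda>x. of_real (Re (f x)))" "trig_poly (\<lambda>x. of_real (Im (f x)))"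
proof -
  have "(\<lambda>x. of_real (Re (f x))) = (\<lambda>x. (1/2) * (f x + cnj (f x)))" by (simp add: complex_add_cnj)
  moreover have "(\<lambda>x. of_real (Im (f x))) = (\<lambda>x. (1/(2*\<i>)) * (f x + (-1) * cnj (f x)))"
    by (auto simp: fun_eq_iff complex_eq_iff Re_divide Im_divide)
  moreover have "trig_poly (\<lambda>x. (1/2) * (f x + cnj (f x)))" "trig_poly (\<lambda>x. (1/(2*\<i>)) * (f x + (-1) * cnj (f x)))"
    by (intro trig_poly_mult trig_poly_const trig_poly.add assms)+
  ultimately show "trig_poly (\<lambda>x. of_real (Re (f x)))" "trig_poly (\<lambda>x. of_real (Im (f x)))"
    by (simp_all only:)
qed

lemma trig_poly_real_polynomial:
  assumes "real_polynomial_function g"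
  shows "trig_poly (\<lambda>x. of_real (g (torus_map x)))"
  using assms
proof induction
  case (linear g)
  interpret g: bounded_linear g by fact
  have comp: "trig_poly (\<lambda>x. of_real (torus_map x \<bullet> b))" if b: "b \<in> Basis" for b
  proof -
    obtain i z where z: "z \<in> {1, \<i>}" and bi: "b = axis i z"
      using b by (auto simp: Basis_vec_def Basis_complex_def)
    have "cis (2 * pi * (x $ i)) = chr (axis i 1) x" for x
    proof -
      have "freq (axis i 1) = axis i 1" by (simp add: freq_def axis_def vec_eq_iff)
      then show ?thesis by (simp add: chr_def inner_axis)
    qed
    moreover have "trig_poly (chr (axis i 1))" "trig_poly (\<lambda>x. cnj (chr (axis i 1) x))"
      using trig_poly.chr[of 1 "axis i 1"] trig_poly.chr[of 1 "- axis i 1"] by (simp_all add: cnj_chr)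
    ultimately have "trig_poly (\<lambda>x. of_real (Re (torus_map x $ i)))" "trig_poly (\<lambda>x. of_real (Im (torus_map x $ i)))"
      using trig_poly_Re_Im[of "chr (axis i 1)"] by (simp_all add: torus_map_def)
    then show ?thesis using z by (auto simp: bi inner_axis)
  qed
  have "(\<lambda>x. complex_of_real (g (torus_map x))) = (\<lambda>x. \<Sum>b\<in>Basis. of_real (g b) * of_real (torus_map x \<bullet> b))"
  proof
    fix x
    have "g (torus_map x) = g (\<Sum>b\<in>Basis. (torus_map x \<bullet> b) *\<^sub>R b)" by (simp add: euclidean_representation)
    also have "\<dots> = (\<Sum>b\<in>Basis. g b * (torus_map x \<bullet> b))" by (simp add: g.sum g.scaleR mult.commute)
    finally show "complex_of_real (g (torus_map x)) = (\<Sum>b\<in>Basis. of_real (g b) * of_real (torus_map x \<bullet> b))" by simp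
  qed
  then show ?case using comp by (auto intro!: trig_poly_sum trig_poly_mult trig_poly_const)
next
  case (mult f g) then show ?case using trig_poly_mult by simp
qed (simp_all add: trig_poly_const trig_poly.add)

lemma trig_closure_continuous:
  fixes h :: "complex^3 \<Rightarrow> real"
  assumes h: "continuous_on UNIV h"
  shows "(\<lambda>x. of_real (h (torus_map x))) \<in> trig_closure"
proof (rule trig_closure_closed)
  define S where "S = torus_map ` cbox 0 1"
  have S: "compact S" unfolding S_def by (intro compact_continuous_image continuous_torus_map) auto
  have hS: "continuous_on S h" using h by (rule continuous_on_subset) auto
  have "continuous_on UNIV (\<lambda>x. complex_of_real (h (torus_map x)))"
    by (intro continuous_intros continuous_on_compose2[OF h] continuous_torus_map) auto
  then have meas: "(\<lambda>x. complex_of_real (h (torus_map x))) \<in> borel_measurable torus"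
    by (rule continuous_measurable_torus)
  have "bounded (h ` S)" using compact_imp_bounded[OF compact_continuous_image[OF hS S]] .
  then obtain B where "\<And>z. z \<in> S \<Longrightarrow> norm (h z) \<le> B" by (auto simp: bounded_iff)
  then show L: "(\<lambda>x. complex_of_real (h (torus_map x))) \<in> torus_L2"
    using meas by (intro torus_L2_bounded[where C=B]) (auto simp: S_def)
  fix \<delta> :: real assume d: "\<delta> > 0"
  \<comment> \<open>A uniform error e <= 1 has square at most e, and the torus has measure
    1.\<close>
  define e where "e = min 1 (\<delta> / 2)"
  have e: "e > 0" "e \<le> 1" "e < \<delta>" using d by (auto simp: e_def)
  obtain g where g: "real_polynomial_function g" "\<And>x. x \<in> S \<Longrightarrow> \<bar>h x - g x\<bar> < e"
    using Stone_Weierstrass_real_polynomial_function[OF S hS e(1)] by blast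
  define p where "p = (\<lambda>x. complex_of_real (g (torus_map x)))"
  have p: "trig_poly p" unfolding p_def by (rule trig_poly_real_polynomial[OF g(1)])
  have "(LINT x|torus. (cmod (of_real (h (torus_map x)) - p x))\<^sup>2) \<le> (LINT x|torus. e)"
  proof (rule Bochner_Integration.integral_mono)
    show "integrable torus (\<lambda>x. (cmod (of_real (h (torus_map x)) - p x))\<^sup>2)"
      by (rule integrable_torus_norm_diff[OF L trig_poly_L2[OF p]])
    fix x assume "x \<in> space torus"
    then have "torus_map x \<in> S" by (simp add: S_def)
    then have "\<bar>h (torus_map x) - g (torus_map x)\<bar> \<le> e" using g(2)[of "torus_map x"] by simp
    then have "cmod (of_real (h (torus_map x)) - p x) \<le> e" unfolding p_def by (metis norm_of_real of_real_diff)
    then have "(cmod (of_real (h (torus_map x)) - p x))\<^sup>2 \<le> e\<^sup>2" by (intro power_mono) auto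
    also have "\<dots> \<le> e" using e by (simp add: power2_eq_square mult_left_le)
    finally show "(cmod (of_real (h (torus_map x)) - p x))\<^sup>2 \<le> e" .
  qed simp
  also have "\<dots> = e" by (metis measure_torus mult.commute mult_1 lebesgue_integral_const real_scaleR_def)
  finally show "\<exists>g\<in>trig_closure. (LINT x|torus. (cmod (of_real (h (torus_map x)) - g x))\<^sup>2) < \<delta>"
    using e trig_closure_poly[OF p] by (intro bexI[of _ p]) auto
qed

text \<open>Opposite faces of the cube have the same image, so injectivity requires one of the
  points to be interior. This is why the approximation of indicators starts from compact subsets of
  \<open>box 0 1\<close>.\<close>

lemma torus_map_eq_interior:
  assumes x: "x \<in> cbox 0 1" and y: "y \<in> box 0 1" and eq: "torus_map x = torus_map y"
  shows "x = y"
proof -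
  have "x $ i = y $ i" for i
  proof -
    have "cis (2 * pi * (x $ i) - 2 * pi * (y $ i)) = 1"
      using eq by (simp add: torus_map_def vec_eq_iff flip: cis_divide)
    then have "cos (2 * pi * (x $ i) - 2 * pi * (y $ i)) = 1" by (metis cis.sel(1) one_complex.sel(1))
    then obtain n :: int where "2 * pi * (x $ i) - 2 * pi * (y $ i) = of_int n * 2 * pi"
      by (auto simp: cos_one_2pi_int)
    then have "2 * pi * (x $ i - y $ i) = 2 * pi * of_int n" by (simp add: algebra_simps)
    then have n: "x $ i - y $ i = of_int n" by simp
    have "0 \<le> x $ i" "x $ i \<le> 1" "0 < y $ i" "y $ i < 1"
      using x y by (auto simp: mem_box_cart)
    then have "-1 < (of_int n :: real)" "(of_int n :: real) < 1" using n by linarith+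
    then have "n = 0" by simp
    with n show ?thesis by simp
  qed
  then show ?thesis by (simp add: vec_eq_iff)
qed

text \<open>The cut-offs max(0, 1 - n dist(z, S)), with S the image of B, are continuous and
  decrease to the indicator of S. As B avoids the boundary, no point of the closed cube outside B is
  mapped into S.\<close>

lemma trig_closure_indicator_compact:
  assumes B: "compact B" "B \<subseteq> box 0 1"
  shows "(\<lambda>x. of_real (indicator B x)) \<in> trig_closure"
proof (cases "B = {}")
  case True
  then show ?thesis by (simp add: trig_closure_poly trig_poly_const)
next
  case False
  define S where "S = torus_map ` B"
  have S: "closed S" "S \<noteq> {}"
    using compact_continuous_image[OF continuous_torus_map B(1)] False by (auto simp: S_def compact_imp_closed)
  define h where "h = (\<lambda>n z. max 0 (1 - real n * infdist z S))"
  have Bm: "B \<in> sets lebesgue" using B(1) by (simp add: borel_compact)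
  have mB: "B \<in> sets torus"
    using Bm B(2) box_subset_cbox[of "0::real^3" 1] unfolding torus_def by (auto simp: sets_restrict_space_iff)
  have L: "(\<lambda>x. complex_of_real (indicator B x)) \<in> torus_L2"
    using mB by (intro torus_L2_bounded[where C=1]) (auto simp: indicator_def)
  show ?thesis
  proof (rule trig_closure_limit[OF L, where g = "\<lambda>n x. of_real (h n (torus_map x))" and h = "\<lambda>_. 1"])
    show "(\<lambda>x. complex_of_real (h n (torus_map x))) \<in> trig_closure" for n
      unfolding h_def by (intro trig_closure_continuous continuous_intros)
    show "(cmod (of_real (indicator B x) - of_real (h n (torus_map x))))\<^sup>2 \<le> 1" for n x
    proof -
      have "0 \<le> h n (torus_map x)" "h n (torus_map x) \<le> 1" by (auto simp: h_def infdist_nonneg)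
      then have "\<bar>indicator B x - h n (torus_map x)\<bar> \<le> 1" by (auto simp: indicator_def)
      then have "(indicator B x - h n (torus_map x))\<^sup>2 \<le> 1" by (simp add: abs_square_le_1)
      then show ?thesis by (metis norm_of_real of_real_diff power2_abs)
    qed
    show "(\<lambda>n. complex_of_real (h n (torus_map x))) \<longlonglongrightarrow> of_real (indicator B x)" if x: "x \<in> cbox 0 1" for x
    proof (rule tendsto_of_real)
      show "(\<lambda>n. h n (torus_map x)) \<longlonglongrightarrow> indicator B x"
      proof (cases "x \<in> B")
        case True
        then have "infdist (torus_map x) S = 0" by (simp add: S_def)
        then show ?thesis using True by (simp add: h_def)
      next
        case False
        then have "torus_map x \<notin> S" using torus_map_eq_interior[OF x] B(2) by (auto simp: S_def)
        then have pos: "infdist (torus_map x) S > 0"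
          using in_closed_iff_infdist_zero[OF S] infdist_nonneg[of "torus_map x" S] by (simp add: order_less_le)
        obtain N :: nat where N: "1 < real N * infdist (torus_map x) S"
          using reals_Archimedean3[OF pos] by blast
        have "h n (torus_map x) = 0" if "n \<ge> N" for n
        proof -
          have "real N * infdist (torus_map x) S \<le> real n * infdist (torus_map x) S"
            using that pos by (intro mult_right_mono) auto
          then show ?thesis using N by (simp add: h_def)
        qed
        then have "(\<lambda>n. h n (torus_map x)) \<longlonglongrightarrow> 0"
          by (intro tendsto_eventually) (auto simp: eventually_sequentially)
        then show ?thesis using False by simp
      qed
    qed
  qed simp
qed

text \<open>Inner regularity by closed sets, after intersection with the open cube, whose boundary
  is a null set.\<close>

lemma trig_closure_indicator:
  assumes A: "A \<in> sets torus"
  shows "(\<lambda>x. of_real (indicator A x)) \<in> trig_closure"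
proof (rule trig_closure_closed)
  show "(\<lambda>x. complex_of_real (indicator A x)) \<in> torus_L2"
    using A by (intro torus_L2_bounded[where C=1]) (auto simp: indicator_def)
  fix \<delta> :: real assume d: "\<delta> > 0"
  have A': "A \<in> sets lebesgue" "A \<subseteq> cbox 0 1"
    using A unfolding torus_def by (auto simp: sets_restrict_space_iff)
  then have "A \<inter> box 0 1 \<in> sets lebesgue" by auto
  then obtain T where T: "closed T" "T \<subseteq> A \<inter> box 0 1" "A \<inter> box 0 1 - T \<in> lmeasurable"
    "emeasure lebesgue (A \<inter> box 0 1 - T) < ennreal \<delta>"
    using sets_lebesgue_inner_closed d by metis
  have "bounded T" using T(2) bounded_box bounded_subset by blast
  then have cT: "compact T" using T(1) by (simp add: compact_eq_bounded_closed)
  have mT: "T \<in> sets torus"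
    using T A' unfolding torus_def by (auto simp: sets_restrict_space_iff)
  have "(LINT x|torus. (cmod (of_real (indicator A x) - of_real (indicator T x)))\<^sup>2) = (LINT x|torus. indicator (A - T) x)"
    using T(2) by (intro Bochner_Integration.integral_cong) (auto simp: indicator_def)
  also have "\<dots> = measure torus (A - T)"
    using sets.Diff[OF A mT] sets.sets_into_space[OF sets.Diff[OF A mT]] by (simp add: Int_absorb2)
  also have "\<dots> = measure lebesgue (A - T)"
    using A' unfolding torus_def by (intro measure_restrict_space) auto
  also have "\<dots> = measure lebesgue (A \<inter> box 0 1 - T)"
  proof (rule measure_negligible_symdiff[OF T(3)])
    have "(A \<inter> box 0 1 - T) - (A - T) \<union> ((A - T) - (A \<inter> box 0 1 - T)) \<subseteq> cbox 0 1 - box 0 1" using A' by auto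
    then show "negligible ((A \<inter> box 0 1 - T) - (A - T) \<union> ((A - T) - (A \<inter> box 0 1 - T)))"
      using negligible_frontier_interval negligible_subset by blast
  qed
  also have "\<dots> < \<delta>" using T(3,4) d by (simp add: emeasure_eq_measure2 fmeasurableD2 ennreal_less_iff emeasure_eq_ennreal_measure)
  finally have "(LINT x|torus. (cmod (of_real (indicator A x) - of_real (indicator T x)))\<^sup>2) < \<delta>" .
  then show "\<exists>g\<in>trig_closure. (LINT x|torus. (cmod (of_real (indicator A x) - g x))\<^sup>2) < \<delta>"
    using trig_closure_indicator_compact[OF cT] T(2) by (intro bexI) auto
qed

lemma trig_closure_sum:
  "finite I \<Longrightarrow> (\<And>i. i \<in> I \<Longrightarrow> f i \<in> trig_closure) \<Longrightarrow> (\<lambda>x. \<Sum>i\<in>I. f i x) \<in> trig_closure"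
  by (induction I rule: finite_induct) (auto intro: trig_closure_add trig_closure_poly trig_poly_const)

lemma trig_closure_cong:
  assumes "f \<in> trig_closure" "\<And>x. x \<in> cbox 0 1 \<Longrightarrow> f x = g x"
  shows "g \<in> trig_closure"
proof (rule trig_closure_limit[where g = "\<lambda>_. f" and h = "\<lambda>_. 0"])
  have f: "f \<in> torus_L2" using assms(1) by (simp add: trig_closure_def)
  have "g \<in> borel_measurable torus \<longleftrightarrow> f \<in> borel_measurable torus"
    by (rule measurable_cong) (simp add: assms(2))
  then have "g \<in> borel_measurable torus" using torus_L2_measurable[OF f] by simp
  then show "g \<in> torus_L2" by (rule torus_L2_dominated[where C=1, OF _ f]) (simp add: assms(2))
qed (simp_all add: assms)

theorem trig_closure_L2: "f \<in> torus_L2 \<Longrightarrow> f \<in> trig_closure"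
proof -
  assume f: "f \<in> torus_L2"
  obtain F where F: "\<And>i. simple_function torus (F i)" "\<And>x. x \<in> cbox 0 1 \<Longrightarrow> (\<lambda>i. F i x) \<longlonglongrightarrow> f x"
    "\<And>i x. x \<in> cbox 0 1 \<Longrightarrow> cmod (F i x) \<le> 2 * cmod (f x)"
    using borel_measurable_implies_sequence_metric[OF torus_L2_measurable[OF f], of 0] by simp metis
  have G: "F i \<in> trig_closure" for i
  proof (rule trig_closure_cong)
    show "(\<lambda>x. \<Sum>y\<in>F i ` space torus. y * of_real (indicator (F i -` {y} \<inter> space torus) x)) \<in> trig_closure"
      by (intro trig_closure_sum trig_closure_cmult trig_closure_indicator simple_functionD[OF F(1)])
    show "(\<Sum>y\<in>F i ` space torus. y * of_real (indicator (F i -` {y} \<inter> space torus) x)) = F i x" if "x \<in> cbox 0 1" for x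
    proof -
      have "F i x = (\<Sum>y\<in>F i ` space torus. indicator (F i -` {y} \<inter> space torus) x *\<^sub>R y)"
        using that by (intro simple_function_indicator_representation_banach F(1)) simp
      then show ?thesis by (simp only: scaleR_conv_of_real mult.commute)
    qed
  qed
  show ?thesis
  proof (rule trig_closure_limit[where g = F, OF f G])
    \<comment> \<open>9 = (1 + 2)^2, since the simple functions satisfy
      \<open>cmod (F i x) \<le> 2 * cmod (f x)\<close>.\<close>
    show "integrable torus (\<lambda>x. 9 * (cmod (f x))\<^sup>2)" using f by (simp add: torus_L2_iff)
    show "(cmod (f x - F n x))\<^sup>2 \<le> 9 * (cmod (f x))\<^sup>2" if "x \<in> cbox 0 1" for n x
    proof -
      have "cmod (f x - F n x) \<le> 3 * cmod (f x)"
        using norm_triangle_ineq4[of "f x" "F n x"] F(3)[OF that, of n] by linarith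
      then have "(cmod (f x - F n x))\<^sup>2 \<le> (3 * cmod (f x))\<^sup>2" by (intro power_mono) auto
      then show ?thesis by (simp add: power_mult_distrib)
    qed
  qed (use F in auto)
qed

subsection \<open>Parseval's identity\<close>

theorem Parseval_norm:
  assumes f: "f \<in> torus_L2"
  shows "((\<lambda>k. (cmod (coef f k))\<^sup>2) has_sum (LINT x|torus. (cmod (f x))\<^sup>2)) UNIV"
proof -
  define I where "I = (LINT x|torus. (cmod (f x))\<^sup>2)"
  have bd: "sum (\<lambda>k. (cmod (coef f k))\<^sup>2) K \<le> I" if "finite K" for K
    unfolding I_def by (rule Bessel_inequality[OF f that])
  have "(\<lambda>k. (cmod (coef f k))\<^sup>2) summable_on UNIV"
    by (rule nonneg_bdd_above_summable_on) (use bd in \<open>auto intro!: bdd_aboveI[of _ I]\<close>)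
  moreover have "infsum (\<lambda>k. (cmod (coef f k))\<^sup>2) UNIV = I"
  proof (rule antisym)
    show "infsum (\<lambda>k. (cmod (coef f k))\<^sup>2) UNIV \<le> I"
      using calculation bd by (intro infsum_le_finite_sums) auto
    show "I \<le> infsum (\<lambda>k. (cmod (coef f k))\<^sup>2) UNIV"
    proof (rule field_le_epsilon)
      fix e :: real assume e: "e > 0"
      obtain p where p: "trig_poly p" "(LINT x|torus. (cmod (f x - p x))\<^sup>2) < e"
        using trig_closure_L2[OF f] e by (auto simp: trig_closure_def)
      obtain K c where K: "finite K" "p = (\<lambda>x. \<Sum>k\<in>K. c k * chr k x)"
        using trig_poly_sum_form[OF p(1)] by blast
      \<comment> \<open>The defect in Bessel's inequality is at most the error of any trigonometric
        polynomial with frequencies in \<open>K\<close>.\<close>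
      have "I - (\<Sum>k\<in>K. (cmod (coef f k))\<^sup>2) \<le> (LINT x|torus. (cmod (f x - p x))\<^sup>2)"
        unfolding K(2) Bessel_identity[OF f K(1)] I_def by (simp add: sum_nonneg)
      moreover have "(\<Sum>k\<in>K. (cmod (coef f k))\<^sup>2) \<le> infsum (\<lambda>k. (cmod (coef f k))\<^sup>2) UNIV"
        using calculation K(1) \<open>(\<lambda>k. (cmod (coef f k))\<^sup>2) summable_on UNIV\<close> by (intro finite_sum_le_infsum) auto
      ultimately show "I \<le> infsum (\<lambda>k. (cmod (coef f k))\<^sup>2) UNIV + e" using p(2) by linarith
    qed
  qed
  ultimately show ?thesis unfolding I_def by (metis has_sum_infsum)
qed

lemma coef_add:
  assumes "f \<in> torus_L2" "g \<in> torus_L2"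
  shows "coef (\<lambda>x. f x + g x) k = coef f k + coef g k"
  unfolding coef_def using integrable_torus_mult(2)[OF assms(1) chr_L2] integrable_torus_mult(2)[OF assms(2) chr_L2]
  by (simp add: distrib_right)

lemma coef_cmult: "coef (\<lambda>x. c * f x) k = c * coef f k"
  unfolding coef_def by (simp add: mult.assoc)

lemma has_sum_finite_sum:
  fixes f :: "'i \<Rightarrow> 'a \<Rightarrow> 'b::topological_comm_monoid_add"
  assumes "finite I" "\<And>i. i \<in> I \<Longrightarrow> (f i has_sum S i) A"
  shows "((\<lambda>x. \<Sum>i\<in>I. f i x) has_sum (\<Sum>i\<in>I. S i)) A"
  using assms by (induction I rule: finite_induct) (auto intro: has_sum_add)

text \<open>Polarisation over the fourth roots of unity reduces this to \<open>Parseval_norm\<close>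
  for the functions \<open>f + \<i> ^ n * g\<close>.\<close>

theorem Parseval_inner:
  assumes f: "f \<in> torus_L2" and g: "g \<in> torus_L2"
  shows "((\<lambda>k. coef f k * cnj (coef g k)) has_sum (LINT x|torus. f x * cnj (g x))) UNIV"
proof -
  define q where "q = (\<lambda>n a b. of_real ((cmod (a + \<i> ^ n * b))\<^sup>2) * \<i> ^ n / (4::complex))"
  have pol: "a * cnj b = (\<Sum>n<4. q n a b)" for a b
    unfolding q_def complex_norm_square by (simp add: eval_nat_numeral field_simps)
  have 1: "((\<lambda>k. q n (coef f k) (coef g k)) has_sum (LINT x|torus. q n (f x) (g x))) UNIV" for n
  proof -
    have L: "(\<lambda>x. f x + \<i> ^ n * g x) \<in> torus_L2" by (intro torus_L2_add torus_L2_cmult f g)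
    have "((\<lambda>k. complex_of_real ((cmod (coef f k + \<i> ^ n * coef g k))\<^sup>2)) has_sum
        of_real (LINT x|torus. (cmod (f x + \<i> ^ n * g x))\<^sup>2)) UNIV"
      using Parseval_norm[OF L] unfolding coef_add[OF f torus_L2_cmult[OF g]] coef_cmult
      by (rule has_sum_of_real)
    from has_sum_cmult_left[OF this, of "\<i> ^ n / 4"] show ?thesis
      by (simp add: q_def flip: integral_complex_of_real)
  qed
  have "((\<lambda>k. \<Sum>n<4. q n (coef f k) (coef g k)) has_sum (\<Sum>n<4. LINT x|torus. q n (f x) (g x))) UNIV"
    by (intro has_sum_finite_sum 1) auto
  also have "(\<Sum>n<4. LINT x|torus. q n (f x) (g x)) = (LINT x|torus. (\<Sum>n<4. q n (f x) (g x)))"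
  proof (rule Bochner_Integration.integral_sum[symmetric])
    fix n
    have "(\<lambda>x. f x + \<i> ^ n * g x) \<in> torus_L2" by (intro torus_L2_add torus_L2_cmult f g)
    then show "integrable torus (\<lambda>x. q n (f x) (g x))"
      unfolding q_def torus_L2_iff by (intro integrable_divide_zero integrable_mult_left integrable_of_real) auto
  qed
  finally show ?thesis unfolding pol .
qed

subsection \<open>The trilinear form on the Fourier side\<close>

text \<open>Bilinear, without conjugation; \<open>cdot (a k) k = 0\<close> is the Fourier form of
  vanishing divergence.\<close>

definition cdot :: "complex^3 \<Rightarrow> int^3 \<Rightarrow> complex" where
  "cdot a k = (\<Sum>i\<in>UNIV. a $ i * of_int (k $ i))"

lemma cdot_add_left: "cdot (a + b) k = cdot a k + cdot b k"
  by (simp add: cdot_def distrib_right sum.distrib)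

lemma cdot_diff_left: "cdot (a - b) k = cdot a k - cdot b k"
  by (simp add: cdot_def left_diff_distrib sum_subtractf)

lemma cdot_scaleR_left: "cdot (c *\<^sub>R a) k = c *\<^sub>R cdot a k"
  by (simp add: cdot_def scaleR_sum_right)

lemma cdot_add_right: "cdot a (j + k) = cdot a j + cdot a k"
  by (simp add: cdot_def distrib_left sum.distrib)

lemma cdot_minus_right: "cdot a (- k) = - cdot a k"
  by (simp add: cdot_def sum_negf)

lemma norm_cdot_le: "cmod (cdot a k) \<le> norm a * norm (freq k)"
proof -
  have "cmod (cdot a k) \<le> (\<Sum>i\<in>UNIV. cmod (a $ i * of_int (k $ i)))"
    unfolding cdot_def by (rule norm_sum)
  also have "\<dots> = (\<Sum>i\<in>UNIV. \<bar>cmod (a $ i)\<bar> * \<bar>norm (freq k $ i)\<bar>)"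
    by (simp add: norm_mult freq_def)
  also have "\<dots> \<le> norm a * norm (freq k)"
    unfolding norm_vec_def by (rule L2_set_mult_ineq)
  finally show ?thesis .
qed

lemma norm_vector_scalar_mult: "norm (c *s (a :: complex^'n)) = cmod c * norm a"
  by (simp add: norm_vec_def norm_mult L2_set_right_distrib)

text \<open>One summand of the integral of ((x . grad) y) . z: the transporting field has frequency
  \<open>p\<close>, the transported one \<open>j\<close>, the output \<open>p + j\<close>. The inner
  product on complex vectors is the real one, so the value is a real number.\<close>

definition tri :: "(int^3 \<Rightarrow> complex^3) \<Rightarrow> (int^3 \<Rightarrow> complex^3) \<Rightarrow> (int^3 \<Rightarrow> complex^3) \<Rightarrow> (int^3) \<times> (int^3) \<Rightarrow> real" where
  "tri x y z = (\<lambda>(p, j). z (p + j) \<bullet> ((2 * of_real pi * \<i> * cdot (x p) j) *s y j))"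

lemma tri_add:
  "tri (\<lambda>k. x k + x' k) y z pj = tri x y z pj + tri x' y z pj"
  "tri x (\<lambda>k. y k + y' k) z pj = tri x y z pj + tri x y' z pj"
  by (cases pj; simp add: tri_def cdot_add_left inner_add_right inner_add_left distrib_left
        vector_add_ldistrib vector_sadd_rdistrib)+

lemma inner_complex_vec: "(a :: complex^'n) \<bullet> b = Re (\<Sum>i\<in>UNIV. a $ i * cnj (b $ i))"
  by (simp add: inner_vec_def inner_complex_def)

text \<open>Integration by parts on the Fourier side: the reflection j -> -(p + j) exchanges the
  frequencies of \<open>y\<close> and \<open>z\<close> up to conjugation, and since
  \<open>x p\<close> is orthogonal to \<open>p\<close>, the factor \<open>cdot (x p) j\<close>
  merely changes its sign.\<close>

lemma tri_swap:
  assumes x: "cdot (x p) p = 0"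
    and y: "\<And>k i. y (- k) $ i = cnj (y k $ i)" and z: "\<And>k i. z (- k) $ i = cnj (z k $ i)"
  shows "tri x y z (p, - (p + j)) = - tri x z y (p, j)"
proof -
  define c where "c = 2 * of_real pi * \<i> * cdot (x p) j"
  have "2 * of_real pi * \<i> * cdot (x p) (- (p + j)) = - c"
    using x by (simp only: cdot_minus_right cdot_add_right c_def) simp
  then have "tri x y z (p, - (p + j)) = z (- j) \<bullet> ((- c) *s y (- (p + j)))"
    by (simp add: tri_def)
  also have "\<dots> = Re (\<Sum>i\<in>UNIV. - cnj (z j $ i * c * cnj (y (p + j) $ i)))"
    unfolding inner_complex_vec by (intro arg_cong[where f=Re] sum.cong refl) (simp only: y z vector_smult_component, simp)
  also have "\<dots> = - (\<Sum>i\<in>UNIV. Re (y (p + j) $ i * cnj (c * z j $ i)))"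
    by (simp add: sum_negf[symmetric] algebra_simps)
  also have "\<dots> = - (y (p + j) \<bullet> (c *s z j))"
    unfolding inner_complex_vec by simp
  also have "\<dots> = - tri x z y (p, j)" by (simp add: tri_def c_def)
  finally show ?thesis .
qed

lemma tri_swap_has_sum:
  assumes x: "\<And>p. cdot (x p) p = 0"
    and y: "\<And>k i. y (- k) $ i = cnj (y k $ i)" and z: "\<And>k i. z (- k) $ i = cnj (z k $ i)"
    and s: "(tri x y z has_sum S) UNIV"
  shows "(tri x z y has_sum - S) UNIV"
proof -
  have "bij (\<lambda>(p, j). (p, - (p + j)) :: (int^3) \<times> (int^3))"
    by (rule bij_betw_byWitness[where f' = "\<lambda>(p, j). (p, - (p + j))"]) auto
  from has_sum_reindex_bij_betw[OF this, of "tri x y z" S] s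
  have "((\<lambda>q. tri x y z (case q of (p, j) \<Rightarrow> (p, - (p + j)))) has_sum S) UNIV" by simp
  also have "(\<lambda>q. tri x y z (case q of (p, j) \<Rightarrow> (p, - (p + j)))) = (\<lambda>q. - tri x z y q)"
    using tri_swap[of x _ y z, OF x y z] by (auto simp: fun_eq_iff)
  finally show ?thesis by (simp add: has_sum_uminus)
qed

text \<open>Division by zero turns the bound at \<open>k = 0\<close> into
  \<open>norm (z 0) \<le> 0\<close>, so a vanishing mean is included.\<close>

abbreviation decay :: "real \<Rightarrow> (int^3 \<Rightarrow> complex^3) \<Rightarrow> bool" where
  "decay r z \<equiv> \<forall>k. norm (z k) \<le> r / (norm (freq k))\<^sup>2"

text \<open>The weight vanishes at the zero frequency, hence the separate condition on the
  mean.\<close>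

definition h1_seq :: "(int^3 \<Rightarrow> complex^3) \<Rightarrow> bool" where
  "h1_seq x \<longleftrightarrow> x 0 = 0 \<and> (\<lambda>k. (norm (freq k) * norm (x k))\<^sup>2) summable_on UNIV"

definition h1_norm2 :: "(int^3 \<Rightarrow> complex^3) \<Rightarrow> real" where
  "h1_norm2 x = (\<Sum>\<^sub>\<infinity>k. (norm (freq k) * norm (x k))\<^sup>2)"

lemma h1_norm2_nonneg: "h1_norm2 x \<ge> 0"
  unfolding h1_norm2_def by (rule infsum_nonneg) simp

lemma h1_norm2_finite: "h1_seq x \<Longrightarrow> finite K \<Longrightarrow> (\<Sum>k\<in>K. (norm (freq k) * norm (x k))\<^sup>2) \<le> h1_norm2 x"
  unfolding h1_norm2_def h1_seq_def by (intro finite_sum_le_infsum) auto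

lemma h1_seq_mono:
  assumes "h1_seq x" "\<And>k. norm (y k) \<le> norm (x k)"
  shows "h1_seq y"
proof -
  have "y 0 = 0" using assms(2)[of 0] assms(1) by (simp add: h1_seq_def)
  moreover have "(\<lambda>k. (norm (freq k) * norm (y k))\<^sup>2) summable_on UNIV"
  proof (rule summable_on_comparison_test)
    show "(\<lambda>k. (norm (freq k) * norm (x k))\<^sup>2) summable_on UNIV" using assms(1) by (simp add: h1_seq_def)
  qed (auto intro!: power_mono mult_left_mono assms(2))
  ultimately show ?thesis by (simp add: h1_seq_def)
qed

text \<open>Schur's test with the weight \<open>(\<bar>p\<bar> / \<bar>j\<bar>) powr (3/2)\<close>.\<close>

lemma kernel_bound:
  obtains C where "C > 0"
    "\<And>F X Y. finite F \<Longrightarrow> X 0 = 0 \<Longrightarrow> Y 0 = 0 \<Longrightarrow>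
      (\<Sum>(p, j)\<in>F. X p * Y j / (norm (freq p) * norm (freq j) * norm (freq (p + j))))
        \<le> C * ((\<Sum>p\<in>fst ` F. (X p)\<^sup>2) + (\<Sum>j\<in>snd ` F. (Y j)\<^sup>2))"
proof -
  obtain C where C: "C > 0" "\<And>k J. k \<noteq> 0 \<Longrightarrow> finite J \<Longrightarrow>
      (\<Sum>j\<in>J. norm (freq j) powr -(5/2) * norm (freq (k - j)) powr -1) \<le> C * norm (freq k) powr (3 - 5/2 - 1)"
    using lattice_convolution[of "5/2" 1] by auto
  \<comment> \<open>The kernel times the Schur weight, (|p| / |j|)^(3/2) / (|p| |j| |p + j|). Its
    sum over \<open>j\<close> is at most of order |p|^(1/2) |p|^(3 - 5/2 - 1), a constant; the
    exponents 5/2 and 1 lie in the range of the convolution estimate.\<close>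
  define W where "W = (\<lambda>p j. norm (freq p) powr (1/2) * (norm (freq j) powr -(5/2) * norm (freq (p + j)) powr -1))"
  have W: "(\<Sum>j\<in>J. W p j) \<le> C" if "finite J" "p \<noteq> 0" for p J
  proof -
    have n: "norm (freq (p + j)) = norm (freq (- p - j))" for j
      by (metis freq_simps(2,3,4) minus_add_distrib norm_minus_cancel diff_conv_add_uminus)
    have "(\<Sum>j\<in>J. W p j) = norm (freq p) powr (1/2) * (\<Sum>j\<in>J. norm (freq j) powr -(5/2) * norm (freq (- p - j)) powr -1)"
      unfolding W_def n by (simp only: sum_distrib_left)
    also have "\<dots> \<le> norm (freq p) powr (1/2) * (C * norm (freq (-p)) powr (3 - 5/2 - 1))"
      using that by (intro mult_left_mono C) auto
    also have "\<dots> = C * (norm (freq p) powr (1/2) * norm (freq p) powr (-(1/2)))" by simp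
    also have "\<dots> = C" using that(2) by (simp flip: powr_add)
    finally show ?thesis .
  qed
  have Wp: "W p j \<ge> 0" for p j by (simp add: W_def)
  show thesis
  proof (rule that[OF C(1)])
    fix F :: "((int^3) \<times> (int^3)) set" and X Y :: "int^3 \<Rightarrow> real"
    assume F: "finite F" and X0: "X 0 = 0" and Y0: "Y 0 = 0"
    have pt: "X p * Y j / (norm (freq p) * norm (freq j) * norm (freq (p + j))) \<le> (X p)\<^sup>2 * W p j + (Y j)\<^sup>2 * W j p" for p j
    proof (cases "p = 0 \<or> j = 0 \<or> p + j = 0")
      case True
      then have "X p * Y j / (norm (freq p) * norm (freq j) * norm (freq (p + j))) = 0"
        by (metis X0 Y0 divide_eq_0_iff freq_simps(1) mult_eq_0_iff norm_zero)
      moreover have "0 \<le> (X p)\<^sup>2 * W p j + (Y j)\<^sup>2 * W j p" using Wp by simp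
      ultimately show ?thesis by linarith
    next
      case False
      define a where "a = norm (freq p)"
      define b where "b = norm (freq j)"
      define c where "c = norm (freq (p + j))"
      have pos: "a > 0" "b > 0" "c > 0" using False by (auto simp: a_def b_def c_def simp del: freq_simps)
      \<comment> \<open>The square root of the Schur weight, used to split the product before
        Young's inequality.\<close>
      define s where "s = (a / b) powr (3/4)"
      have s: "s > 0" using pos by (simp add: s_def)
      have s2: "s\<^sup>2 = (a / b) powr (3/2)" "(1 / s)\<^sup>2 = (b / a) powr (3/2)"
        using pos by (simp_all add: s_def powr_divide power_divide powr_power)
      have Wab: "W p j = (a / b) powr (3/2) / (a * b * c)"
      proof -
        have "(a / b) powr (3/2) / (a * b * c) = (a powr (3/2) * a powr -1) * (b powr -(3/2) * b powr -1) * c powr -1"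
          using pos by (simp add: powr_divide powr_minus_divide)
        also have "\<dots> = a powr (1/2) * b powr -(5/2) * c powr -1" unfolding powr_add[symmetric] by simp
        finally show ?thesis by (simp add: W_def a_def b_def c_def)
      qed
      have Wba: "W j p = (b / a) powr (3/2) / (a * b * c)"
      proof -
        have "(b / a) powr (3/2) / (a * b * c) = (b powr (3/2) * b powr -1) * (a powr -(3/2) * a powr -1) * c powr -1"
          using pos by (simp add: powr_divide powr_minus_divide)
        also have "\<dots> = b powr (1/2) * a powr -(5/2) * c powr -1" unfolding powr_add[symmetric] by simp
        finally show ?thesis by (simp add: W_def a_def b_def c_def add.commute)
      qed
      have "X p * Y j = (s * X p) * (1 / s * Y j)" using s by simp
      also have "\<dots> \<le> (s * X p)\<^sup>2 + (1 / s * Y j)\<^sup>2"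
        using sum_squares_bound[of "s * X p" "1 / s * Y j"] zero_le_power2[of "s * X p"] zero_le_power2[of "1 / s * Y j"] by linarith
      also have "\<dots> = (X p)\<^sup>2 * (a / b) powr (3/2) + (Y j)\<^sup>2 * (b / a) powr (3/2)"
        by (simp only: power_mult_distrib s2 mult.commute)
      finally have "X p * Y j / (a * b * c) \<le> ((X p)\<^sup>2 * (a / b) powr (3/2) + (Y j)\<^sup>2 * (b / a) powr (3/2)) / (a * b * c)"
        using pos by (intro divide_right_mono) auto
      then show ?thesis unfolding Wab Wba a_def[symmetric] b_def[symmetric] c_def[symmetric]
        by (simp add: add_divide_distrib)
    qed
    define P where "P = fst ` F"
    define J where "J = snd ` F"
    have PJ: "finite P" "finite J" "F \<subseteq> P \<times> J" using F by (auto simp: P_def J_def) force+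
    have "(\<Sum>(p, j)\<in>F. X p * Y j / (norm (freq p) * norm (freq j) * norm (freq (p + j))))
        \<le> (\<Sum>(p, j)\<in>F. (X p)\<^sup>2 * W p j + (Y j)\<^sup>2 * W j p)"
      using pt by (intro sum_mono) auto
    also have "\<dots> \<le> (\<Sum>(p, j)\<in>P \<times> J. (X p)\<^sup>2 * W p j + (Y j)\<^sup>2 * W j p)"
      using PJ Wp by (intro sum_mono2) auto
    also have "\<dots> = (\<Sum>p\<in>P. \<Sum>j\<in>J. (X p)\<^sup>2 * W p j) + (\<Sum>p\<in>P. \<Sum>j\<in>J. (Y j)\<^sup>2 * W j p)"
      by (simp add: sum.cartesian_product[symmetric] sum.distrib)
    also have "(\<Sum>p\<in>P. \<Sum>j\<in>J. (Y j)\<^sup>2 * W j p) = (\<Sum>j\<in>J. \<Sum>p\<in>P. (Y j)\<^sup>2 * W j p)"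
      by (rule sum.swap)
    also have "(\<Sum>p\<in>P. \<Sum>j\<in>J. (X p)\<^sup>2 * W p j) + \<dots> \<le> (\<Sum>p\<in>P. (X p)\<^sup>2 * C) + (\<Sum>j\<in>J. (Y j)\<^sup>2 * C)"
    proof (intro add_mono sum_mono)
      show "(\<Sum>j\<in>J. (X p)\<^sup>2 * W p j) \<le> (X p)\<^sup>2 * C" for p
        using W[OF PJ(2), of p] X0 by (cases "p = 0") (auto simp flip: sum_distrib_left intro!: mult_left_mono)
      show "(\<Sum>p\<in>P. (Y j)\<^sup>2 * W j p) \<le> (Y j)\<^sup>2 * C" for j
        using W[OF PJ(1), of j] Y0 by (cases "j = 0") (auto simp flip: sum_distrib_left intro!: mult_left_mono)
    qed
    also have "\<dots> = C * ((\<Sum>p\<in>P. (X p)\<^sup>2) + (\<Sum>j\<in>J. (Y j)\<^sup>2))"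
      by (simp add: sum_distrib_left distrib_left mult.commute)
    finally show "(\<Sum>(p, j)\<in>F. X p * Y j / (norm (freq p) * norm (freq j) * norm (freq (p + j))))
        \<le> C * ((\<Sum>p\<in>fst ` F. (X p)\<^sup>2) + (\<Sum>j\<in>snd ` F. (Y j)\<^sup>2))" by (simp add: P_def J_def)
  qed
qed

lemma abs_tri_le:
  "\<bar>tri x y z (p, j)\<bar> \<le> norm (z (p + j)) * (2 * pi * cmod (cdot (x p) j) * norm (y j))"
proof -
  have "\<bar>tri x y z (p, j)\<bar> \<le> norm (z (p + j)) * norm ((2 * of_real pi * \<i> * cdot (x p) j) *s y j)"
    unfolding tri_def by (simp only: prod.case) (rule Cauchy_Schwarz_ineq2)
  then show ?thesis by (simp add: norm_vector_scalar_mult norm_mult)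
qed

text \<open>As \<open>x p\<close> is orthogonal to \<open>p\<close>, the derivative may be taken at
  the output: \<open>cdot (x p) j = cdot (x p) (p + j)\<close>. This uses up one of the two powers
  of |p + j| in the decay of \<open>z\<close>; what remains is the kernel of
  \<open>kernel_bound\<close>, acting on |p| |x_p| and |j| |y_j|.\<close>

lemma tri_bound:
  obtains C where "C > 0"
    "\<And>x y z r F. h1_seq x \<Longrightarrow> h1_seq y \<Longrightarrow> 0 \<le> r \<Longrightarrow> decay r z \<Longrightarrow> (\<And>p. cdot (x p) p = 0) \<Longrightarrow> finite F \<Longrightarrow>
      (\<Sum>q\<in>F. \<bar>tri x y z q\<bar>) \<le> C * r * (h1_norm2 x + h1_norm2 y)"
proof -
  obtain C where C: "C > 0" "\<And>F X Y. finite F \<Longrightarrow> X 0 = 0 \<Longrightarrow> Y 0 = 0 \<Longrightarrow>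
      (\<Sum>(p, j)\<in>F. X p * Y j / (norm (freq p) * norm (freq j) * norm (freq (p + j))))
        \<le> C * ((\<Sum>p\<in>fst ` F. (X p)\<^sup>2) + (\<Sum>j\<in>snd ` F. (Y j)\<^sup>2))"
    using kernel_bound by blast
  show thesis
  proof (rule that[of "2 * pi * C"])
    show "2 * pi * C > 0" using C by simp
    fix x y z :: "int^3 \<Rightarrow> complex^3" and r F
    assume x: "h1_seq x" and y: "h1_seq y" and r: "0 \<le> r" and z: "decay r z"
      and div: "\<And>p. cdot (x p) p = 0" and F: "finite (F :: ((int^3) \<times> (int^3)) set)"
    define X where "X = (\<lambda>k. norm (freq k) * norm (x k))"
    define Y where "Y = (\<lambda>k. norm (freq k) * norm (y k))"
    have x0: "x 0 = 0" "y 0 = 0" using x y by (auto simp: h1_seq_def)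
    have pt: "\<bar>tri x y z (p, j)\<bar> \<le> 2 * pi * r * (X p * Y j / (norm (freq p) * norm (freq j) * norm (freq (p + j))))" for p j
    proof (cases "p = 0 \<or> j = 0 \<or> p + j = 0")
      case True
      have "z 0 = 0" using z[rule_format, of 0] by simp
      then have "tri x y z (p, j) = 0" using True x0 by (auto simp: tri_def cdot_def)
      then show ?thesis using r by (simp add: X_def Y_def)
    next
      case False
      define a where "a = norm (freq p)"
      define b where "b = norm (freq j)"
      define c where "c = norm (freq (p + j))"
      have pos: "a > 0" "b > 0" "c > 0" using False by (auto simp: a_def b_def c_def simp del: freq_simps)
      have "cdot (x p) j = cdot (x p) (p + j)" by (simp add: cdot_add_right div)
      then have "cmod (cdot (x p) j) \<le> norm (x p) * c" unfolding c_def using norm_cdot_le by metis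
      then have "norm (z (p + j)) * (2 * pi * cmod (cdot (x p) j) * norm (y j)) \<le> (r / c\<^sup>2) * (2 * pi * (norm (x p) * c) * norm (y j))"
        using z[rule_format, of "p + j"] r by (intro mult_mono) (auto simp: c_def)
      also have "\<dots> = 2 * pi * r * (X p * Y j / (a * b * c))"
        using pos unfolding X_def Y_def a_def[symmetric] b_def[symmetric] by (simp add: power2_eq_square divide_simps)
      finally show ?thesis using abs_tri_le[of x y z p j] by (simp add: a_def b_def c_def)
    qed
    have "(\<Sum>q\<in>F. \<bar>tri x y z q\<bar>) \<le> (\<Sum>(p, j)\<in>F. 2 * pi * r * (X p * Y j / (norm (freq p) * norm (freq j) * norm (freq (p + j)))))"
      using pt by (intro sum_mono) auto
    also have "\<dots> = 2 * pi * r * (\<Sum>(p, j)\<in>F. X p * Y j / (norm (freq p) * norm (freq j) * norm (freq (p + j))))"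
      by (simp only: sum_distrib_left case_prod_unfold)
    also have "\<dots> \<le> 2 * pi * r * (C * ((\<Sum>p\<in>fst ` F. (X p)\<^sup>2) + (\<Sum>j\<in>snd ` F. (Y j)\<^sup>2)))"
      using r F by (intro mult_left_mono C) (auto simp: X_def Y_def)
    also have "\<dots> \<le> 2 * pi * r * (C * (h1_norm2 x + h1_norm2 y))"
      unfolding X_def Y_def using r C F x y by (intro mult_left_mono add_mono h1_norm2_finite) auto
    finally show "(\<Sum>q\<in>F. \<bar>tri x y z q\<bar>) \<le> 2 * pi * C * r * (h1_norm2 x + h1_norm2 y)" by (simp only: mult_ac)
  qed
qed

text \<open>With the derivative at the output k = p + j, the sum of |j|^-2 |k - j|^-2 is O(1 / |k|)
  and exactly compensates the factor |k|. Hence \<open>w\<close> enters only through the sum of its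
  norms.\<close>

lemma tri_bound_decay:
  obtains C where "C > 0"
    "\<And>v w r B F. 0 \<le> r \<Longrightarrow> decay r v \<Longrightarrow> (\<And>p. cdot (v p) p = 0) \<Longrightarrow>
      (\<And>K. finite K \<Longrightarrow> (\<Sum>k\<in>K. norm (w k)) \<le> B) \<Longrightarrow> w 0 = 0 \<Longrightarrow> finite F \<Longrightarrow>
      (\<Sum>q\<in>F. \<bar>tri v v w q\<bar>) \<le> C * r\<^sup>2 * B"
proof -
  obtain C where C: "C > 0" "\<And>k J. k \<noteq> 0 \<Longrightarrow> finite J \<Longrightarrow>
      (\<Sum>j\<in>J. norm (freq j) powr -2 * norm (freq (k - j)) powr -2) \<le> C * norm (freq k) powr (3 - 2 - 2)"
    using lattice_convolution[of 2 2] by auto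
  show thesis
  proof (rule that[of "2 * pi * C"])
    show "2 * pi * C > 0" using C by simp
    fix v w :: "int^3 \<Rightarrow> complex^3" and r B F
    assume r: "0 \<le> r" and v: "decay r v" and div: "\<And>p. cdot (v p) p = 0"
      and w: "\<And>K. finite K \<Longrightarrow> (\<Sum>k\<in>K. norm (w k)) \<le> B" and w0: "w 0 = 0"
      and F: "finite (F :: ((int^3) \<times> (int^3)) set)"
    define f where "f = (\<lambda>k j. 2 * pi * r\<^sup>2 * (norm (w k) * norm (freq k) * (norm (freq j) powr -2 * norm (freq (k - j)) powr -2)))"
    have f0: "f k j \<ge> 0" for k j by (simp add: f_def)
    have pw: "norm (freq k) powr -2 = 1 / (norm (freq k))\<^sup>2" for k
      by (cases "k = 0") (simp_all add: powr_minus_divide)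
    have pt: "\<bar>tri v v w (p, j)\<bar> \<le> f (p + j) j" for p j
    proof -
      have "cdot (v p) j = cdot (v p) (p + j)" by (simp add: cdot_add_right div)
      then have "cmod (cdot (v p) j) \<le> norm (v p) * norm (freq (p + j))" using norm_cdot_le by metis
      also have "\<dots> \<le> (r / (norm (freq p))\<^sup>2) * norm (freq (p + j))" using v by (intro mult_right_mono) auto
      finally have "norm (w (p + j)) * (2 * pi * cmod (cdot (v p) j) * norm (v j))
          \<le> norm (w (p + j)) * (2 * pi * ((r / (norm (freq p))\<^sup>2) * norm (freq (p + j))) * (r / (norm (freq j))\<^sup>2))"
        using v r by (intro mult_left_mono mult_mono) auto
      also have "\<dots> = f (p + j) j" by (simp add: f_def pw power2_eq_square)
      finally show ?thesis using abs_tri_le[of v v w p j] by linarith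
    qed
    define K where "K = (\<lambda>(p, j). p + j) ` F"
    define J where "J = snd ` F"
    have KJ: "finite K" "finite J" using F by (auto simp: K_def J_def)
    have inj: "inj_on (\<lambda>(p, j). (p + j, j) :: (int^3) \<times> (int^3)) F" by (auto simp: inj_on_def)
    have "(\<Sum>q\<in>F. \<bar>tri v v w q\<bar>) \<le> (\<Sum>(p, j)\<in>F. f (p + j) j)"
      using pt by (intro sum_mono) auto
    also have "\<dots> = (\<Sum>(k, j)\<in>(\<lambda>(p, j). (p + j, j)) ` F. f k j)"
      by (subst sum.reindex[OF inj]) (auto intro!: sum.cong)
    also have "\<dots> \<le> (\<Sum>(k, j)\<in>K \<times> J. f k j)"
      using KJ f0 by (intro sum_mono2) (auto simp: K_def J_def image_iff, force+)
    also have "\<dots> = (\<Sum>k\<in>K. \<Sum>j\<in>J. f k j)" by (simp add: sum.cartesian_product)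
    also have "\<dots> \<le> (\<Sum>k\<in>K. 2 * pi * r\<^sup>2 * C * norm (w k))"
    proof (rule sum_mono)
      fix k
      show "(\<Sum>j\<in>J. f k j) \<le> 2 * pi * r\<^sup>2 * C * norm (w k)"
      proof (cases "k = 0")
        case True then show ?thesis by (simp add: f_def w0)
      next
        case False
        have "(\<Sum>j\<in>J. f k j) = 2 * pi * r\<^sup>2 * (norm (w k) * norm (freq k) * (\<Sum>j\<in>J. norm (freq j) powr -2 * norm (freq (k - j)) powr -2))"
          by (simp only: f_def sum_distrib_left)
        also have "\<dots> \<le> 2 * pi * r\<^sup>2 * (norm (w k) * norm (freq k) * (C * norm (freq k) powr (3 - 2 - 2)))"
          using False KJ by (intro mult_left_mono C) auto
        also have "\<dots> = 2 * pi * r\<^sup>2 * C * norm (w k)"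
          using False by (simp add: powr_minus_divide)
        finally show ?thesis .
      qed
    qed
    also have "\<dots> = 2 * pi * r\<^sup>2 * C * (\<Sum>k\<in>K. norm (w k))" by (simp only: sum_distrib_left)
    also have "\<dots> \<le> 2 * pi * r\<^sup>2 * C * B" using C r KJ by (intro mult_left_mono w) auto
    finally show "(\<Sum>q\<in>F. \<bar>tri v v w q\<bar>) \<le> 2 * pi * C * r\<^sup>2 * B" by (simp only: mult_ac)
  qed
qed

subsection \<open>Truncation of Fourier coefficients\<close>

text \<open>For nonnegative \<open>\<rho>\<close> the nearest-point projection to the ball of radius
  \<open>\<rho>\<close>. The maximum replaces a case distinction; for \<open>\<rho> = 0\<close> the
  result is 0 even at \<open>a = 0\<close>, where the quotient is 0 / 0.\<close>

definition clip :: "real \<Rightarrow> 'a::real_inner \<Rightarrow> 'a" where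
  "clip \<rho> a = (\<rho> / max \<rho> (norm a)) *\<^sub>R a"

lemma clip_eq_self: "0 \<le> \<rho> \<Longrightarrow> norm a \<le> \<rho> \<Longrightarrow> clip \<rho> a = a"
  by (cases "\<rho> = 0") (auto simp: clip_def max_def)

lemma norm_clip_le: "0 \<le> \<rho> \<Longrightarrow> norm (clip \<rho> a) \<le> \<rho>" "0 \<le> \<rho> \<Longrightarrow> norm (clip \<rho> a) \<le> norm a"
proof -
  assume r: "0 \<le> \<rho>"
  have "\<rho> / max \<rho> (norm a) * norm a \<le> \<rho>"
    using r mult_left_mono[of "norm a" "max \<rho> (norm a)" \<rho>]
    by (cases "max \<rho> (norm a) = 0") (auto simp: divide_simps max_def)
  then show "norm (clip \<rho> a) \<le> \<rho>" using r by (simp add: clip_def)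
  have "\<rho> / max \<rho> (norm a) \<le> 1" using r by (cases "max \<rho> (norm a) = 0") (auto simp: divide_simps max_def)
  then have "\<rho> / max \<rho> (norm a) * norm a \<le> norm a" using mult_right_mono by fastforce
  then show "norm (clip \<rho> a) \<le> norm a" using r by (simp add: clip_def)
qed

lemma clip_beyond:
  assumes "0 \<le> \<rho>" "\<rho> < norm a"
  shows "norm (clip \<rho> a) = \<rho>" "norm (a - clip \<rho> a) = norm a - \<rho>"
    "a \<bullet> clip \<rho> a = \<rho> * norm a"
proof -
  have n: "norm a > 0" using assms by linarith
  have c: "clip \<rho> a = (\<rho> / norm a) *\<^sub>R a" using assms by (simp add: clip_def max_def)
  show "norm (clip \<rho> a) = \<rho>" using n assms by (simp add: c)
  have "a - clip \<rho> a = (1 - \<rho> / norm a) *\<^sub>R a" by (simp add: c scaleR_left_diff_distrib)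
  moreover have "1 - \<rho> / norm a \<ge> 0" using assms n by simp
  ultimately have "norm (a - clip \<rho> a) = (1 - \<rho> / norm a) * norm a" by simp
  then show "norm (a - clip \<rho> a) = norm a - \<rho>" using n by (simp add: left_diff_distrib)
  show "a \<bullet> clip \<rho> a = \<rho> * norm a"
    using n by (simp add: c dot_square_norm power2_eq_square)
qed

lemma clip_nearest:
  assumes "0 \<le> \<rho>" "norm b \<le> \<rho>"
  shows "norm (a - clip \<rho> a) \<le> norm (a - b)"
proof (cases "norm a \<le> \<rho>")
  case False
  have "norm a - norm b \<le> norm (a - b)" by (rule norm_triangle_ineq2)
  then show ?thesis using clip_beyond[of \<rho> a] False assms by simp
qed (use assms in \<open>simp add: clip_eq_self\<close>)

lemma continuous_on_clip:
  assumes "0 \<le> \<rho>" "continuous_on S f"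
  shows "continuous_on S (\<lambda>x. clip \<rho> (f x))"
proof (cases "\<rho> = 0")
  case False
  then have "\<forall>x\<in>S. max \<rho> (norm (f x)) \<noteq> 0" using assms(1) by (auto simp: max_def)
  then show ?thesis unfolding clip_def using assms(2) by (intro continuous_intros)
qed (simp add: clip_def)

text \<open>For \<rho> >= 0 this is the Huber function: |a|^2 inside the ball and 2 \<rho> |a| -
  \<rho>^2 outside. It equals the maximum of 2 <a, b> - |b|^2 over |b| <= \<rho>, attained at the
  projection of a.\<close>

definition clip_energy :: "real \<Rightarrow> 'a::real_inner \<Rightarrow> real" where
  "clip_energy \<rho> a = (norm a)\<^sup>2 - (norm (a - clip \<rho> a))\<^sup>2"

text \<open>In a maximum of affine functions the one that is active at \<open>a\<close> supports the
  graph. Concretely, \<open>clip \<rho> a\<close> is a competitor for the point of the ball that is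
  nearest to \<open>b\<close>.\<close>

lemma clip_energy_subgradient:
  assumes "0 \<le> \<rho>"
  shows "clip_energy \<rho> b \<ge> clip_energy \<rho> a + 2 * (clip \<rho> a \<bullet> (b - a))"
proof -
  have "norm (b - clip \<rho> b) \<le> norm (b - clip \<rho> a)"
    using assms by (intro clip_nearest norm_clip_le)
  then have "(norm (b - clip \<rho> b))\<^sup>2 \<le> (norm (b - clip \<rho> a))\<^sup>2" by (intro power_mono) auto
  then show ?thesis
    unfolding clip_energy_def power2_norm_eq_inner
    by (simp add: inner_diff_left inner_diff_right inner_commute algebra_simps)
qed

abbreviation clip_seq :: "real \<Rightarrow> (int^3 \<Rightarrow> complex^3) \<Rightarrow> int^3 \<Rightarrow> complex^3" where
  "clip_seq r a k \<equiv> clip (r / (norm (freq k))\<^sup>2) (a k)"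

text \<open>On a clipped mode \<open>v\<close> is parallel to \<open>a\<close> and has norm \<rho> =
  r / |k|^2, so |a|^2 - <a, v> = |a| |w| = |w|^2 + \<rho> |w|. The weight |k|^2 turns the linear
  term into r |w|; this gain absorbs T(v, v, w).\<close>

lemma clip_seq_identity:
  assumes r: "0 < r" and a0: "a 0 = 0"
  shows "(norm (freq k) * norm (a k))\<^sup>2 - (norm (freq k))\<^sup>2 * (a k \<bullet> clip_seq r a k) =
    (norm (freq k) * norm (a k - clip_seq r a k))\<^sup>2 + r * norm (a k - clip_seq r a k)"
proof (cases "norm (a k) \<le> r / (norm (freq k))\<^sup>2")
  case True
  then have "clip_seq r a k = a k" using r by (intro clip_eq_self) auto
  then show ?thesis by (simp add: power_mult_distrib dot_square_norm)
next
  case False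
  then have k: "k \<noteq> 0" using a0 by auto
  define n where "n = norm (freq k)"
  define A where "A = norm (a k)"
  have n: "n > 0" using k by (simp add: n_def)
  have "r / n\<^sup>2 \<ge> 0" using r by simp
  note cb = clip_beyond[OF this, of "a k", folded A_def]
  have lt: "r / n\<^sup>2 < A" using False by (simp add: n_def A_def)
  have "(n * A)\<^sup>2 - n\<^sup>2 * (r / n\<^sup>2 * A) = (n * (A - r / n\<^sup>2))\<^sup>2 + r * (A - r / n\<^sup>2)"
    using n by (simp add: field_simps power2_eq_square)
  then show ?thesis using cb(2,3)[OF lt] by (simp add: n_def[symmetric] A_def[symmetric])
qed

lemma has_sum_of_bound:
  fixes f :: "'a \<Rightarrow> real"
  assumes "\<And>F. finite F \<Longrightarrow> (\<Sum>q\<in>F. \<bar>f q\<bar>) \<le> B"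
  shows "f summable_on UNIV" "\<bar>infsum f UNIV\<bar> \<le> B" "(\<lambda>q. norm (f q)) summable_on UNIV"
proof -
  show s: "(\<lambda>q. norm (f q)) summable_on UNIV"
    by (rule nonneg_bdd_above_summable_on) (use assms in \<open>auto intro!: bdd_aboveI[of _ B]\<close>)
  then show "f summable_on UNIV" by (rule abs_summable_summable)
  have "\<bar>infsum f UNIV\<bar> \<le> (\<Sum>\<^sub>\<infinity>q. norm (f q))" using norm_infsum_bound[OF s] by simp
  also have "\<dots> \<le> B" using s assms by (intro infsum_le_finite_sums) auto
  finally show "\<bar>infsum f UNIV\<bar> \<le> B" .
qed

lemma has_sum_minus:
  fixes f g :: "'a \<Rightarrow> real"
  assumes "(f has_sum S) A" "(g has_sum T) A"
  shows "((\<lambda>x. f x - g x) has_sum (S - T)) A"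
  using has_sum_add[OF assms(1), of "\<lambda>x. - g x" "- T"] assms(2) by (simp add: has_sum_uminus)

text \<open>
  Write \<open>T x y z\<close> for the sum of \<^const>\<open>tri\<close>, \<open>v\<close> for the truncation of \<open>a\<close>, and \<open>w = a - v\<close>. Since
  \<open>T x y z = - T x z y\<close>, one has \<open>T a a v = T a w v = - T a v w = - T v v w + T w w v\<close>; every sum
  involved converges absolutely because one of its entries is truncated.
\<close>

lemma tri_clip_dissipation:
  obtains r0 where "r0 > 0"
    "\<And>a r. h1_seq a \<Longrightarrow> (\<And>k. cdot (a k) k = 0) \<Longrightarrow> (\<And>k i. a (- k) $ i = cnj (a k $ i)) \<Longrightarrow>
      0 < r \<Longrightarrow> r \<le> r0 \<Longrightarrow>
      tri a a (clip_seq r a) summable_on UNIV \<and>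
      (\<lambda>k. (norm (freq k))\<^sup>2 * (a k \<bullet> clip_seq r a k)) summable_on UNIV \<and>
      4 * pi\<^sup>2 * (\<Sum>\<^sub>\<infinity>k. (norm (freq k))\<^sup>2 * (a k \<bullet> clip_seq r a k)) +
        (\<Sum>\<^sub>\<infinity>q. tri a a (clip_seq r a) q) \<le> 4 * pi\<^sup>2 * h1_norm2 a"
proof -
  obtain C2 where C2: "C2 > 0" "\<And>x y z r F. h1_seq x \<Longrightarrow> h1_seq y \<Longrightarrow> 0 \<le> r \<Longrightarrow> decay r z \<Longrightarrow> (\<And>p. cdot (x p) p = 0) \<Longrightarrow> finite F \<Longrightarrow>
      (\<Sum>q\<in>F. \<bar>tri x y z q\<bar>) \<le> C2 * r * (h1_norm2 x + h1_norm2 y)"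
    using tri_bound by blast
  obtain C1 where C1: "C1 > 0" "\<And>v w r B F. 0 \<le> r \<Longrightarrow> decay r v \<Longrightarrow> (\<And>p. cdot (v p) p = 0) \<Longrightarrow>
      (\<And>K. finite K \<Longrightarrow> (\<Sum>k\<in>K. norm (w k)) \<le> B) \<Longrightarrow> w 0 = 0 \<Longrightarrow> finite F \<Longrightarrow>
      (\<Sum>q\<in>F. \<bar>tri v v w q\<bar>) \<le> C1 * r\<^sup>2 * B"
    using tri_bound_decay by blast
  \<comment> \<open>The first entry lets the linear gain, 4 pi^2 r times the sum of |w_k|, absorb
    T(v, v, w); the second lets 4 pi^2 times \<open>h1_norm2 w\<close> absorb T(w, w, v).\<close>
  define r0 where "r0 = min (4 * pi\<^sup>2 / C1) (2 * pi\<^sup>2 / C2)"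
  show thesis
  proof (rule that[of r0])
    show "r0 > 0" using C1 C2 by (simp add: r0_def)
    fix a r
    assume a: "h1_seq a" and div: "\<And>k. cdot (a k) k = 0" and re: "\<And>k i. a (- k) $ i = cnj (a k $ i)"
      and r: "0 < r" "r \<le> r0"
    define v where "v = clip_seq r a"
    define w where "w = (\<lambda>k. a k - v k)"
    have a0: "a 0 = 0" using a by (simp add: h1_seq_def)
    have rk: "r / (norm (freq k))\<^sup>2 \<ge> 0" for k using r by simp
    have vk: "clip_seq r a k = v k" for k by (simp add: v_def)
    have vdec: "decay r v" unfolding v_def using norm_clip_le(1)[OF rk] by blast
    have vle: "norm (v k) \<le> norm (a k)" for k unfolding v_def using norm_clip_le(2)[OF rk] by blast
    have v_scale: "\<exists>s. v k = s *\<^sub>R a k" for k unfolding v_def clip_def by blast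
    have wle: "norm (w k) \<le> norm (a k)" for k
      using clip_nearest[OF rk, of 0 k "a k"] by (simp add: w_def v_def rk)
    have vh: "h1_seq v" using h1_seq_mono[OF a vle] .
    have wh: "h1_seq w" using h1_seq_mono[OF a wle] .
    have vdiv: "cdot (v k) k = 0" for k using v_scale[of k] div[of k] by (auto simp: cdot_scaleR_left)
    have wdiv: "cdot (w k) k = 0" for k by (simp add: w_def cdot_diff_left div vdiv)
    have vre: "v (- k) $ i = cnj (v k $ i)" for k i
    proof -
      \<comment> \<open>The scaling factor depends on |k| and |a_k| only, hence is the same at
        \<open>k\<close> and \<open>- k\<close>.\<close>
      have "norm (a (- k)) = norm (a k)" by (simp add: norm_vec_def re)
      then show ?thesis by (simp add: v_def clip_def re)
    qed
    have wre: "w (- k) $ i = cnj (w k $ i)" for k i by (simp add: w_def re vre)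
    have w0: "w 0 = 0" using wle[of 0] a0 by simp
    have aw: "(\<lambda>k. v k + w k) = a" "(\<lambda>k. w k + v k) = a" by (auto simp: w_def)
    define T where "T = (\<lambda>x y z. \<Sum>\<^sub>\<infinity>q. tri x y z q)"
    have ts: "(tri x y v has_sum T x y v) UNIV" "\<bar>T x y v\<bar> \<le> C2 * r * (h1_norm2 x + h1_norm2 y)"
      if "h1_seq x" "h1_seq y" "\<And>p. cdot (x p) p = 0" for x y
    proof -
      have "(\<Sum>q\<in>F. \<bar>tri x y v q\<bar>) \<le> C2 * r * (h1_norm2 x + h1_norm2 y)" if "finite F" for F
        using C2(2)[OF \<open>h1_seq x\<close> \<open>h1_seq y\<close> _ vdec] that \<open>\<And>p. cdot (x p) p = 0\<close> r by simp
      note has_sum_of_bound[OF this]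
      then show "(tri x y v has_sum T x y v) UNIV" "\<bar>T x y v\<bar> \<le> C2 * r * (h1_norm2 x + h1_norm2 y)"
        by (auto simp: T_def)
    qed
    have s_avv: "(tri a v v has_sum T a v v) UNIV" and s_aav: "(tri a a v has_sum T a a v) UNIV"
      and s_awv: "(tri a w v has_sum T a w v) UNIV" and s_wwv: "(tri w w v has_sum T w w v) UNIV"
      using ts(1) a vh wh div wdiv by blast+
    \<comment> \<open>Antisymmetry with two equal entries makes the sum its own negative.\<close>
    have "(tri a v v has_sum - T a v v) UNIV" by (rule tri_swap_has_sum[OF div vre vre s_avv])
    then have "T a v v = - T a v v" using s_avv has_sum_unique by blast
    then have z: "T a v v = 0" by simp
    have s_avw: "(tri a v w has_sum - T a w v) UNIV" by (rule tri_swap_has_sum[OF div wre vre s_awv])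
    have s_wvw: "(tri w v w has_sum - T w w v) UNIV" by (rule tri_swap_has_sum[OF wdiv wre vre s_wwv])
    have "T a a v = T a v v + T a w v"
    proof -
      have "tri a a v = (\<lambda>q. tri a v v q + tri a w v q)"
        using tri_add(2)[of a v w v] by (auto simp: aw)
      then show ?thesis using has_sum_add[OF s_avv s_awv] s_aav has_sum_unique by metis
    qed
    have s_vvw: "(tri v v w has_sum - T a w v - - T w w v) UNIV"
    proof -
      have "tri v v w = (\<lambda>q. tri a v w q - tri w v w q)"
        using tri_add(1)[of v w v w] by (auto simp: aw)
      then show ?thesis using has_sum_minus[OF s_avw s_wvw] by simp
    qed
    \<comment> \<open>A mode with \<open>w k \<noteq> 0\<close> has r < |k|^2 |a_k|; multiplication
      by |w_k| <= |a_k| then puts \<open>w\<close> into l^1.\<close>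
    have wpt: "r * norm (w k) \<le> (norm (freq k) * norm (a k))\<^sup>2" for k
    proof (cases "norm (a k) \<le> r / (norm (freq k))\<^sup>2")
      case True
      then have "w k = 0" using clip_eq_self[OF rk True] by (simp add: w_def v_def)
      then show ?thesis by simp
    next
      case False
      then have k: "k \<noteq> 0" using a0 by auto
      then have "r \<le> (norm (freq k))\<^sup>2 * norm (a k)" using False by (simp add: divide_simps mult.commute split: if_splits)
      then have "r * norm (w k) \<le> ((norm (freq k))\<^sup>2 * norm (a k)) * norm (a k)"
        using wle r by (intro mult_mono) auto
      then show ?thesis by (simp add: power_mult_distrib power2_eq_square mult_ac)
    qed
    have ws: "(\<lambda>k. norm (w k)) summable_on UNIV"
    proof (rule summable_on_comparison_test)
      show "(\<lambda>k. (1 / r) * (norm (freq k) * norm (a k))\<^sup>2) summable_on UNIV"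
        using a by (intro summable_on_cmult_right) (simp add: h1_seq_def)
      show "norm (w k) \<le> (1 / r) * (norm (freq k) * norm (a k))\<^sup>2" for k
        using wpt[of k] r by (simp add: pos_le_divide_eq mult.commute)
    qed auto
    define B where "B = (\<Sum>\<^sub>\<infinity>k. norm (w k))"
    have B0: "B \<ge> 0" unfolding B_def by (rule infsum_nonneg) simp
    have Bf: "(\<Sum>k\<in>K. norm (w k)) \<le> B" if "finite K" for K
      unfolding B_def using that ws by (intro finite_sum_le_infsum) auto
    have "(\<Sum>q\<in>F. \<bar>tri v v w q\<bar>) \<le> C1 * r\<^sup>2 * B" if "finite F" for F
      using C1(2)[OF _ vdec vdiv Bf w0 that] r by simp
    note has_sum_of_bound[OF this]
    then have "\<bar>- T a w v - - T w w v\<bar> \<le> C1 * r\<^sup>2 * B" using infsumI[OF s_vvw] by simp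
    moreover have "\<bar>T w w v\<bar> \<le> C2 * r * (h1_norm2 w + h1_norm2 w)" by (rule ts(2)[OF wh wh wdiv])
    ultimately have Tb: "T a a v \<le> C1 * r\<^sup>2 * B + C2 * r * (2 * h1_norm2 w)"
      using \<open>T a a v = T a v v + T a w v\<close> z by (simp add: abs_le_iff)
    have e1: "C1 * r\<^sup>2 * B \<le> 4 * pi\<^sup>2 * (r * B)"
    proof -
      have "C1 * r \<le> 4 * pi\<^sup>2" using r C1 by (simp add: r0_def pos_le_divide_eq mult.commute)
      then have "C1 * r * (r * B) \<le> 4 * pi\<^sup>2 * (r * B)" using r B0 by (intro mult_right_mono) auto
      then show ?thesis by (simp add: power2_eq_square mult_ac)
    qed
    have e2: "C2 * r * (2 * h1_norm2 w) \<le> 4 * pi\<^sup>2 * h1_norm2 w"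
    proof -
      have "C2 * r \<le> 2 * pi\<^sup>2" using r C2 by (simp add: r0_def pos_le_divide_eq mult.commute)
      then have "C2 * r * (2 * h1_norm2 w) \<le> 2 * pi\<^sup>2 * (2 * h1_norm2 w)"
        using h1_norm2_nonneg[of w] by (intro mult_right_mono) auto
      then show ?thesis by simp
    qed
    have hs_a: "((\<lambda>k. (norm (freq k) * norm (a k))\<^sup>2) has_sum h1_norm2 a) UNIV"
      using a by (simp add: h1_seq_def h1_norm2_def)
    have hs_w: "((\<lambda>k. (norm (freq k) * norm (w k))\<^sup>2) has_sum h1_norm2 w) UNIV"
      using wh by (simp add: h1_seq_def h1_norm2_def)
    have hs_B: "((\<lambda>k. norm (w k)) has_sum B) UNIV" using ws by (simp add: B_def)
    have "((\<lambda>k. (norm (freq k) * norm (a k))\<^sup>2 - ((norm (freq k) * norm (w k))\<^sup>2 + r * norm (w k))) has_sum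
        h1_norm2 a - (h1_norm2 w + r * B)) UNIV"
      by (intro has_sum_minus has_sum_add has_sum_cmult_right hs_a hs_w hs_B)
    also have "(\<lambda>k. (norm (freq k) * norm (a k))\<^sup>2 - ((norm (freq k) * norm (w k))\<^sup>2 + r * norm (w k))) =
        (\<lambda>k. (norm (freq k))\<^sup>2 * (a k \<bullet> v k))"
      using clip_seq_identity[of r a, OF r(1) a0] by (simp add: fun_eq_iff w_def v_def algebra_simps)
    finally have hs_v: "((\<lambda>k. (norm (freq k))\<^sup>2 * (a k \<bullet> v k)) has_sum h1_norm2 a - (h1_norm2 w + r * B)) UNIV" .
    have "4 * pi\<^sup>2 * (h1_norm2 a - (h1_norm2 w + r * B)) + T a a v \<le> 4 * pi\<^sup>2 * h1_norm2 a"
      using Tb e1 e2 by (simp add: algebra_simps)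
    then show "tri a a (clip_seq r a) summable_on UNIV \<and>
      (\<lambda>k. (norm (freq k))\<^sup>2 * (a k \<bullet> clip_seq r a k)) summable_on UNIV \<and>
      4 * pi\<^sup>2 * (\<Sum>\<^sub>\<infinity>k. (norm (freq k))\<^sup>2 * (a k \<bullet> clip_seq r a k)) +
        (\<Sum>\<^sub>\<infinity>q. tri a a (clip_seq r a) q) \<le> 4 * pi\<^sup>2 * h1_norm2 a"
      using hs_v s_aav infsumI[OF hs_v] unfolding v_def[symmetric] vk T_def
      by (auto simp: has_sum_imp_summable)
  qed
qed

subsection \<open>Energy increments of truncated modes\<close>

lemma set_integral_Icc_split:
  fixes f :: "real \<Rightarrow> 'a::{banach,second_countable_topology}"
  assumes f: "set_integrable lebesgue {0..t} f" and s: "0 \<le> s" "s \<le> s'" "s' \<le> t"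
  shows "(LINT x:{0..s'}|lebesgue. f x) = (LINT x:{0..s}|lebesgue. f x) + (LINT x:{s<..s'}|lebesgue. f x)"
proof -
  have "{0..s'} = {0..s} \<union> {s<..s'}" using s by auto
  moreover have "set_integrable lebesgue {0..s} f" "set_integrable lebesgue {s<..s'} f"
    using s by (auto intro: set_integrable_subset[OF f])
  moreover have "{0..s} \<inter> {s<..s'} = {}" by auto
  ultimately show ?thesis using set_integral_Un[of "{0..s}" "{s<..s'}" lebesgue f] by simp
qed

lemma set_integral_lebesgue_singleton:
  fixes f :: "real \<Rightarrow> 'a::{banach,second_countable_topology}"
  shows "(LINT x:{a}|lebesgue. f x) = 0"
proof -
  have "AE x in lebesgue. x \<noteq> a" by (rule AE_completion[OF AE_lborel_singleton])
  then show ?thesis unfolding set_lebesgue_integral_def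
    by (intro integral_eq_zero_AE) (auto elim!: eventually_mono)
qed

lemma set_integrable_inner_continuous:
  fixes v h :: "real \<Rightarrow> 'a::euclidean_space"
  assumes v: "continuous_on {0..t} v" and h: "set_integrable lebesgue {0..t} h"
  shows "set_integrable lebesgue {0..t} (\<lambda>s. v s \<bullet> h s)"
proof -
  have "compact (v ` {0..t})" by (intro compact_continuous_image v) auto
  then have "bounded (v ` {0..t})" by (rule compact_imp_bounded)
  then obtain B where "\<forall>x\<in>v ` {0..t}. norm x \<le> B" unfolding bounded_iff by blast
  then have B: "norm (v s) \<le> B" if "s \<in> {0..t}" for s using that by blast
  have "v \<in> borel_measurable (lebesgue_on {0..t})"
    by (rule continuous_imp_measurable_on_sets_lebesgue[OF v]) auto
  then have vm: "(\<lambda>s. indicator {0..t} s *\<^sub>R v s) \<in> borel_measurable lebesgue"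
    by (subst borel_measurable_restrict_space_iff[symmetric]) auto
  have hm: "integrable lebesgue (\<lambda>s. indicator {0..t} s *\<^sub>R h s)" using h by (simp add: set_integrable_def)
  have eq: "indicator {0..t} s *\<^sub>R (v s \<bullet> h s) = (indicator {0..t} s *\<^sub>R v s) \<bullet> (indicator {0..t} s *\<^sub>R h s)" for s
    by (simp add: indicator_def)
  show ?thesis unfolding set_integrable_def
  proof (rule Bochner_Integration.integrable_bound)
    show "integrable lebesgue (\<lambda>s. B *\<^sub>R norm (indicator {0..t} s *\<^sub>R h s))"
      using hm by (intro integrable_scaleR_right integrable_norm)
    show "(\<lambda>s. indicator {0..t} s *\<^sub>R (v s \<bullet> h s)) \<in> borel_measurable lebesgue"
      unfolding eq using vm hm by (intro borel_measurable_inner) auto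
    show "AE s in lebesgue. norm (indicator {0..t} s *\<^sub>R (v s \<bullet> h s)) \<le> norm (B *\<^sub>R norm (indicator {0..t} s *\<^sub>R h s))"
    proof (rule AE_I2)
      fix s
      show "norm (indicator {0..t} s *\<^sub>R (v s \<bullet> h s)) \<le> norm (B *\<^sub>R norm (indicator {0..t} s *\<^sub>R h s))"
      proof (cases "s \<in> {0..t}")
        case True
        have "\<bar>v s \<bullet> h s\<bar> \<le> norm (v s) * norm (h s)" by (rule Cauchy_Schwarz_ineq2)
        also have "\<dots> \<le> B * norm (h s)" using B[OF True] by (intro mult_right_mono) auto
        also have "\<dots> \<le> \<bar>B\<bar> * norm (h s)" by (intro mult_right_mono) auto
        finally show ?thesis using True by (simp add: abs_mult)
      qed simp
    qed
  qed
qed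

text \<open>
  Convexity bounds the increment of the truncated energy over a short interval from below by the
  integral with \<open>clip \<rho> (y \<tau>)\<close> frozen at the left end point; uniform continuity removes the freezing.
\<close>

lemma clip_energy_increment:
  fixes y h :: "real \<Rightarrow> 'a::euclidean_space"
  assumes t: "0 \<le> t" and \<rho>: "0 \<le> \<rho>" and y: "continuous_on {0..t} y"
    and h: "set_integrable lebesgue {0..t} h"
    and ode: "\<And>s s'. 0 \<le> s \<Longrightarrow> s \<le> s' \<Longrightarrow> s' \<le> t \<Longrightarrow>
      clip \<rho> (y s) \<bullet> (y s' - y s) = (LINT \<tau>:{s<..s'}|lebesgue. clip \<rho> (y s) \<bullet> h \<tau>)"
  shows "clip_energy \<rho> (y 0) + 2 * (LINT s:{0..t}|lebesgue. clip \<rho> (y s) \<bullet> h s) \<le> clip_energy \<rho> (y t)"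
proof -
  define v where "v = (\<lambda>s. clip \<rho> (y s))"
  have v: "continuous_on {0..t} v" unfolding v_def by (rule continuous_on_clip[OF \<rho> y])
  have vh: "set_integrable lebesgue {0..t} (\<lambda>s. v s \<bullet> h s)" by (rule set_integrable_inner_continuous[OF v h])
  have nh: "set_integrable lebesgue {0..t} (\<lambda>s. norm (h s))" using h by (rule set_integrable_norm)
  define I where "I = (\<lambda>s. LINT \<tau>:{0..s}|lebesgue. v \<tau> \<bullet> h \<tau>)"
  define N where "N = (\<lambda>s. LINT \<tau>:{0..s}|lebesgue. norm (h \<tau>))"
  define G where "G = (\<lambda>s. clip_energy \<rho> (y s) - 2 * I s)"
  \<comment> \<open>The error is proportional to \<open>e\<close> times the integral of |h| over the
    short interval. Being additive, these errors sum to \<open>e\<close> times the total integral,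
    whatever the number of intervals.\<close>
  have step: "G s - 2 * e * (N s' - N s) \<le> G s'"
    if s: "0 \<le> s" "s \<le> s'" "s' \<le> t" and e: "\<And>\<tau>. \<tau> \<in> {s<..s'} \<Longrightarrow> norm (v \<tau> - v s) \<le> e" for s s' e
  proof -
    have sub: "{s<..s'} \<in> sets lebesgue" "{s<..s'} \<subseteq> {0..t}" using s by auto
    have i1: "set_integrable lebesgue {s<..s'} (\<lambda>\<tau>. v \<tau> \<bullet> h \<tau>)"
      and i2: "set_integrable lebesgue {s<..s'} (\<lambda>\<tau>. norm (h \<tau>))"
      using vh nh sub by (auto intro: set_integrable_subset)
    have i3: "set_integrable lebesgue {s<..s'} (\<lambda>\<tau>. v s \<bullet> h \<tau>)"
      by (rule set_integrable_subset[OF set_integrable_inner_continuous[OF continuous_on_const h] sub])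
    have "(LINT \<tau>:{s<..s'}|lebesgue. v \<tau> \<bullet> h \<tau>) - (LINT \<tau>:{s<..s'}|lebesgue. v s \<bullet> h \<tau>)
        = (LINT \<tau>:{s<..s'}|lebesgue. v \<tau> \<bullet> h \<tau> - v s \<bullet> h \<tau>)"
      using i1 i3 by (simp add: set_integral_diff)
    also have "\<dots> \<le> (LINT \<tau>:{s<..s'}|lebesgue. e * norm (h \<tau>))"
    proof (rule set_integral_mono)
      fix \<tau> assume \<tau>: "\<tau> \<in> {s<..s'}"
      have "v \<tau> \<bullet> h \<tau> - v s \<bullet> h \<tau> = (v \<tau> - v s) \<bullet> h \<tau>" by (simp add: inner_diff_left)
      also have "\<dots> \<le> norm (v \<tau> - v s) * norm (h \<tau>)" by (rule norm_cauchy_schwarz)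
      also have "\<dots> \<le> e * norm (h \<tau>)" using e[OF \<tau>] by (intro mult_right_mono) auto
      finally show "v \<tau> \<bullet> h \<tau> - v s \<bullet> h \<tau> \<le> e * norm (h \<tau>)" .
    qed (use i1 i2 i3 in auto)
    also have "\<dots> = e * (N s' - N s)"
      using set_integral_Icc_split[OF nh s] by (simp add: N_def)
    finally have "(I s' - I s) - e * (N s' - N s) \<le> (LINT \<tau>:{s<..s'}|lebesgue. v s \<bullet> h \<tau>)"
      using set_integral_Icc_split[OF vh s] by (simp add: I_def)
    also have "\<dots> = v s \<bullet> (y s' - y s)" using ode[OF s] by (simp add: v_def)
    finally have 1: "(I s' - I s) - e * (N s' - N s) \<le> v s \<bullet> (y s' - y s)" .
    have "clip_energy \<rho> (y s) + 2 * (v s \<bullet> (y s' - y s)) \<le> clip_energy \<rho> (y s')"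
      using clip_energy_subgradient[OF \<rho>, of "y s" "y s'"] by (simp add: v_def)
    with 1 show ?thesis by (simp add: G_def algebra_simps)
  qed
  have glob: "G 0 - 2 * e * (N t - N 0) \<le> G t" if e: "e > 0" for e
  proof -
    have "uniformly_continuous_on {0..t} v" by (rule compact_uniformly_continuous[OF v]) auto
    then obtain d where d: "d > 0" "\<And>x x'. x \<in> {0..t} \<Longrightarrow> x' \<in> {0..t} \<Longrightarrow> dist x' x < d \<Longrightarrow> dist (v x') (v x) < e"
      using e unfolding uniformly_continuous_on_def by metis
    obtain n :: nat where n: "t / d < real n" using reals_Archimedean2 by blast
    have n0: "real n > 0" using n d t by (meson divide_nonneg_pos le_less_trans)
    have tn: "t / n < d" using n n0 d by (simp add: divide_simps mult.commute)
    define p where "p = (\<lambda>i::nat. t * real i / real n)"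
    have "G 0 - 2 * e * (N (p i) - N 0) \<le> G (p i)" if "i \<le> n" for i
      using that
    proof (induction i)
      case 0
      then show ?case by (simp add: p_def)
    next
      case (Suc i)
      have p: "0 \<le> p i" "p i \<le> p (Suc i)" "p (Suc i) \<le> t"
        using t n0 Suc.prems by (auto simp: p_def divide_simps mult_left_mono)
      have pd: "p (Suc i) - p i = t / n" by (simp add: p_def field_simps diff_divide_distrib[symmetric])
      have "norm (v \<tau> - v (p i)) \<le> e" if "\<tau> \<in> {p i<..p (Suc i)}" for \<tau>
      proof -
        have "dist \<tau> (p i) < d" using that pd tn by (auto simp: dist_real_def)
        then have "dist (v \<tau>) (v (p i)) < e" using that p by (intro d) auto
        then show ?thesis by (simp add: dist_norm)
      qed
      from step[OF p this] Suc show ?case by (simp add: algebra_simps)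
    qed
    from this[of n] n0 show ?thesis by (simp add: p_def)
  qed
  have "G 0 \<le> G t"
  proof (rule field_le_epsilon)
    fix e :: real assume e: "e > 0"
    \<comment> \<open>The summand 1 keeps the divisor positive.\<close>
    define Q where "Q = 2 * \<bar>N t - N 0\<bar> + 1"
    have Q: "Q > 0" unfolding Q_def by (intro add_nonneg_pos) auto
    have "2 * (e / Q) * (N t - N 0) \<le> (e / Q) * Q"
      using e Q by (subst mult.commute[of 2], subst mult.assoc, intro mult_left_mono) (use abs_ge_self[of "N t - N 0"] in \<open>auto simp: Q_def simp del: abs_ge_self\<close>)
    then show "G 0 \<le> G t + e" using glob[of "e / Q"] e Q by simp
  qed
  moreover have "I 0 = 0" by (simp add: I_def set_integral_lebesgue_singleton)
  ultimately show ?thesis by (simp add: G_def I_def v_def)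
qed

subsection \<open>The energy argument\<close>

text \<open>One exhausting sequence of finite sets turns unordered sums into sequential limits, as
  dominated convergence in time requires.\<close>

definition freq_ball :: "nat \<Rightarrow> (int^3) set" where
  "freq_ball n = {k. norm (freq k) \<le> real n}"

lemma finite_freq_ball [simp]: "finite (freq_ball n)"
  unfolding freq_ball_def by (rule card_freq_ball) simp

lemma has_sum_freq_ball:
  fixes f :: "int^3 \<Rightarrow> 'a::topological_comm_monoid_add"
  assumes "(f has_sum S) UNIV"
  shows "(\<lambda>n. sum f (freq_ball n)) \<longlonglongrightarrow> S"
proof -
  have "filterlim freq_ball (finite_subsets_at_top UNIV) sequentially"
    unfolding filterlim_iff eventually_finite_subsets_at_top eventually_sequentially
  proof (intro allI impI, elim exE conjE)
    fix P and X :: "(int^3) set" assume X: "finite X" and P: "\<forall>Y. finite Y \<and> X \<subseteq> Y \<and> Y \<subseteq> UNIV \<longrightarrow> P Y"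
    obtain N :: nat where N: "Max (insert 0 ((\<lambda>k. norm (freq k)) ` X)) < real N"
      using reals_Archimedean2 by blast
    have "X \<subseteq> freq_ball n" if "n \<ge> N" for n
    proof
      fix k assume "k \<in> X"
      then have "norm (freq k) \<le> Max (insert 0 ((\<lambda>k. norm (freq k)) ` X))" using X by (intro Max_ge) auto
      then show "k \<in> freq_ball n" using N that by (simp add: freq_ball_def)
    qed
    then show "\<exists>N. \<forall>n\<ge>N. P (freq_ball n)" using P by (intro exI[of _ N]) auto
  qed
  then show ?thesis using assms unfolding has_sum_def by (rule filterlim_compose[rotated])
qed

lemma freq_ball_eventually: "eventually (\<lambda>n. k \<in> freq_ball n) sequentially"
proof -
  obtain N :: nat where N: "norm (freq k) < real N" using reals_Archimedean2 by blast
  then show ?thesis unfolding eventually_sequentially freq_ball_def by (intro exI[of _ N]) auto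
qed

text \<open>A summand of the convolution for the mode \<open>k\<close> of (u . grad) u;
  \<open>j\<close> is the frequency of the differentiated factor.\<close>

definition conv_term :: "(int^3 \<Rightarrow> complex^3) \<Rightarrow> int^3 \<Rightarrow> int^3 \<Rightarrow> complex^3" where
  "conv_term a k j = (2 * of_real pi * \<i> * cdot (a (k - j)) j) *s a j"

lemma tri_conv_term: "tri a a z (k - j, j) = z k \<bullet> conv_term a k j"
  by (simp add: tri_def conv_term_def)

text \<open>Absolute convergence over pairs allows summation over \<open>j\<close> first with k = p
  + j fixed. The bound for finite \<open>K\<close> does not depend on \<open>K\<close>; it will
  dominate the partial sums in time.\<close>

lemma tri_conv:
  assumes conv: "\<And>k. ((\<lambda>j. z k \<bullet> conv_term a k j) has_sum (z k \<bullet> b k)) UNIV"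
    and T: "\<And>F. finite F \<Longrightarrow> (\<Sum>q\<in>F. \<bar>tri a a z q\<bar>) \<le> B"
  shows "((\<lambda>k. z k \<bullet> b k) has_sum (\<Sum>\<^sub>\<infinity>q. tri a a z q)) UNIV"
    and "finite K \<Longrightarrow> \<bar>\<Sum>k\<in>K. z k \<bullet> b k\<bar> \<le> B"
proof -
  define t where "t = (\<lambda>(k, j). z k \<bullet> conv_term a k j)"
  have bij: "bij (\<lambda>(k, j). (k - j, j) :: (int^3) \<times> (int^3))"
    by (rule bij_betw_byWitness[where f' = "\<lambda>(p, j). (p + j, j)"]) auto
  have t: "tri a a z (case q of (k, j) \<Rightarrow> (k - j, j)) = t q" for q
    by (cases q) (simp add: t_def tri_conv_term)
  have "(tri a a z has_sum (\<Sum>\<^sub>\<infinity>q. tri a a z q)) UNIV" using has_sum_of_bound(1)[OF T] by simp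
  then have "((\<lambda>q. tri a a z (case q of (k, j) \<Rightarrow> (k - j, j))) has_sum (\<Sum>\<^sub>\<infinity>q. tri a a z q)) UNIV"
    using has_sum_reindex_bij_betw[OF bij, of "tri a a z"] by simp
  then have hs: "(t has_sum (\<Sum>\<^sub>\<infinity>q. tri a a z q)) (UNIV \<times> UNIV)" by (simp add: t)
  show "((\<lambda>k. z k \<bullet> b k) has_sum (\<Sum>\<^sub>\<infinity>q. tri a a z q)) UNIV"
    by (rule has_sum_SigmaD[OF hs]) (use conv in \<open>simp add: t_def\<close>)
  have tb: "(\<Sum>q\<in>F. \<bar>t q\<bar>) \<le> B" if F: "finite F" for F
  proof -
    have "(\<Sum>q\<in>F. \<bar>t q\<bar>) = (\<Sum>q\<in>(\<lambda>(k, j). (k - j, j)) ` F. \<bar>tri a a z q\<bar>)"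
      using bij by (subst sum.reindex) (auto simp: t inj_on_def)
    also have "\<dots> \<le> B" using F by (intro T) auto
    finally show ?thesis .
  qed
  show "\<bar>\<Sum>k\<in>K. z k \<bullet> b k\<bar> \<le> B" if K: "finite K"
  proof -
    have abs: "(\<lambda>q. norm (t q)) summable_on (K \<times> UNIV)"
      using has_sum_of_bound(3)[OF tb] by (rule summable_on_subset_banach) auto
    have s: "(t has_sum infsum t (K \<times> UNIV)) (K \<times> UNIV)"
      using abs_summable_summable[OF abs] by simp
    have "((\<lambda>k. z k \<bullet> b k) has_sum infsum t (K \<times> UNIV)) K"
      by (rule has_sum_SigmaD[OF s]) (use conv in \<open>simp add: t_def\<close>)
    then have "(\<Sum>k\<in>K. z k \<bullet> b k) = infsum t (K \<times> UNIV)"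
      using K has_sum_finite has_sum_unique by blast
    also have "\<bar>\<dots>\<bar> \<le> infsum (\<lambda>q. norm (t q)) (K \<times> UNIV)" using norm_infsum_bound[OF abs] by simp
    also have "\<dots> \<le> B" using abs tb by (intro infsum_le_finite_sums) auto
    finally show ?thesis .
  qed
qed

text \<open>The properties of the modes on which the energy argument rests, with \<open>b\<close>
  the modes of the convection. Testing only with \<open>c\<close> orthogonal to \<open>k\<close>
  removes the pressure. The constant 8 pi^2 combines the 2 of the energy inequality with the 4 pi^2
  |k|^2 of the gradient.\<close>

definition fourier_solution ::
    "real \<Rightarrow> (int^3 \<Rightarrow> complex^3) \<Rightarrow> (real \<Rightarrow> int^3 \<Rightarrow> complex^3) \<Rightarrow> (real \<Rightarrow> int^3 \<Rightarrow> complex^3) \<Rightarrow> bool" where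
  "fourier_solution t \<psi> a b \<longleftrightarrow>
     (\<forall>k. continuous_on {0..t} (\<lambda>s. a s k)) \<and>
     (\<forall>s\<in>{0..t}. \<forall>k. cdot (a s k) k = 0) \<and>
     (\<forall>s\<in>{0..t}. \<forall>k i. a s (- k) $ i = cnj (a s k $ i)) \<and>
     (AE s in lebesgue. s \<in> {0..t} \<longrightarrow> h1_seq (a s)) \<and>
     (AE s in lebesgue. s \<in> {0..t} \<longrightarrow> (\<forall>k z. ((\<lambda>j. z \<bullet> conv_term (a s) k j) has_sum (z \<bullet> b s k)) UNIV)) \<and>
     set_integrable lebesgue {0..t} (\<lambda>s. h1_norm2 (a s)) \<and>
     (\<forall>k. set_integrable lebesgue {0..t} (\<lambda>s. b s k)) \<and>
     (\<forall>s\<in>{0..t}. \<forall>k c. cdot c k = 0 \<longrightarrow>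
        c \<bullet> a s k + (LINT \<tau>:{0..s}|lebesgue. 4 * pi\<^sup>2 * (norm (freq k))\<^sup>2 * (c \<bullet> a \<tau> k) + c \<bullet> b \<tau> k) = c \<bullet> \<psi> k) \<and>
     (\<forall>k. cdot (\<psi> k) k = 0) \<and>
     (\<exists>E. ((\<lambda>k. (norm (\<psi> k))\<^sup>2) has_sum E) UNIV \<and>
       (\<forall>K. finite K \<longrightarrow>
         (\<Sum>k\<in>K. (norm (a t k))\<^sup>2) + 8 * pi\<^sup>2 * (LINT s:{0..t}|lebesgue. h1_norm2 (a s)) \<le> E))"

theorem decay_preserved:
  obtains r0 where "r0 > 0"
    "\<And>t r \<psi> a b. 0 \<le> t \<Longrightarrow> 0 < r \<Longrightarrow> r \<le> r0 \<Longrightarrow> fourier_solution t \<psi> a b \<Longrightarrow> decay r \<psi> \<Longrightarrow> decay r (a t)"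
proof -
  obtain r0 where r0: "r0 > 0"
    "\<And>a r. h1_seq a \<Longrightarrow> (\<And>k. cdot (a k) k = 0) \<Longrightarrow> (\<And>k i. a (- k) $ i = cnj (a k $ i)) \<Longrightarrow>
      0 < r \<Longrightarrow> r \<le> r0 \<Longrightarrow>
      tri a a (clip_seq r a) summable_on UNIV \<and>
      (\<lambda>k. (norm (freq k))\<^sup>2 * (a k \<bullet> clip_seq r a k)) summable_on UNIV \<and>
      4 * pi\<^sup>2 * (\<Sum>\<^sub>\<infinity>k. (norm (freq k))\<^sup>2 * (a k \<bullet> clip_seq r a k)) +
        (\<Sum>\<^sub>\<infinity>q. tri a a (clip_seq r a) q) \<le> 4 * pi\<^sup>2 * h1_norm2 a"
    using tri_clip_dissipation by blast
  obtain C where C: "C > 0" "\<And>x y z r F. h1_seq x \<Longrightarrow> h1_seq y \<Longrightarrow> 0 \<le> r \<Longrightarrow> decay r z \<Longrightarrow> (\<And>p. cdot (x p) p = 0) \<Longrightarrow> finite F \<Longrightarrow>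
      (\<Sum>q\<in>F. \<bar>tri x y z q\<bar>) \<le> C * r * (h1_norm2 x + h1_norm2 y)"
    using tri_bound by blast
  show thesis
  proof (rule that[OF r0(1)])
    fix t r \<psi> a b
    assume t: "0 \<le> t" and r: "0 < r" "r \<le> r0" and sol: "fourier_solution t \<psi> a b" and \<psi>: "decay r \<psi>"
    have cont: "\<And>k. continuous_on {0..t} (\<lambda>s. a s k)"
      and div: "\<And>k s. s \<in> {0..t} \<Longrightarrow> cdot (a s k) k = 0"
      and re: "\<And>k i s. s \<in> {0..t} \<Longrightarrow> a s (- k) $ i = cnj (a s k $ i)"
      and h1: "AE s in lebesgue. s \<in> {0..t} \<longrightarrow> h1_seq (a s)"
      and conv: "AE s in lebesgue. s \<in> {0..t} \<longrightarrow> (\<forall>k z. ((\<lambda>j. z \<bullet> conv_term (a s) k j) has_sum (z \<bullet> b s k)) UNIV)"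
      and Hint: "set_integrable lebesgue {0..t} (\<lambda>s. h1_norm2 (a s))"
      and bint: "\<And>k. set_integrable lebesgue {0..t} (\<lambda>s. b s k)"
      and ode: "\<And>k c s. s \<in> {0..t} \<Longrightarrow> cdot c k = 0 \<Longrightarrow>
        c \<bullet> a s k + (LINT \<tau>:{0..s}|lebesgue. 4 * pi\<^sup>2 * (norm (freq k))\<^sup>2 * (c \<bullet> a \<tau> k) + c \<bullet> b \<tau> k) = c \<bullet> \<psi> k"
      and \<psi>div: "\<And>k. cdot (\<psi> k) k = 0"
      using sol[unfolded fourier_solution_def] by (elim conjE; simp del: atLeastAtMost_iff)+
    obtain E where E: "((\<lambda>k. (norm (\<psi> k))\<^sup>2) has_sum E) UNIV"
      and energy: "\<And>K. finite K \<Longrightarrow> (\<Sum>k\<in>K. (norm (a t k))\<^sup>2) + 8 * pi\<^sup>2 * (LINT s:{0..t}|lebesgue. h1_norm2 (a s)) \<le> E"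
      using sol[unfolded fourier_solution_def] by (elim conjE exE) simp
    define \<rho> where "\<rho> = (\<lambda>k. r / (norm (freq k))\<^sup>2)"
    define v where "v = (\<lambda>s. clip_seq r (a s))"
    have \<rho>0: "\<rho> k \<ge> 0" for k using r by (simp add: \<rho>_def)
    have v_clip: "v s k = clip (\<rho> k) (a s k)" for s k by (simp add: v_def \<rho>_def)
    have vdec: "decay r (v s)" for s
    proof
      show "norm (v s k) \<le> r / (norm (freq k))\<^sup>2" for k
        unfolding v_clip using norm_clip_le(1)[OF \<rho>0[of k], of "a s k"] by (simp add: \<rho>_def)
    qed
    have vdiv: "cdot (v s k) k = 0" if "s \<in> {0..t}" for s k
      unfolding v_clip clip_def cdot_scaleR_left using div[OF that] by simp
    have vcont: "continuous_on {0..t} (\<lambda>s. v s k)" for k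
      unfolding v_clip by (rule continuous_on_clip[OF \<rho>0 cont])
    \<comment> \<open>The right-hand side of the mode equation without the pressure term; the
      equation is used only against vectors orthogonal to \<open>k\<close>.\<close>
    define h where "h = (\<lambda>k s. - ((4 * pi\<^sup>2 * (norm (freq k))\<^sup>2) *\<^sub>R a s k + b s k))"
    have aint: "set_integrable lebesgue {0..t} (\<lambda>s. a s k)" for k
      using set_integrable_subset[of lebesgue "{0..t}"] borel_integrable_compact[OF _ cont[of k]]
      by (simp add: set_integrable_def integrable_completion)
    have hint: "set_integrable lebesgue {0..t} (h k)" for k
    proof -
      have "set_integrable lebesgue {0..t} (\<lambda>s. (4 * pi\<^sup>2 * (norm (freq k))\<^sup>2) *\<^sub>R a s k)"
        using aint[of k] unfolding set_integrable_def by (subst scaleR_left_commute) (rule integrable_scaleR_right)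
      from set_integral_add(1)[OF this bint[of k]]
      have "set_integrable lebesgue {0..t} (\<lambda>s. (-1) *\<^sub>R ((4 * pi\<^sup>2 * (norm (freq k))\<^sup>2) *\<^sub>R a s k + b s k))"
        unfolding set_integrable_def by (subst scaleR_left_commute) (rule integrable_scaleR_right)
      then show ?thesis by (simp add: h_def)
    qed
    have ch: "c \<bullet> h k \<tau> = - (4 * pi\<^sup>2 * (norm (freq k))\<^sup>2 * (c \<bullet> a \<tau> k) + c \<bullet> b \<tau> k)" for c k \<tau>
      by (simp add: h_def inner_diff_right)
    have chint: "set_integrable lebesgue {0..t} (\<lambda>\<tau>. c \<bullet> h k \<tau>)" for c k
      by (rule set_integrable_inner_continuous[OF continuous_on_const hint])
    have ode': "c \<bullet> a s k = c \<bullet> \<psi> k + (LINT \<tau>:{0..s}|lebesgue. c \<bullet> h k \<tau>)" if "s \<in> {0..t}" "cdot c k = 0" for s c k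
      using ode[OF that] unfolding ch set_lebesgue_integral_def scaleR_minus_right Bochner_Integration.integral_minus by linarith
    \<comment> \<open>The weak formulation at time 0, tested with the difference itself, which is
      orthogonal to \<open>k\<close>.\<close>
    have init: "a 0 k = \<psi> k" for k
    proof -
      define c where "c = a 0 k - \<psi> k"
      have "cdot c k = 0" using div[of 0 k] \<psi>div t by (simp add: c_def cdot_diff_left)
      then have "c \<bullet> a 0 k = c \<bullet> \<psi> k"
        using ode'[of 0 c k] t by (simp add: set_integral_lebesgue_singleton)
      then have "c \<bullet> c = 0" by (simp add: c_def inner_diff_right inner_diff_left)
      then show ?thesis by (simp add: c_def)
    qed
    have incr: "(norm (\<psi> k))\<^sup>2 + 2 * (LINT s:{0..t}|lebesgue. v s k \<bullet> h k s) \<le> (norm (a t k))\<^sup>2 - (norm (a t k - v t k))\<^sup>2" for k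
    proof -
      have "clip_energy (\<rho> k) (a 0 k) + 2 * (LINT s:{0..t}|lebesgue. clip (\<rho> k) (a s k) \<bullet> h k s) \<le> clip_energy (\<rho> k) (a t k)"
      proof (rule clip_energy_increment[OF t \<rho>0 cont hint])
        fix s s' assume s: "0 \<le> s" "s \<le> s'" "s' \<le> t"
        define c where "c = clip (\<rho> k) (a s k)"
        have c: "cdot c k = 0" using vdiv[of s k] s by (simp add: c_def v_clip)
        have "c \<bullet> a s' k = c \<bullet> a s k + (LINT \<tau>:{s<..s'}|lebesgue. c \<bullet> h k \<tau>)"
          using ode'[of s c k] ode'[of s' c k] set_integral_Icc_split[OF chint s, of c k] c s by simp
        then show "clip (\<rho> k) (a s k) \<bullet> (a s' k - a s k) = (LINT \<tau>:{s<..s'}|lebesgue. clip (\<rho> k) (a s k) \<bullet> h k \<tau>)"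
          unfolding c_def by (simp add: inner_diff_right)
      qed
      \<comment> \<open>The bound on the initial data says that nothing is clipped at time
        0.\<close>
      moreover have "clip_energy (\<rho> k) (a 0 k) = (norm (\<psi> k))\<^sup>2"
        using \<psi> clip_eq_self[OF \<rho>0, of "\<psi> k" k] unfolding init clip_energy_def by (simp add: \<rho>_def)
      ultimately show ?thesis by (simp add: clip_energy_def v_clip)
    qed
    define f where "f = (\<lambda>n s. \<Sum>k\<in>freq_ball n. - (v s k \<bullet> h k s))"
    have vhint: "set_integrable lebesgue {0..t} (\<lambda>s. v s k \<bullet> h k s)" for k
      by (rule set_integrable_inner_continuous[OF vcont hint])
    have fint: "integrable lebesgue (\<lambda>s. indicator {0..t} s *\<^sub>R f n s)" for n
    proof -
      have "integrable lebesgue (\<lambda>s. \<Sum>k\<in>freq_ball n. - (indicator {0..t} s *\<^sub>R (v s k \<bullet> h k s)))"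
        using vhint unfolding set_integrable_def by (intro Bochner_Integration.integrable_sum integrable_minus)
      then show ?thesis by (simp add: f_def sum_distrib_left)
    qed
    define F where "F = (\<lambda>n. LINT s|lebesgue. indicator {0..t} s *\<^sub>R f n s)"
    have F: "F n = - (\<Sum>k\<in>freq_ball n. LINT s:{0..t}|lebesgue. v s k \<bullet> h k s)" for n
    proof -
      have "F n = (LINT s|lebesgue. (\<Sum>k\<in>freq_ball n. - (indicator {0..t} s *\<^sub>R (v s k \<bullet> h k s))))"
        by (simp add: F_def f_def sum_distrib_left)
      also have "\<dots> = (\<Sum>k\<in>freq_ball n. LINT s|lebesgue. - (indicator {0..t} s *\<^sub>R (v s k \<bullet> h k s)))"
        using vhint unfolding set_integrable_def by (intro Bochner_Integration.integral_sum integrable_minus)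
      finally show ?thesis by (simp add: set_lebesgue_integral_def sum_negf)
    qed
    define H where "H = (LINT s:{0..t}|lebesgue. h1_norm2 (a s))"
    \<comment> \<open>The increments over the ball, subtracted from the energy inequality. The modes
      of \<open>\<psi>\<close> in the ball cancel \<open>E\<close> only in the limit.\<close>
    have bound: "(\<Sum>k\<in>freq_ball n. (norm (a t k - v t k))\<^sup>2) \<le> E - (\<Sum>k\<in>freq_ball n. (norm (\<psi> k))\<^sup>2) - 8 * pi\<^sup>2 * H + 2 * F n" for n
    proof -
      have "(\<Sum>k\<in>freq_ball n. (norm (\<psi> k))\<^sup>2 + 2 * (LINT s:{0..t}|lebesgue. v s k \<bullet> h k s))
          \<le> (\<Sum>k\<in>freq_ball n. (norm (a t k))\<^sup>2 - (norm (a t k - v t k))\<^sup>2)"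
        by (intro sum_mono incr)
      then have "(\<Sum>k\<in>freq_ball n. (norm (a t k - v t k))\<^sup>2) \<le> (\<Sum>k\<in>freq_ball n. (norm (a t k))\<^sup>2) - (\<Sum>k\<in>freq_ball n. (norm (\<psi> k))\<^sup>2) + 2 * F n"
        by (simp add: F sum.distrib sum_subtractf sum_distrib_left[symmetric])
      then show ?thesis using energy[OF finite_freq_ball[of n]] by (simp add: H_def)
    qed
    \<comment> \<open>The constant of domination: 4 pi^2 comes from 0 <= <a_k, v_k> <= |a_k|^2, and
      2 C r from the trilinear bound with \<open>a s\<close> in both of the first two
      entries.\<close>
    define Q where "Q = 4 * pi\<^sup>2 + 2 * C * r"
    have ptw: "AE s in lebesgue. s \<in> {0..t} \<longrightarrow> (\<forall>n. \<bar>f n s\<bar> \<le> Q * h1_norm2 (a s)) \<and>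
        (\<exists>L. ((\<lambda>n. f n s) \<longlonglongrightarrow> L) \<and> L \<le> 4 * pi\<^sup>2 * h1_norm2 (a s))"
      using h1 conv
    proof (eventually_elim, intro impI)
      fix s assume "s \<in> {0..t} \<longrightarrow> h1_seq (a s)"
        "s \<in> {0..t} \<longrightarrow> (\<forall>k z. ((\<lambda>j. z \<bullet> conv_term (a s) k j) has_sum (z \<bullet> b s k)) UNIV)" "s \<in> {0..t}"
      then have s: "s \<in> {0..t}" and as: "h1_seq (a s)"
        and cs: "\<And>k z. ((\<lambda>j. z \<bullet> conv_term (a s) k j) has_sum (z \<bullet> b s k)) UNIV" by auto
      note div_s = div[OF s] and re_s = re[OF s]
      have tb: "(\<Sum>q\<in>F. \<bar>tri (a s) (a s) (v s) q\<bar>) \<le> C * r * (h1_norm2 (a s) + h1_norm2 (a s))" if "finite F" for F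
        using r by (intro C(2)[OF as as _ vdec div_s that]) auto
      note tc = tri_conv[OF cs tb]
      have R: "(\<lambda>k. (norm (freq k))\<^sup>2 * (a s k \<bullet> v s k)) summable_on UNIV"
        "4 * pi\<^sup>2 * (\<Sum>\<^sub>\<infinity>k. (norm (freq k))\<^sup>2 * (a s k \<bullet> v s k)) +
        (\<Sum>\<^sub>\<infinity>q. tri (a s) (a s) (v s) q) \<le> 4 * pi\<^sup>2 * h1_norm2 (a s)"
        using r0(2)[OF as div_s re_s r] unfolding v_def by blast+
      have feq: "f n s = (\<Sum>k\<in>freq_ball n. 4 * pi\<^sup>2 * ((norm (freq k))\<^sup>2 * (a s k \<bullet> v s k)) + v s k \<bullet> b s k)" for n
        unfolding f_def ch by (simp add: inner_commute mult.assoc add.commute)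
      have "((\<lambda>k. 4 * pi\<^sup>2 * ((norm (freq k))\<^sup>2 * (a s k \<bullet> v s k)) + v s k \<bullet> b s k) has_sum
          4 * pi\<^sup>2 * (\<Sum>\<^sub>\<infinity>k. (norm (freq k))\<^sup>2 * (a s k \<bullet> v s k)) + (\<Sum>\<^sub>\<infinity>q. tri (a s) (a s) (v s) q)) UNIV"
        by (intro has_sum_add has_sum_cmult_right has_sum_infsum R tc(1))
      from has_sum_freq_ball[OF this]
      have lim: "\<exists>L. ((\<lambda>n. f n s) \<longlonglongrightarrow> L) \<and> L \<le> 4 * pi\<^sup>2 * h1_norm2 (a s)"
        using R(2) unfolding feq by blast
      have "\<bar>f n s\<bar> \<le> Q * h1_norm2 (a s)" for n
      proof -
        have av: "0 \<le> a s k \<bullet> v s k \<and> a s k \<bullet> v s k \<le> (norm (a s k))\<^sup>2" for k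
        proof
          show "0 \<le> a s k \<bullet> v s k" unfolding v_clip clip_def using \<rho>0[of k] by simp
          have "a s k \<bullet> v s k \<le> norm (a s k) * norm (v s k)" by (rule norm_cauchy_schwarz)
          also have "\<dots> \<le> norm (a s k) * norm (a s k)"
            unfolding v_clip by (intro mult_left_mono norm_clip_le \<rho>0) auto
          finally show "a s k \<bullet> v s k \<le> (norm (a s k))\<^sup>2" by (simp add: power2_eq_square)
        qed
        have "\<bar>\<Sum>k\<in>freq_ball n. (norm (freq k))\<^sup>2 * (a s k \<bullet> v s k)\<bar> = (\<Sum>k\<in>freq_ball n. (norm (freq k))\<^sup>2 * (a s k \<bullet> v s k))"
          using av by (intro abs_of_nonneg sum_nonneg) auto
        also have "\<dots> \<le> (\<Sum>k\<in>freq_ball n. (norm (freq k) * norm (a s k))\<^sup>2)"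
          using av by (intro sum_mono) (auto simp: power_mult_distrib intro!: mult_left_mono)
        also have "\<dots> \<le> h1_norm2 (a s)" by (rule h1_norm2_finite[OF as finite_freq_ball])
        finally have 1: "\<bar>\<Sum>k\<in>freq_ball n. (norm (freq k))\<^sup>2 * (a s k \<bullet> v s k)\<bar> \<le> h1_norm2 (a s)" .
        have "\<bar>f n s\<bar> \<le> 4 * pi\<^sup>2 * \<bar>\<Sum>k\<in>freq_ball n. (norm (freq k))\<^sup>2 * (a s k \<bullet> v s k)\<bar> + \<bar>\<Sum>k\<in>freq_ball n. v s k \<bullet> b s k\<bar>"
          unfolding feq sum.distrib sum_distrib_left[symmetric]
          by (rule order_trans[OF abs_triangle_ineq]) (simp add: abs_mult)
        also have "\<dots> \<le> 4 * pi\<^sup>2 * h1_norm2 (a s) + C * r * (h1_norm2 (a s) + h1_norm2 (a s))"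
          by (intro add_mono mult_left_mono 1 tc(2)) auto
        finally show ?thesis by (simp add: Q_def algebra_simps)
      qed
      with lim show "(\<forall>n. \<bar>f n s\<bar> \<le> Q * h1_norm2 (a s)) \<and>
        (\<exists>L. ((\<lambda>n. f n s) \<longlonglongrightarrow> L) \<and> L \<le> 4 * pi\<^sup>2 * h1_norm2 (a s))" by blast
    qed
    \<comment> \<open>Defined through \<open>lim\<close> so that measurability is immediate; the
      sequence may fail to converge on a null set.\<close>
    define L where "L = (\<lambda>s. lim (\<lambda>n. indicator {0..t} s *\<^sub>R f n s))"
    have L: "AE s in lebesgue. (\<lambda>n. indicator {0..t} s *\<^sub>R f n s) \<longlonglongrightarrow> L s \<and> L s \<le> indicator {0..t} s *\<^sub>R (4 * pi\<^sup>2 * h1_norm2 (a s))"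
      using ptw
    proof eventually_elim
      case (elim s)
      show ?case
      proof (cases "s \<in> {0..t}")
        case True
        then obtain l where "(\<lambda>n. f n s) \<longlonglongrightarrow> l" "l \<le> 4 * pi\<^sup>2 * h1_norm2 (a s)" using elim by blast
        moreover then have "L s = l" using True unfolding L_def by (simp add: limI)
        ultimately show ?thesis using True by simp
      next
        case False
        then show ?thesis unfolding L_def by (auto simp: limI)
      qed
    qed
    have w: "integrable lebesgue (\<lambda>s. indicator {0..t} s *\<^sub>R (Q * h1_norm2 (a s)))"
      "integrable lebesgue (\<lambda>s. indicator {0..t} s *\<^sub>R (4 * pi\<^sup>2 * h1_norm2 (a s)))"
      using set_integrable_mult_right[OF Hint, of Q] set_integrable_mult_right[OF Hint, of "4 * pi\<^sup>2"]
      by (auto simp: set_integrable_def)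
    have fm: "(\<lambda>s. indicator {0..t} s *\<^sub>R f n s) \<in> borel_measurable lebesgue" for n
      using fint by (rule borel_measurable_integrable)
    have Lm: "L \<in> borel_measurable lebesgue" unfolding L_def by (intro borel_measurable_lim_metric fm)
    have dom: "AE s in lebesgue. norm (indicator {0..t} s *\<^sub>R f n s) \<le> indicator {0..t} s *\<^sub>R (Q * h1_norm2 (a s))" for n
      using ptw by eventually_elim (auto simp: indicator_def)
    have Llim: "AE s in lebesgue. (\<lambda>n. indicator {0..t} s *\<^sub>R f n s) \<longlonglongrightarrow> L s"
      using L by eventually_elim blast
    have Flim: "F \<longlonglongrightarrow> (LINT s|lebesgue. L s)"
      unfolding F_def by (rule integral_dominated_convergence[OF Lm fm w(1) Llim dom])
    have Lint: "integrable lebesgue L"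
      by (rule integrable_dominated_convergence[OF Lm fm w(1) Llim dom])
    have "(LINT s|lebesgue. L s) \<le> (LINT s|lebesgue. indicator {0..t} s *\<^sub>R (4 * pi\<^sup>2 * h1_norm2 (a s)))"
      using L by (intro integral_mono_AE Lint w) (auto elim!: eventually_mono)
    also have "\<dots> = 4 * pi\<^sup>2 * H"
      unfolding H_def set_lebesgue_integral_def[symmetric] by simp
    finally have Lle: "(LINT s|lebesgue. L s) \<le> 4 * pi\<^sup>2 * H" .
    show "decay r (a t)"
    proof
      fix k
      \<comment> \<open>The initial energies cancel in the limit. What is left, twice the integral
        of \<open>L\<close> minus 8 pi^2 \<open>H\<close>, is at most 0 by the dissipation
        estimate.\<close>
      have lim: "(\<lambda>n. E - (\<Sum>k\<in>freq_ball n. (norm (\<psi> k))\<^sup>2) - 8 * pi\<^sup>2 * H + 2 * F n) \<longlonglongrightarrow>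
          E - E - 8 * pi\<^sup>2 * H + 2 * (LINT s|lebesgue. L s)"
        by (intro tendsto_intros has_sum_freq_ball[OF E] Flim)
      have "(norm (a t k - v t k))\<^sup>2 \<le> E - E - 8 * pi\<^sup>2 * H + 2 * (LINT s|lebesgue. L s)"
      proof (rule tendsto_lowerbound[OF lim])
        show "eventually (\<lambda>n. (norm (a t k - v t k))\<^sup>2 \<le> E - (\<Sum>k\<in>freq_ball n. (norm (\<psi> k))\<^sup>2) - 8 * pi\<^sup>2 * H + 2 * F n) sequentially"
          using freq_ball_eventually[of k]
        proof eventually_elim
          case (elim n)
          have "(norm (a t k - v t k))\<^sup>2 \<le> (\<Sum>k\<in>freq_ball n. (norm (a t k - v t k))\<^sup>2)"
            using elim by (intro member_le_sum) auto
          then show ?case using bound[of n] by linarith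
        qed
      qed simp
      then have "(norm (a t k - v t k))\<^sup>2 \<le> 0" using Lle by linarith
      then have "a t k = v t k" by simp
      then show "norm (a t k) \<le> r / (norm (freq k))\<^sup>2" using vdec[of t] by metis
    qed
  qed
qed

subsection \<open>Plane waves as test functions\<close>

lemma has_derivative_linear_cis:
  fixes l :: "'a::euclidean_space" and L :: "complex \<Rightarrow> 'b::real_normed_vector"
  assumes "bounded_linear L"
  shows "((\<lambda>x. L (cis (x \<bullet> l))) has_derivative (\<lambda>v. L (of_real (v \<bullet> l) * \<i> * cis (x \<bullet> l)))) (at x within S)"
proof -
  have 1: "((\<lambda>x. \<i> * of_real (x \<bullet> l)) has_derivative (\<lambda>v. \<i> * of_real (v \<bullet> l))) (at x within S)"
    by (auto intro!: derivative_eq_intros)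
  have 2: "(exp has_derivative (*) (exp (\<i> * of_real (x \<bullet> l)))) (at (\<i> * of_real (x \<bullet> l)))"
    using DERIV_exp[of "\<i> * of_real (x \<bullet> l)"] by (simp add: has_field_derivative_def)
  have "((\<lambda>x. cis (x \<bullet> l)) has_derivative (\<lambda>v. of_real (v \<bullet> l) * \<i> * cis (x \<bullet> l))) (at x within S)"
    using has_derivative_compose[OF 1 2] by (simp add: cis_conv_exp mult_ac)
  then show ?thesis by (rule bounded_linear.has_derivative[OF assms])
qed

text \<open>Maps of the form L(cis(x . l)) are closed under directional derivatives, which change
  only \<open>L\<close>; hence the induction with \<open>L\<close> arbitrary. The domain is general
  in order to cover both space and space-time.\<close>

lemma Ck_on_linear_cis:
  fixes l :: "'a::euclidean_space" and L :: "complex \<Rightarrow> 'b::real_normed_vector"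
  assumes "bounded_linear L"
  shows "Ck_on n S (\<lambda>x. L (cis (x \<bullet> l)))"
  using assms
proof (induction n arbitrary: L)
  case 0
  then show ?case
    using bounded_linear.continuous_on[OF 0, of S "\<lambda>x. cis (x \<bullet> l)"] by (simp add: continuous_intros)
next
  case (Suc n)
  have "Ck_on n S (\<lambda>x. L (of_real (v \<bullet> l) * \<i> * cis (x \<bullet> l)))" for v
  proof (rule Suc.IH)
    show "bounded_linear (\<lambda>z. L (of_real (v \<bullet> l) * \<i> * z))"
      by (rule bounded_linear_compose[OF Suc.prems bounded_linear_mult_right])
  qed
  then show ?case using has_derivative_linear_cis[OF Suc.prems] by (auto intro!: exI[of _ "\<lambda>x v. L (of_real (v \<bullet> l) * \<i> * cis (x \<bullet> l))"])
qed

lemma chr_cis: "chr k x = cis (x \<bullet> (2 * pi) *\<^sub>R freq k)"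
  by (simp add: chr_def)

lemma periodic_chr: "periodic (\<lambda>x. L (chr k x))"
proof -
  have "chr k (x + freq m) = chr k x" for x m
  proof -
    have "freq m \<bullet> freq k = of_int (\<Sum>i\<in>UNIV. m $ i * k $ i)" by (simp add: inner_vec_def freq_def)
    then have "cis (2 * pi * (freq m \<bullet> freq k)) = 1" by (metis Ints_of_int cis_multiple_2pi)
    then show ?thesis by (simp add: chr_def inner_add_left distrib_left flip: cis_mult)
  qed
  then show ?thesis by (simp add: periodic_def)
qed

lemma has_derivative_chr:
  assumes "bounded_linear L"
  shows "((\<lambda>x. L (chr k x)) has_derivative (\<lambda>v. L (2 * of_real pi * \<i> * of_real (v \<bullet> freq k) * chr k x))) (at x within S)"
  using has_derivative_linear_cis[OF assms, of "(2 * pi) *\<^sub>R freq k" x S] by (simp add: chr_cis mult_ac)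

lemma smooth_on_chr: "bounded_linear L \<Longrightarrow> smooth_on UNIV (\<lambda>x. L (chr k x))"
  unfolding smooth_on_def chr_cis by (blast intro: Ck_on_linear_cis)

text \<open>The complex amplitude \<open>z\<close> covers all phases of the real wave; real pairings
  with every \<open>z\<close> determine a complex Fourier coefficient.\<close>

definition wave :: "complex \<Rightarrow> int^3 \<Rightarrow> real^3 \<Rightarrow> real" where
  "wave z k x = Re (z * chr k x)"

lemma bounded_linear_Re_mult: "bounded_linear (\<lambda>w. Re (z * w))"
  by (rule bounded_linear_compose[OF bounded_linear_Re bounded_linear_mult_right])

lemma wave_test: "smooth_on UNIV (wave z k)" "periodic (wave z k)"
  unfolding wave_def by (rule smooth_on_chr[OF bounded_linear_Re_mult], rule periodic_chr)

lemma frechet_derivative_wave: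
  "frechet_derivative (wave z k) (at x) v = (v \<bullet> freq k) * wave (2 * of_real pi * \<i> * z) k x"
  unfolding wave_def frechet_derivative_at[OF has_derivative_chr[OF bounded_linear_Re_mult], symmetric]
  by (simp add: algebra_simps)

lemma abs_wave_le: "\<bar>wave z k x\<bar> \<le> cmod z"
  unfolding wave_def using abs_Re_le_cmod[of "z * chr k x"] by (simp add: norm_mult)

lemma coef_cnj_real: "cnj (coef (\<lambda>x. of_real (f x)) k) = (LINT x|torus. of_real (f x) * chr k x)"
  using Bochner_Integration.integral_cnj[of torus "\<lambda>x. of_real (f x) * cnj (chr k x)"] by (simp add: coef_def)

lemma coef_real_minus: "coef (\<lambda>x. of_real (f x)) (- k) = cnj (coef (\<lambda>x. of_real (f x)) k)"
  unfolding coef_cnj_real by (simp add: coef_def cnj_chr)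

text \<open>Stated for integrable \<open>f\<close>, because it is also applied to the convection, a
  sum of products of two L^2 functions.\<close>

lemma integral_wave:
  fixes f :: "real^3 \<Rightarrow> real"
  assumes f: "integrable torus f"
  shows "integrable torus (\<lambda>x. f x * wave z k x)"
    "(LINT x|torus. f x * wave z k x) = z \<bullet> coef (\<lambda>x. of_real (f x)) k"
proof -
  have i: "integrable torus (\<lambda>x. z * (of_real (f x) * chr k x))"
  proof (rule Bochner_Integration.integrable_bound)
    show "integrable torus (\<lambda>x. cmod z * f x)" using f by simp
    show "(\<lambda>x. z * (of_real (f x) * chr k x)) \<in> borel_measurable torus"
      using borel_measurable_integrable[OF f] by measurable
  qed (simp add: norm_mult abs_mult)
  have eq: "f x * wave z k x = Re (z * (of_real (f x) * chr k x))" for x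
    by (simp add: wave_def algebra_simps)
  show "integrable torus (\<lambda>x. f x * wave z k x)" unfolding eq by (rule integrable_Re[OF i])
  have "(LINT x|torus. f x * wave z k x) = Re (LINT x|torus. z * (of_real (f x) * chr k x))"
    unfolding eq by (rule integral_Re[OF i])
  also have "\<dots> = Re (z * cnj (coef (\<lambda>x. of_real (f x)) k))"
    unfolding coef_cnj_real by simp
  also have "\<dots> = z \<bullet> coef (\<lambda>x. of_real (f x)) k" by (simp add: inner_complex_def)
  finally show "(LINT x|torus. f x * wave z k x) = z \<bullet> coef (\<lambda>x. of_real (f x)) k" .
qed

lemma fourier_coeff_coef: "fourier_coeff f k $ i = coef (\<lambda>x. of_real (f x $ i)) k"
proof -
  have "exp (- 2 * of_real pi * \<i> * of_real (x \<bullet> freq k)) = cnj (chr k x)" for x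
    by (simp add: chr_def cis_conv_exp exp_cnj mult_ac)
  then show ?thesis by (simp add: fourier_coeff_def coef_def)
qed

lemma fourier_coeff_minus: "fourier_coeff f (- k) $ i = cnj (fourier_coeff f k $ i)"
  by (simp add: fourier_coeff_coef coef_real_minus)

lemma torus_L2_component:
  fixes f :: "real^3 \<Rightarrow> 'a::euclidean_space"
  assumes f: "f \<in> torus_L2" and L: "bounded_linear L" "\<And>y. \<bar>L y\<bar> \<le> norm y"
  shows "(\<lambda>x. L (f x)) \<in> torus_L2" "(\<lambda>x. complex_of_real (L (f x))) \<in> torus_L2" "integrable torus (\<lambda>x. L (f x))"
proof -
  have m: "(\<lambda>x. L (f x)) \<in> borel_measurable torus"
    using borel_measurable_continuous_on[OF linear_continuous_on[OF L(1)] torus_L2_measurable[OF f]] by blast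
  show R: "(\<lambda>x. L (f x)) \<in> torus_L2" "(\<lambda>x. complex_of_real (L (f x))) \<in> torus_L2"
    by (rule torus_L2_dominated[where C=1, OF _ f]; use m L in simp)+
  have "(\<lambda>_. 1::real) \<in> torus_L2" by (simp add: torus_L2_iff)
  from integrable_torus_L2_bound[OF R(1) this m] show "integrable torus (\<lambda>x. L (f x))" by simp
qed

lemmas torus_L2_nth = torus_L2_component[OF _ bounded_linear_vec_nth component_le_norm_cart]

lemma torus_L2_nth_nth:
  fixes G :: "real^3 \<Rightarrow> real^3^3"
  assumes "G \<in> torus_L2"
  shows "(\<lambda>x. G x $ i $ j) \<in> torus_L2" "(\<lambda>x. complex_of_real (G x $ i $ j)) \<in> torus_L2" "integrable torus (\<lambda>x. G x $ i $ j)"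
proof -
  have b: "bounded_linear (\<lambda>y::real^3^3. y $ i $ j)"
    by (rule bounded_linear_compose[OF bounded_linear_vec_nth bounded_linear_vec_nth])
  have l: "\<bar>y $ i $ j\<bar> \<le> norm y" for y :: "real^3^3"
    using component_le_norm_cart[of "y $ i" j] Finite_Cartesian_Product.norm_nth_le[of y i] by linarith
  show "(\<lambda>x. G x $ i $ j) \<in> torus_L2" "(\<lambda>x. complex_of_real (G x $ i $ j)) \<in> torus_L2" "integrable torus (\<lambda>x. G x $ i $ j)"
    using torus_L2_component[OF assms b l] by auto
qed

subsection \<open>Fourier coefficients of vector fields and their gradients\<close>

definition wave_field :: "complex^3 \<Rightarrow> int^3 \<Rightarrow> real^3 \<Rightarrow> real^3" where
  "wave_field c k x = (\<chi> i. wave (c $ i) k x)"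

lemma torus_inner_wave_field:
  assumes "\<And>i. integrable torus (\<lambda>x. f x $ i)"
  shows "torus_inner f (wave_field c k) = c \<bullet> fourier_coeff f k"
proof -
  have "torus_inner f (wave_field c k) = (\<Sum>i\<in>UNIV. LINT x|torus. f x $ i * wave (c $ i) k x)"
    unfolding torus_inner_def wave_field_def inner_vec_def
    using integral_wave(1)[OF assms] by (simp add: Bochner_Integration.integral_sum)
  then show ?thesis by (simp add: integral_wave(2)[OF assms] fourier_coeff_coef inner_vec_def)
qed

lemma wave_field_L2: "wave_field c k \<in> torus_L2"
proof (rule torus_L2_bounded)
  show "wave_field c k \<in> borel_measurable torus"
    unfolding wave_field_def wave_def by (intro continuous_measurable_torus continuous_intros continuous_chr)
  show "norm (wave_field c k x) \<le> norm c" for x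
    unfolding norm_vec_def wave_field_def by (intro L2_set_mono) (auto simp: abs_wave_le)
qed

lemma inner_complex_all_eq:
  fixes a b :: complex
  assumes "\<And>z. z \<bullet> a = z \<bullet> b"
  shows "a = b"
  using assms[of "a - b"] by (metis inner_diff_right inner_eq_zero_iff right_minus_eq)

lemma cdot_fourier_coeff:
  assumes f: "f \<in> torus_L2" and div: "weakly_div_free f"
  shows "cdot (fourier_coeff f k) k = 0"
proof (rule inner_complex_all_eq)
  fix w :: complex
  \<comment> \<open>Compensates the factor that differentiation brings down, so that the test
    produces the wave of amplitude \<open>w\<close>.\<close>
  define z where "z = w / (2 * of_real pi * \<i>)"
  have w: "2 * of_real pi * \<i> * z = w" by (simp add: z_def)
  have i: "integrable torus (\<lambda>x. f x $ i)" for i by (rule torus_L2_nth[OF f])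
  have "0 = (LINT x|torus. frechet_derivative (wave z k) (at x) (f x))"
    using div wave_test unfolding weakly_div_free_def by metis
  also have "\<dots> = (LINT x|torus. (\<Sum>i\<in>UNIV. freq k $ i * (f x $ i * wave w k x)))"
    unfolding frechet_derivative_wave w inner_vec_def by (simp add: sum_distrib_left sum_distrib_right mult_ac)
  also have "\<dots> = (\<Sum>i\<in>UNIV. freq k $ i * (w \<bullet> fourier_coeff f k $ i))"
    using integral_wave(1)[OF i] by (simp add: Bochner_Integration.integral_sum integral_wave(2)[OF i] fourier_coeff_coef)
  also have "\<dots> = w \<bullet> cdot (fourier_coeff f k) k"
    unfolding cdot_def inner_sum_right
    by (intro sum.cong refl) (simp add: freq_def inner_complex_def algebra_simps)
  finally show "w \<bullet> cdot (fourier_coeff f k) k = w \<bullet> 0" by simp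
qed

lemma coef_weak_grad:
  assumes f: "f \<in> torus_L2" and G: "is_weak_grad f G"
  shows "coef (\<lambda>x. of_real (G x $ i $ j)) k = 2 * of_real pi * \<i> * of_int (k $ j) * fourier_coeff f k $ i"
proof (rule inner_complex_all_eq)
  fix z :: complex
  have GL: "G \<in> torus_L2" using G by (simp add: is_weak_grad_def)
  have fi: "integrable torus (\<lambda>x. f x $ i)" by (rule torus_L2_nth[OF f])
  have "(LINT x|torus. f x $ i * frechet_derivative (wave z k) (at x) (axis j 1)) = - (LINT x|torus. G x $ i $ j * wave z k x)"
    using G wave_test unfolding is_weak_grad_def by blast
  also have "(LINT x|torus. f x $ i * frechet_derivative (wave z k) (at x) (axis j 1)) =
      (LINT x|torus. of_int (k $ j) * (f x $ i * wave (2 * of_real pi * \<i> * z) k x))"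
    unfolding frechet_derivative_wave by (simp add: inner_axis' freq_def mult_ac)
  also have "\<dots> = of_int (k $ j) * ((2 * of_real pi * \<i> * z) \<bullet> fourier_coeff f k $ i)"
    by (simp add: integral_wave(2)[OF fi] fourier_coeff_coef)
  also have "(LINT x|torus. G x $ i $ j * wave z k x) = z \<bullet> coef (\<lambda>x. of_real (G x $ i $ j)) k"
    by (rule integral_wave(2)[OF torus_L2_nth_nth(3)[OF GL]])
  finally show "z \<bullet> coef (\<lambda>x. of_real (G x $ i $ j)) k = z \<bullet> (2 * of_real pi * \<i> * of_int (k $ j) * fourier_coeff f k $ i)"
    by (simp add: inner_complex_def algebra_simps)
qed

lemma Parseval_vector:
  assumes f: "f \<in> torus_L2"
  shows "((\<lambda>k. (norm (fourier_coeff f k))\<^sup>2) has_sum (L2_norm f)\<^sup>2) UNIV"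
proof -
  note fi = torus_L2_nth[OF f]
  have "((\<lambda>k. \<Sum>i\<in>UNIV. (cmod (coef (\<lambda>x. of_real (f x $ i)) k))\<^sup>2) has_sum
      (\<Sum>i\<in>UNIV. LINT x|torus. (cmod (of_real (f x $ i)))\<^sup>2)) UNIV"
    by (intro has_sum_finite_sum Parseval_norm fi) auto
  moreover have "(\<Sum>i\<in>UNIV. LINT x|torus. (cmod (of_real (f x $ i)))\<^sup>2) = (L2_norm f)\<^sup>2"
  proof -
    have "torus_inner f f = (LINT x|torus. (\<Sum>i\<in>UNIV. (f x $ i)\<^sup>2))"
      by (simp add: torus_inner_def inner_vec_def power2_eq_square)
    also have "\<dots> = (\<Sum>i\<in>UNIV. LINT x|torus. (f x $ i)\<^sup>2)"
      using fi(1) by (intro Bochner_Integration.integral_sum) (simp add: torus_L2_iff)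
    finally have "torus_inner f f = (\<Sum>i\<in>UNIV. LINT x|torus. (f x $ i)\<^sup>2)" .
    moreover have "torus_inner f f \<ge> 0" unfolding torus_inner_def by (rule Bochner_Integration.integral_nonneg) simp
    ultimately show ?thesis by (simp add: L2_norm_def)
  qed
  moreover have "(\<Sum>i\<in>UNIV. (cmod (coef (\<lambda>x. of_real (f x $ i)) k))\<^sup>2) = (norm (fourier_coeff f k))\<^sup>2" for k
    by (simp add: norm_vec_def L2_set_def fourier_coeff_coef sum_nonneg)
  ultimately show ?thesis by simp
qed

lemma weak_grad_H1:
  assumes "f \<in> torus_H1"
  shows "is_weak_grad f (weak_grad f)"
proof -
  obtain G where "is_weak_grad f G" using assms by (auto simp: torus_H1_def)
  then show ?thesis unfolding weak_grad_def by (rule someI[where P = "is_weak_grad f"])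
qed

lemma torus_H1_Parseval:
  assumes f: "f \<in> torus_H1"
  shows "((\<lambda>k. 4 * pi\<^sup>2 * (norm (freq k) * norm (fourier_coeff f k))\<^sup>2) has_sum (L2_norm (weak_grad f))\<^sup>2) UNIV"
proof -
  define G where "G = weak_grad f"
  have fL: "f \<in> torus_L2" using f by (simp add: torus_H1_def)
  have wg: "is_weak_grad f G" unfolding G_def by (rule weak_grad_H1[OF f])
  then have GL: "G \<in> torus_L2" by (simp add: is_weak_grad_def)
  note Gij = torus_L2_nth_nth[OF GL]
  have "((\<lambda>k. \<Sum>i\<in>UNIV. \<Sum>j\<in>UNIV. (cmod (coef (\<lambda>x. of_real (G x $ i $ j)) k))\<^sup>2) has_sum
      (\<Sum>i\<in>UNIV. \<Sum>j\<in>UNIV. LINT x|torus. (cmod (of_real (G x $ i $ j)))\<^sup>2)) UNIV"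
    by (intro has_sum_finite_sum Parseval_norm Gij) auto
  moreover have "(\<Sum>i\<in>UNIV. \<Sum>j\<in>UNIV. LINT x|torus. (cmod (of_real (G x $ i $ j)))\<^sup>2) = (L2_norm G)\<^sup>2"
  proof -
    have "torus_inner G G = (LINT x|torus. (\<Sum>i\<in>UNIV. \<Sum>j\<in>UNIV. (G x $ i $ j)\<^sup>2))"
      by (simp add: torus_inner_def inner_vec_def power2_eq_square)
    also have "\<dots> = (\<Sum>i\<in>UNIV. \<Sum>j\<in>UNIV. LINT x|torus. (G x $ i $ j)\<^sup>2)"
    proof -
      have "integrable torus (\<lambda>x. (G x $ i $ j)\<^sup>2)" for i j using Gij(1)[of i j] by (simp add: torus_L2_iff)
      then show ?thesis by simp
    qed
    finally have "torus_inner G G = (\<Sum>i\<in>UNIV. \<Sum>j\<in>UNIV. LINT x|torus. (G x $ i $ j)\<^sup>2)" .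
    moreover have "torus_inner G G \<ge> 0" unfolding torus_inner_def by (rule Bochner_Integration.integral_nonneg) simp
    ultimately show ?thesis by (simp add: L2_norm_def)
  qed
  moreover have "(\<Sum>i\<in>UNIV. \<Sum>j\<in>UNIV. (cmod (coef (\<lambda>x. of_real (G x $ i $ j)) k))\<^sup>2) =
      4 * pi\<^sup>2 * (norm (freq k) * norm (fourier_coeff f k))\<^sup>2" for k
  proof -
    have "(\<Sum>i\<in>UNIV. \<Sum>j\<in>UNIV. (cmod (coef (\<lambda>x. of_real (G x $ i $ j)) k))\<^sup>2) =
        (\<Sum>i\<in>UNIV. \<Sum>j\<in>UNIV. 4 * pi\<^sup>2 * ((cmod (fourier_coeff f k $ i))\<^sup>2 * (freq k $ j)\<^sup>2))"
      unfolding coef_weak_grad[OF fL wg] by (simp add: norm_mult power_mult_distrib freq_def mult_ac)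
    also have "\<dots> = 4 * pi\<^sup>2 * ((\<Sum>i\<in>UNIV. (cmod (fourier_coeff f k $ i))\<^sup>2) * (\<Sum>j\<in>UNIV. (freq k $ j)\<^sup>2))"
      unfolding sum_product by (simp only: sum_distrib_left)
    also have "\<dots> = 4 * pi\<^sup>2 * (norm (freq k) * norm (fourier_coeff f k))\<^sup>2"
      by (simp add: norm_vec_def L2_set_def power_mult_distrib sum_nonneg)
    finally show ?thesis .
  qed
  ultimately show ?thesis by (simp add: G_def)
qed

lemma torus_H1_seq:
  assumes f: "f \<in> torus_H1" and 0: "fourier_coeff f 0 = 0"
  shows "h1_seq (fourier_coeff f)" "4 * pi\<^sup>2 * h1_norm2 (fourier_coeff f) = (L2_norm (weak_grad f))\<^sup>2"
proof -
  have "((\<lambda>k. 1 / (4 * pi\<^sup>2) * (4 * pi\<^sup>2 * (norm (freq k) * norm (fourier_coeff f k))\<^sup>2)) has_sum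
      1 / (4 * pi\<^sup>2) * (L2_norm (weak_grad f))\<^sup>2) UNIV"
    by (intro has_sum_cmult_right torus_H1_Parseval f)
  then have hs: "((\<lambda>k. (norm (freq k) * norm (fourier_coeff f k))\<^sup>2) has_sum 1 / (4 * pi\<^sup>2) * (L2_norm (weak_grad f))\<^sup>2) UNIV"
    by simp
  then show "h1_seq (fourier_coeff f)" using 0 by (simp add: h1_seq_def has_sum_imp_summable)
  show "4 * pi\<^sup>2 * h1_norm2 (fourier_coeff f) = (L2_norm (weak_grad f))\<^sup>2"
    unfolding h1_norm2_def infsumI[OF hs] by simp
qed

lemma integrable_convection:
  assumes f: "f \<in> torus_H1"
  shows "integrable torus (\<lambda>x. weak_grad f x $ i $ l * f x $ l)" "integrable torus (\<lambda>x. convection f x $ i)"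
proof -
  have fL: "f \<in> torus_L2" using f by (simp add: torus_H1_def)
  have GL: "weak_grad f \<in> torus_L2" using weak_grad_H1[OF f] by (simp add: is_weak_grad_def)
  note Gm = torus_L2_nth_nth(1)[OF GL] and fm = torus_L2_nth(1)[OF fL]
  show i: "integrable torus (\<lambda>x. weak_grad f x $ i $ l * f x $ l)" for l
  proof (rule integrable_torus_L2_bound[OF Gm[of i l] fm[of l]])
    show "(\<lambda>x. weak_grad f x $ i $ l * f x $ l) \<in> borel_measurable torus"
      by (intro borel_measurable_times torus_L2_measurable Gm fm)
  qed (simp add: abs_mult)
  have "convection f x $ i = (\<Sum>l\<in>UNIV. weak_grad f x $ i $ l * f x $ l)" for x
    by (simp add: convection_def matrix_vector_mult_def)
  then show "integrable torus (\<lambda>x. convection f x $ i)" using i by simp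
qed

text \<open>The coefficient at \<open>k\<close> of a product of a gradient entry and
  \<open>f l\<close> is an L^2 pairing of the former with \<open>f l\<close> times a character.
  Parseval's identity applies to it, and the character shifts the coefficients of \<open>f l\<close>
  to \<open>k - j\<close>.\<close>

lemma fourier_coeff_convection_component:
  assumes f: "f \<in> torus_H1"
  shows "((\<lambda>j. conv_term (fourier_coeff f) k j $ i) has_sum fourier_coeff (convection f) k $ i) UNIV"
proof -
  define G where "G = weak_grad f"
  have fL: "f \<in> torus_L2" using f by (simp add: torus_H1_def)
  have wg: "is_weak_grad f G" unfolding G_def by (rule weak_grad_H1[OF f])
  then have GL: "G \<in> torus_L2" by (simp add: is_weak_grad_def)
  note Gij = torus_L2_nth_nth[OF GL] and fi = torus_L2_nth[OF fL]
  have fc: "(\<lambda>x. of_real (f x $ l) * chr k x) \<in> torus_L2" for l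
    by (rule torus_L2_mult_bounded[OF fi(2), where C=1]) auto
  have 1: "cnj (coef (\<lambda>x. of_real (f x $ l) * chr k x) j) = fourier_coeff f (k - j) $ l" for l j
  proof -
    have "coef (\<lambda>x. of_real (f x $ l) * chr k x) j = coef (\<lambda>x. of_real (f x $ l)) (- (k - j))"
      unfolding coef_def by (simp add: chr_add cnj_chr mult.assoc flip: chr_add)
    then show ?thesis by (simp only: coef_real_minus fourier_coeff_coef complex_cnj_cnj)
  qed
  have hs: "((\<lambda>j. \<Sum>l\<in>UNIV. coef (\<lambda>x. of_real (G x $ i $ l)) j * cnj (coef (\<lambda>x. of_real (f x $ l) * chr k x) j)) has_sum
      (\<Sum>l\<in>UNIV. LINT x|torus. of_real (G x $ i $ l) * cnj (of_real (f x $ l) * chr k x))) UNIV"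
    by (intro has_sum_finite_sum Parseval_inner Gij fc) auto
  have "(\<Sum>l\<in>UNIV. LINT x|torus. of_real (G x $ i $ l) * cnj (of_real (f x $ l) * chr k x)) =
      (LINT x|torus. (\<Sum>l\<in>UNIV. of_real (G x $ i $ l) * cnj (of_real (f x $ l) * chr k x)))"
    by (rule Bochner_Integration.integral_sum[symmetric]) (rule integrable_torus_mult(2)[OF Gij(2) fc])
  also have "\<dots> = fourier_coeff (convection f) k $ i"
    unfolding fourier_coeff_coef coef_def
    by (simp add: convection_def matrix_vector_mult_def G_def sum_distrib_right mult.assoc)
  finally have rhs: "(\<Sum>l\<in>UNIV. LINT x|torus. of_real (G x $ i $ l) * cnj (of_real (f x $ l) * chr k x)) =
      fourier_coeff (convection f) k $ i" .
  have lhs: "(\<Sum>l\<in>UNIV. coef (\<lambda>x. of_real (G x $ i $ l)) j * cnj (coef (\<lambda>x. of_real (f x $ l) * chr k x) j)) =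
      conv_term (fourier_coeff f) k j $ i" for j
    unfolding 1 coef_weak_grad[OF fL wg]
    by (simp add: conv_term_def cdot_def sum_distrib_left sum_distrib_right mult_ac)
  show ?thesis using hs unfolding lhs rhs .
qed

lemma fourier_coeff_convection:
  assumes f: "f \<in> torus_H1"
  shows "((\<lambda>j. z \<bullet> conv_term (fourier_coeff f) k j) has_sum z \<bullet> fourier_coeff (convection f) k) UNIV"
proof -
  have "((\<lambda>j. \<Sum>i\<in>UNIV. z $ i \<bullet> conv_term (fourier_coeff f) k j $ i) has_sum
      (\<Sum>i\<in>UNIV. z $ i \<bullet> fourier_coeff (convection f) k $ i)) UNIV"
  proof (intro has_sum_finite_sum)
    fix i :: 3
    show "((\<lambda>j. z $ i \<bullet> conv_term (fourier_coeff f) k j $ i) has_sum z $ i \<bullet> fourier_coeff (convection f) k $ i) UNIV"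
      using has_sum_bounded_linear[OF bounded_linear_inner_right fourier_coeff_convection_component[OF f]] by (simp add: o_def)
  qed simp
  then show ?thesis by (simp add: inner_vec_def)
qed

subsection \<open>Plane waves as test fields\<close>

lemma wave_field_linear:
  "bounded_linear (\<lambda>z. \<chi> i. Re (c $ i * z) :: real^3)" "wave_field c k x = (\<lambda>z. \<chi> i. Re (c $ i * z)) (chr k x)"
proof -
  show "bounded_linear (\<lambda>z. \<chi> i. Re (c $ i * z) :: real^3)"
    unfolding linear_conv_bounded_linear[symmetric] by (rule linearI) (auto simp: vec_eq_iff algebra_simps)
qed (simp add: wave_field_def wave_def)

lemma grad_wave_field: "grad (wave_field c k) x $ i $ j = of_int (k $ j) * wave (2 * of_real pi * \<i> * c $ i) k x"
proof -
  have "(wave_field c k has_derivative (\<lambda>v. \<chi> i. Re (c $ i * (2 * of_real pi * \<i> * of_real (v \<bullet> freq k) * chr k x)))) (at x)"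
    using has_derivative_chr[OF wave_field_linear(1)[of c], of k x UNIV] unfolding wave_field_linear(2)[abs_def] by simp
  then have "frechet_derivative (wave_field c k) (at x) = (\<lambda>v. \<chi> i. Re (c $ i * (2 * of_real pi * \<i> * of_real (v \<bullet> freq k) * chr k x)))"
    by (rule frechet_derivative_at[symmetric])
  then show ?thesis
    unfolding grad_def jacobian_def matrix_def wave_def by (simp add: inner_axis' freq_def algebra_simps)
qed

lemma test_field_wave_field:
  assumes "cdot c k = 0"
  shows "test_field T (\<lambda>_. wave_field c k)"
proof -
  \<comment> \<open>A stationary wave is a plane wave in space-time with zero time
    frequency.\<close>
  have eq: "(\<lambda>(t, x). wave_field c k x) = (\<lambda>p. (\<lambda>z. \<chi> i. Re (c $ i * z)) (cis (p \<bullet> (0::real, (2 * pi) *\<^sub>R freq k))))"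
    by (auto simp: wave_field_linear(2) chr_cis inner_prod_def)
  have "smooth_on (times T \<times> UNIV) (\<lambda>(t, x). wave_field c k x)"
    unfolding eq smooth_on_def by (blast intro: Ck_on_linear_cis[OF wave_field_linear(1)])
  moreover have "periodic (wave_field c k)"
    using periodic_chr[of "\<lambda>z. \<chi> i. Re (c $ i * z) :: real^3" k] unfolding wave_field_linear(2)[abs_def] .
  moreover have "divergence (wave_field c k) x = 0" for x
  proof -
    have "divergence (wave_field c k) x = Re (2 * of_real pi * \<i> * cdot c k * chr k x)"
      by (simp add: divergence_def trace_def grad_wave_field wave_def cdot_def sum_distrib_left sum_distrib_right algebra_simps sum_subtractf sum.distrib)
    then show ?thesis using assms by simp
  qed
  ultimately show ?thesis by (simp add: test_field_def)
qed

text \<open>The derivative within \<open>times T\<close> is determined only at limit points of that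
  set; an interval from 0 to some \<open>\<tau>'\<close> between \<open>\<tau>\<close> and
  \<open>T\<close> provides this, also at \<open>\<tau> = 0\<close>.\<close>

lemma time_deriv_const:
  assumes "0 \<le> \<tau>" "ereal \<tau> < T"
  shows "time_deriv T (\<lambda>_. f) \<tau> x = 0"
proof -
  obtain \<tau>' where \<tau>': "\<tau> < \<tau>'" "ereal \<tau>' < T" using ereal_dense2[OF assms(2)] by auto
  have "{0..\<tau>'} \<subseteq> times T"
    using \<tau>' by (auto simp: times_def) (meson ereal_less_eq(3) le_less_trans)
  moreover have "\<tau> islimpt {0..\<tau>'}" using assms \<tau>' by simp
  ultimately have "\<tau> islimpt times T" using islimpt_subset by blast
  then have "at \<tau> within times T \<noteq> bot" using trivial_limit_within by blast
  then show ?thesis unfolding time_deriv_def by (intro vector_derivative_within) auto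
qed

lemma torus_inner_grad_wave_field:
  assumes f: "f \<in> torus_H1"
  shows "torus_inner (weak_grad f) (grad (wave_field c k)) = 4 * pi\<^sup>2 * (norm (freq k))\<^sup>2 * (c \<bullet> fourier_coeff f k)"
proof -
  have fL: "f \<in> torus_L2" using f by (simp add: torus_H1_def)
  note wg = weak_grad_H1[OF f]
  have GL: "weak_grad f \<in> torus_L2" using wg by (simp add: is_weak_grad_def)
  note Gi = torus_L2_nth_nth(3)[OF GL]
  define w where "w = (\<lambda>i. wave (2 * of_real pi * \<i> * c $ i) k)"
  have "torus_inner (weak_grad f) (grad (wave_field c k)) =
      (LINT x|torus. (\<Sum>i\<in>UNIV. \<Sum>j\<in>UNIV. of_int (k $ j) * (weak_grad f x $ i $ j * w i x)))"
    by (simp add: torus_inner_def inner_vec_def grad_wave_field w_def mult_ac)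
  also have "\<dots> = (\<Sum>i\<in>UNIV. \<Sum>j\<in>UNIV. of_int (k $ j) * (LINT x|torus. weak_grad f x $ i $ j * w i x))"
    using integral_wave(1)[OF Gi] by (simp add: w_def)
  also have "\<dots> = (\<Sum>i\<in>UNIV. \<Sum>j\<in>UNIV. 4 * pi\<^sup>2 * ((freq k $ j)\<^sup>2 * (c $ i \<bullet> fourier_coeff f k $ i)))"
    unfolding w_def integral_wave(2)[OF Gi] coef_weak_grad[OF fL wg]
    by (intro sum.cong refl) (simp add: inner_complex_def freq_def power2_eq_square algebra_simps)
  also have "\<dots> = 4 * pi\<^sup>2 * ((\<Sum>j\<in>UNIV. (freq k $ j)\<^sup>2) * (\<Sum>i\<in>UNIV. c $ i \<bullet> fourier_coeff f k $ i))"
    unfolding sum_product by (subst sum.swap) (simp only: sum_distrib_left)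
  also have "(\<Sum>j\<in>UNIV. (freq k $ j)\<^sup>2) = (norm (freq k))\<^sup>2" by (simp add: norm_vec_def L2_set_def sum_nonneg)
  finally show ?thesis by (simp add: inner_vec_def)
qed

subsection \<open>Modes of a Leray--Hopf solution\<close>

text \<open>Single modes are continuous in time, and infinite sums over modes are limits of such
  functions for almost every time; completeness of \<open>lebesgue\<close> takes care of the null
  set.\<close>

lemma measurable_AE_limit:
  fixes f :: "nat \<Rightarrow> real \<Rightarrow> real"
  assumes f: "\<And>n. continuous_on {0..t} (f n)"
    and lim: "AE s in lebesgue. s \<in> {0..t} \<longrightarrow> (\<lambda>n. f n s) \<longlonglongrightarrow> g s"
  shows "(\<lambda>s. indicator {0..t} s *\<^sub>R g s) \<in> borel_measurable lebesgue"
proof (rule borel_measurable_AE)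
  have "(\<lambda>s. indicator {0..t} s *\<^sub>R f n s) \<in> borel_measurable lebesgue" for n
    using continuous_imp_measurable_on_sets_lebesgue[OF f]
    by (subst borel_measurable_restrict_space_iff[symmetric]) auto
  then show "(\<lambda>s. lim (\<lambda>n. indicator {0..t} s *\<^sub>R f n s)) \<in> borel_measurable lebesgue"
    by (rule borel_measurable_lim_metric)
  show "AE s in lebesgue. lim (\<lambda>n. indicator {0..t} s *\<^sub>R f n s) = indicator {0..t} s *\<^sub>R g s"
    using lim
  proof eventually_elim
    case (elim s)
    then show ?case by (cases "s \<in> {0..t}") (auto intro: limI)
  qed
qed

text \<open>Completeness of \<open>lebesgue\<close> transfers measurability from \<open>g\<close> to
  \<open>f\<close>.\<close>

lemma set_integral_AE_eq:
  fixes f g :: "real \<Rightarrow> real"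
  assumes g: "set_integrable lebesgue A g" and eq: "AE s in lebesgue. s \<in> A \<longrightarrow> f s = g s"
  shows "(LINT s:A|lebesgue. f s) = (LINT s:A|lebesgue. g s)"
proof -
  have m: "(\<lambda>s. indicator A s *\<^sub>R g s) \<in> borel_measurable lebesgue"
    using g unfolding set_integrable_def by (rule borel_measurable_integrable)
  have ae: "AE s in lebesgue. indicator A s *\<^sub>R g s = indicator A s *\<^sub>R f s"
    using eq by eventually_elim (auto simp: indicator_def)
  show ?thesis unfolding set_lebesgue_integral_def
    by (intro integral_cong_AE borel_measurable_AE[OF m ae] m) (use ae in \<open>auto elim!: eventually_mono\<close>)
qed

text \<open>A bound at fixed \<open>k\<close>, for the integrability of the convection modes in
  time. As \<open>a\<close> has no mean and nonzero frequencies have norm at least 1, |a_k| <= |k|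
  |a_k|, so both factors may carry the H^1 weight.\<close>

lemma conv_term_sum_le:
  assumes a: "h1_seq a" and F: "finite F"
  shows "(\<Sum>j\<in>F. \<bar>c \<bullet> conv_term a k j\<bar>) \<le> norm c * (4 * pi * h1_norm2 a)"
proof -
  define A where "A = (\<lambda>k. norm (freq k) * norm (a k))"
  have le: "norm (a k) \<le> A k" for k
    using norm_freq_ge_1[of k] a mult_right_mono[of 1 "norm (freq k)" "norm (a k)"]
    by (cases "k = 0") (auto simp: A_def h1_seq_def)
  have pt: "\<bar>c \<bullet> conv_term a k j\<bar> \<le> norm c * (2 * pi * ((A (k - j))\<^sup>2 + (A j)\<^sup>2))" for j
  proof -
    have "norm (conv_term a k j) = 2 * pi * (cmod (cdot (a (k - j)) j) * norm (a j))"
      by (simp add: conv_term_def norm_vector_scalar_mult norm_mult)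
    also have "\<dots> \<le> 2 * pi * ((norm (a (k - j)) * norm (freq j)) * norm (a j))"
      by (intro mult_left_mono mult_right_mono norm_cdot_le) auto
    also have "\<dots> = 2 * pi * (norm (a (k - j)) * A j)" by (simp add: A_def)
    also have "\<dots> \<le> 2 * pi * (A (k - j) * A j)"
      by (intro mult_left_mono mult_right_mono le) (auto simp: A_def)
    also have "\<dots> \<le> 2 * pi * ((A (k - j))\<^sup>2 + (A j)\<^sup>2)"
    proof (intro mult_left_mono)
      show "A (k - j) * A j \<le> (A (k - j))\<^sup>2 + (A j)\<^sup>2"
        using sum_squares_bound[of "A (k - j)" "A j"] zero_le_power2[of "A (k - j)"] zero_le_power2[of "A j"] by linarith
    qed simp
    finally have n: "norm (conv_term a k j) \<le> 2 * pi * ((A (k - j))\<^sup>2 + (A j)\<^sup>2)" .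
    have "\<bar>c \<bullet> conv_term a k j\<bar> \<le> norm c * norm (conv_term a k j)" by (rule Cauchy_Schwarz_ineq2)
    also have "\<dots> \<le> norm c * (2 * pi * ((A (k - j))\<^sup>2 + (A j)\<^sup>2))" using n by (intro mult_left_mono) auto
    finally show ?thesis .
  qed
  have "(\<Sum>j\<in>F. \<bar>c \<bullet> conv_term a k j\<bar>) \<le> (\<Sum>j\<in>F. norm c * (2 * pi * ((A (k - j))\<^sup>2 + (A j)\<^sup>2)))"
    using pt by (intro sum_mono)
  also have "\<dots> = norm c * (2 * pi * ((\<Sum>j\<in>F. (A (k - j))\<^sup>2) + (\<Sum>j\<in>F. (A j)\<^sup>2)))"
    by (simp only: sum_distrib_left sum.distrib distrib_left)
  also have "(\<Sum>j\<in>F. (A (k - j))\<^sup>2) = (\<Sum>j\<in>(-) k ` F. (A j)\<^sup>2)"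
    by (subst sum.reindex) (auto simp: inj_on_def)
  also have "norm c * (2 * pi * ((\<Sum>j\<in>(-) k ` F. (A j)\<^sup>2) + (\<Sum>j\<in>F. (A j)\<^sup>2))) \<le> norm c * (2 * pi * (h1_norm2 a + h1_norm2 a))"
    unfolding A_def using F by (intro mult_left_mono add_mono h1_norm2_finite a) auto
  finally show ?thesis by (simp add: mult_ac)
qed

lemma set_integrable_componentwise:
  fixes f :: "real \<Rightarrow> 'a::euclidean_space"
  assumes "\<And>c. set_integrable lebesgue A (\<lambda>s. c \<bullet> f s)"
  shows "set_integrable lebesgue A f"
proof -
  have "integrable lebesgue (\<lambda>s. \<Sum>c\<in>Basis. (indicator A s *\<^sub>R (c \<bullet> f s)) *\<^sub>R c)"
    using assms unfolding set_integrable_def by (intro Bochner_Integration.integrable_sum integrable_scaleR_left)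
  moreover have "(\<Sum>c\<in>Basis. (indicator A s *\<^sub>R (c \<bullet> f s)) *\<^sub>R c) = indicator A s *\<^sub>R f s" for s
  proof -
    have "(\<Sum>c\<in>Basis. (indicator A s *\<^sub>R (c \<bullet> f s)) *\<^sub>R c) = indicator A s *\<^sub>R (\<Sum>c\<in>Basis. (f s \<bullet> c) *\<^sub>R c)"
      by (simp add: scaleR_sum_right inner_commute)
    then show ?thesis by (simp add: euclidean_representation)
  qed
  ultimately show ?thesis by (simp add: set_integrable_def)
qed

lemma leray_hopf_fourier_solution:
  assumes LH: "leray_hopf T \<psi> u" and t: "0 < t" "ereal t < T" and \<psi>0: "fourier_coeff \<psi> 0 = 0"
  shows "fourier_solution t (fourier_coeff \<psi>) (\<lambda>s. fourier_coeff (u s)) (\<lambda>s. fourier_coeff (convection (u s)))"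
proof -
  define a where "a = (\<lambda>s. fourier_coeff (u s))"
  define b where "b = (\<lambda>s. fourier_coeff (convection (u s)))"
  have sT: "ereal s < T" if "s \<le> t" for s
    using that t by (meson ereal_less_eq(3) le_less_trans)
  have times: "s \<in> times T" if "s \<in> {0..t}" for s using that sT by (auto simp: times_def)
  have subT: "{0..t} \<subseteq> times T" using times by blast
  have \<psi>L: "\<psi> \<in> torus_L2" "weakly_div_free \<psi>"
    and uL: "\<And>s. s \<in> {0..t} \<Longrightarrow> u s \<in> torus_L2" "\<And>s. s \<in> {0..t} \<Longrightarrow> weakly_div_free (u s)"
    and wc: "weakly_continuous T u" and LH1: "in_L2_H1 T u"
    and wNS: "weak_NS T \<psi> u" and en: "energy_inequality T \<psi> u"
    using LH times by (auto simp: leray_hopf_def)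
  have H1: "AE s in lebesgue. s \<in> {0..t} \<longrightarrow> u s \<in> torus_H1"
  proof -
    have "AE s in lebesgue. s \<in> times T \<longrightarrow> u s \<in> torus_H1" using LH1 by (simp add: in_L2_H1_def)
    then show ?thesis by eventually_elim (use times in blast)
  qed
  have inner_a: "torus_inner (u s) (wave_field c k) = c \<bullet> a s k" if "s \<in> {0..t}" for s c k
    unfolding a_def by (rule torus_inner_wave_field[OF torus_L2_nth(3)[OF uL(1)[OF that]]])
  have cont_inner: "continuous_on {0..t} (\<lambda>s. c \<bullet> a s k)" for c k
  proof -
    have "continuous_on {0..t} (\<lambda>s. torus_inner (u s) (wave_field c k))"
      using wc wave_field_L2 subT unfolding weakly_continuous_def by (blast intro: continuous_on_subset)
    then show ?thesis by (rule continuous_on_eq) (rule inner_a)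
  qed
  have cont: "continuous_on {0..t} (\<lambda>s. a s k)" for k
    using cont_inner by (subst continuous_on_componentwise) (auto simp: inner_commute)
  have conv: "AE s in lebesgue. s \<in> {0..t} \<longrightarrow> (\<forall>k z. ((\<lambda>j. z \<bullet> conv_term (a s) k j) has_sum (z \<bullet> b s k)) UNIV)"
    using H1 unfolding a_def b_def by eventually_elim (auto intro: fourier_coeff_convection)
  have adiv: "cdot (a s k) k = 0" if "s \<in> {0..t}" for s k
    unfolding a_def by (rule cdot_fourier_coeff[OF uL(1)[OF that] uL(2)[OF that]])
  \<comment> \<open>The integrand of the weak formulation as it stands; off a null set of times it
    equals the expression in the modes, by \<open>g_eq\<close>.\<close>
  define g where "g = (\<lambda>c k \<tau>. - torus_inner (u \<tau>) (time_deriv T (\<lambda>_. wave_field c k) \<tau>)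
       + torus_inner (weak_grad (u \<tau>)) (grad (wave_field c k))
       + torus_inner (convection (u \<tau>)) (wave_field c k))"
  have ode0: "c \<bullet> a s k + (LINT \<tau>:{0..s}|lebesgue. g c k \<tau>) = c \<bullet> fourier_coeff \<psi> k"
    if "s \<in> {0..t}" "cdot c k = 0" for s c k
    using wNS[unfolded weak_NS_def, rule_format, OF test_field_wave_field[OF that(2)] times[OF that(1)]]
    unfolding inner_a[OF that(1)] torus_inner_wave_field[OF torus_L2_nth(3)[OF \<psi>L(1)]] g_def .
  have g_eq: "AE \<tau> in lebesgue. \<tau> \<in> {0..t} \<longrightarrow> g c k \<tau> = 4 * pi\<^sup>2 * (norm (freq k))\<^sup>2 * (c \<bullet> a \<tau> k) + c \<bullet> b \<tau> k" for c k
    using H1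
  proof (eventually_elim, intro impI)
    fix \<tau> assume "\<tau> \<in> {0..t} \<longrightarrow> u \<tau> \<in> torus_H1" and \<tau>: "\<tau> \<in> {0..t}"
    then have h: "u \<tau> \<in> torus_H1" by blast
    have "time_deriv T (\<lambda>_. wave_field c k) \<tau> = (\<lambda>x. 0)"
      using \<tau> sT by (intro ext time_deriv_const) auto
    then have "torus_inner (u \<tau>) (time_deriv T (\<lambda>_. wave_field c k) \<tau>) = 0" by (simp add: torus_inner_def)
    moreover have "torus_inner (convection (u \<tau>)) (wave_field c k) = c \<bullet> b \<tau> k"
      unfolding b_def by (rule torus_inner_wave_field[OF integrable_convection(2)[OF h]])
    ultimately show "g c k \<tau> = 4 * pi\<^sup>2 * (norm (freq k))\<^sup>2 * (c \<bullet> a \<tau> k) + c \<bullet> b \<tau> k"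
      unfolding g_def torus_inner_grad_wave_field[OF h] by (simp add: a_def)
  qed
  \<comment> \<open>Conservation of the mean: at \<open>k = 0\<close> every vector is an admissible
    amplitude, and each term of the convolution contains \<open>cdot (a \<tau> (- j)) j\<close>,
    which vanishes by incompressibility.\<close>
  have a0: "a s 0 = 0" if s: "s \<in> {0..t}" for s
  proof -
    have "AE \<tau> in lebesgue. \<tau> \<in> {0..t} \<longrightarrow> g (a s 0) 0 \<tau> = 0"
      using g_eq[of "a s 0" 0] conv
    proof (eventually_elim, intro impI)
      fix \<tau> assume "\<tau> \<in> {0..t} \<longrightarrow> g (a s 0) 0 \<tau> = 4 * pi\<^sup>2 * (norm (freq 0))\<^sup>2 * (a s 0 \<bullet> a \<tau> 0) + a s 0 \<bullet> b \<tau> 0"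
        "\<tau> \<in> {0..t} \<longrightarrow> (\<forall>k z. ((\<lambda>j. z \<bullet> conv_term (a \<tau>) k j) has_sum (z \<bullet> b \<tau> k)) UNIV)" and \<tau>: "\<tau> \<in> {0..t}"
      then have g: "g (a s 0) 0 \<tau> = a s 0 \<bullet> b \<tau> 0"
        and hs: "((\<lambda>j. a s 0 \<bullet> conv_term (a \<tau>) 0 j) has_sum (a s 0 \<bullet> b \<tau> 0)) UNIV" by auto
      have "cdot (a \<tau> (0 - j)) j = 0" for j
        using adiv[OF \<tau>, of "- j"] cdot_minus_right[of "a \<tau> (- j)" "j"] by simp
      then have "conv_term (a \<tau>) 0 j = 0" for j by (simp add: conv_term_def)
      then have "((\<lambda>j::int^3. 0) has_sum (a s 0 \<bullet> b \<tau> 0)) UNIV" using hs by simp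
      then have "a s 0 \<bullet> b \<tau> 0 = 0" using has_sum_unique[OF _ has_sum_0_simp] by blast
      then show "g (a s 0) 0 \<tau> = 0" using g by simp
    qed
    then have "(LINT \<tau>:{0..s}|lebesgue. g (a s 0) 0 \<tau>) = 0"
      unfolding set_lebesgue_integral_def using s
      by (intro integral_eq_zero_AE) (auto elim!: eventually_mono simp: indicator_def)
    moreover note \<psi>0
    moreover have "cdot (a s 0) 0 = 0" by (rule adiv[OF s])
    ultimately have "a s 0 \<bullet> a s 0 = 0" using ode0[OF s, of "a s 0" 0] by simp
    then show ?thesis by simp
  qed
  have h1: "AE s in lebesgue. s \<in> {0..t} \<longrightarrow> h1_seq (a s) \<and> 4 * pi\<^sup>2 * h1_norm2 (a s) = (L2_norm (weak_grad (u s)))\<^sup>2"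
    using H1
  proof (eventually_elim, intro impI)
    fix s assume "s \<in> {0..t} \<longrightarrow> u s \<in> torus_H1" and s: "s \<in> {0..t}"
    then show "h1_seq (a s) \<and> 4 * pi\<^sup>2 * h1_norm2 (a s) = (L2_norm (weak_grad (u s)))\<^sup>2"
      using torus_H1_seq[of "u s"] a0[OF s] unfolding a_def by blast
  qed
  have h1': "AE s in lebesgue. s \<in> {0..t} \<longrightarrow> h1_seq (a s)" using h1 by eventually_elim blast
  have Hm: "(\<lambda>s. indicator {0..t} s *\<^sub>R h1_norm2 (a s)) \<in> borel_measurable lebesgue"
  proof (rule measurable_AE_limit)
    show "continuous_on {0..t} (\<lambda>s. \<Sum>k\<in>freq_ball n. (norm (freq k) * norm (a s k))\<^sup>2)" for n
      by (intro continuous_intros cont)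
    show "AE s in lebesgue. s \<in> {0..t} \<longrightarrow> (\<lambda>n. \<Sum>k\<in>freq_ball n. (norm (freq k) * norm (a s k))\<^sup>2) \<longlonglongrightarrow> h1_norm2 (a s)"
      using h1' by eventually_elim (auto simp: h1_seq_def h1_norm2_def intro!: has_sum_freq_ball has_sum_infsum)
  qed
  have Hint: "set_integrable lebesgue {0..t} (\<lambda>s. h1_norm2 (a s))"
  proof -
    have "set_integrable lebesgue (times T) (\<lambda>s. (L2_norm (u s))\<^sup>2 + (L2_norm (weak_grad (u s)))\<^sup>2)"
      using LH1 by (simp add: in_L2_H1_def)
    then have i: "set_integrable lebesgue {0..t} (\<lambda>s. (L2_norm (u s))\<^sup>2 + (L2_norm (weak_grad (u s)))\<^sup>2)"
      by (rule set_integrable_subset) (use subT in auto)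
    show ?thesis unfolding set_integrable_def
    proof (rule Bochner_Integration.integrable_bound[OF i[unfolded set_integrable_def] Hm])
      show "AE s in lebesgue. norm (indicator {0..t} s *\<^sub>R h1_norm2 (a s)) \<le>
          norm (indicator {0..t} s *\<^sub>R ((L2_norm (u s))\<^sup>2 + (L2_norm (weak_grad (u s)))\<^sup>2))"
        using h1
      proof eventually_elim
        case (elim s)
        show ?case
        proof (cases "s \<in> {0..t}")
          case True
          have "1 \<le> pi\<^sup>2" using pi_ge_two power_mono[of 1 pi 2] by simp
          then have "1 * h1_norm2 (a s) \<le> (4 * pi\<^sup>2) * h1_norm2 (a s)"
            using h1_norm2_nonneg[of "a s"] by (intro mult_right_mono) auto
          also have "\<dots> = (L2_norm (weak_grad (u s)))\<^sup>2" using elim True by simp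
          finally show ?thesis using True h1_norm2_nonneg[of "a s"] by (simp add: add_increasing)
        qed simp
      qed
    qed
  qed
  have bint: "set_integrable lebesgue {0..t} (\<lambda>s. b s k)" for k
  proof (rule set_integrable_componentwise)
    fix c :: "complex^3"
    have m: "(\<lambda>s. indicator {0..t} s *\<^sub>R (c \<bullet> b s k)) \<in> borel_measurable lebesgue"
    proof (rule measurable_AE_limit)
      show "continuous_on {0..t} (\<lambda>s. \<Sum>j\<in>freq_ball n. c \<bullet> conv_term (a s) k j)" for n
        unfolding conv_term_def cdot_def vector_scalar_mult_def by (intro continuous_intros cont)
      show "AE s in lebesgue. s \<in> {0..t} \<longrightarrow> (\<lambda>n. \<Sum>j\<in>freq_ball n. c \<bullet> conv_term (a s) k j) \<longlonglongrightarrow> c \<bullet> b s k"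
        using conv by eventually_elim (auto intro!: has_sum_freq_ball)
    qed
    have i: "integrable lebesgue (\<lambda>s. indicator {0..t} s *\<^sub>R (norm c * (4 * pi) * h1_norm2 (a s)))"
      using set_integrable_mult_right[OF Hint, of "norm c * (4 * pi)"] by (simp add: set_integrable_def)
    show "set_integrable lebesgue {0..t} (\<lambda>s. c \<bullet> b s k)" unfolding set_integrable_def
    proof (rule Bochner_Integration.integrable_bound[OF i m])
      show "AE s in lebesgue. norm (indicator {0..t} s *\<^sub>R (c \<bullet> b s k)) \<le>
          norm (indicator {0..t} s *\<^sub>R (norm c * (4 * pi) * h1_norm2 (a s)))"
        using h1' conv
      proof eventually_elim
        case (elim s)
        show ?case
        proof (cases "s \<in> {0..t}")
          case True
          then have as: "h1_seq (a s)" and hs: "((\<lambda>j. c \<bullet> conv_term (a s) k j) has_sum c \<bullet> b s k) UNIV"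
            using elim by auto
          have "\<bar>c \<bullet> b s k\<bar> \<le> norm c * (4 * pi * h1_norm2 (a s))"
            using has_sum_of_bound(2)[OF conv_term_sum_le[OF as], of c k] infsumI[OF hs] by simp
          then show ?thesis using True h1_norm2_nonneg[of "a s"] by (simp add: abs_mult mult.assoc)
        qed simp
      qed
    qed
  qed
  have ode: "c \<bullet> a s k + (LINT \<tau>:{0..s}|lebesgue. 4 * pi\<^sup>2 * (norm (freq k))\<^sup>2 * (c \<bullet> a \<tau> k) + c \<bullet> b \<tau> k) = c \<bullet> fourier_coeff \<psi> k"
    if s: "s \<in> {0..t}" and c: "cdot c k = 0" for k c s
  proof -
    have "set_integrable lebesgue {0..t} (\<lambda>\<tau>. c \<bullet> b \<tau> k)"
      by (rule set_integrable_inner_continuous[OF continuous_on_const bint])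
    moreover have "set_integrable lebesgue {0..t} (\<lambda>\<tau>. 4 * pi\<^sup>2 * (norm (freq k))\<^sup>2 * (c \<bullet> a \<tau> k))"
    proof -
      have "set_integrable lebesgue {0..t} (\<lambda>\<tau>. a \<tau> k)"
        using borel_integrable_compact[OF _ cont[of k]] by (simp add: set_integrable_def integrable_completion)
      then show ?thesis
        by (intro set_integrable_mult_right set_integrable_inner_continuous[OF continuous_on_const])
    qed
    ultimately have "set_integrable lebesgue {0..t} (\<lambda>\<tau>. 4 * pi\<^sup>2 * (norm (freq k))\<^sup>2 * (c \<bullet> a \<tau> k) + c \<bullet> b \<tau> k)"
      by (rule set_integral_add(1)[rotated])
    then have i: "set_integrable lebesgue {0..s} (\<lambda>\<tau>. 4 * pi\<^sup>2 * (norm (freq k))\<^sup>2 * (c \<bullet> a \<tau> k) + c \<bullet> b \<tau> k)"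
      by (rule set_integrable_subset) (use s in auto)
    have "(LINT \<tau>:{0..s}|lebesgue. g c k \<tau>) =
        (LINT \<tau>:{0..s}|lebesgue. 4 * pi\<^sup>2 * (norm (freq k))\<^sup>2 * (c \<bullet> a \<tau> k) + c \<bullet> b \<tau> k)"
      by (rule set_integral_AE_eq[OF i]) (use g_eq[of c k] s in \<open>auto elim!: eventually_mono\<close>)
    then show ?thesis using ode0[OF s c] by simp
  qed
  have energy: "(\<Sum>k\<in>K. (norm (a t k))\<^sup>2) + 8 * pi\<^sup>2 * (LINT s:{0..t}|lebesgue. h1_norm2 (a s)) \<le> (L2_norm \<psi>)\<^sup>2"
    if K: "finite K" for K
  proof -
    have tt: "t \<in> {0..t}" using t by simp
    have "(\<Sum>k\<in>K. (norm (a t k))\<^sup>2) \<le> (L2_norm (u t))\<^sup>2"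
      using Parseval_vector[OF uL(1)[OF tt]] K unfolding a_def has_sum_iff
      by (metis finite_sum_le_infsum subset_UNIV zero_le_power2)
    moreover have "(LINT s:{0..t}|lebesgue. (L2_norm (weak_grad (u s)))\<^sup>2) = (LINT s:{0..t}|lebesgue. 4 * pi\<^sup>2 * h1_norm2 (a s))"
      using h1 by (intro set_integral_AE_eq set_integrable_mult_right Hint) (auto elim!: eventually_mono)
    moreover have "(L2_norm (u t))\<^sup>2 + 2 * (LINT \<tau>:{0..t}|lebesgue. (L2_norm (weak_grad (u \<tau>)))\<^sup>2) \<le> (L2_norm \<psi>)\<^sup>2"
      using en times[OF tt] by (simp add: energy_inequality_def)
    ultimately show ?thesis by simp
  qed
  have re: "a s (- k) $ i = cnj (a s k $ i)" for s k i unfolding a_def by (rule fourier_coeff_minus)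
  have "fourier_solution t (fourier_coeff \<psi>) a b"
    unfolding fourier_solution_def
  proof (intro conjI)
    show "\<forall>k. continuous_on {0..t} (\<lambda>s. a s k)" by (intro allI cont)
    show "\<forall>s\<in>{0..t}. \<forall>k. cdot (a s k) k = 0" by (intro ballI allI adiv)
    show "\<forall>s\<in>{0..t}. \<forall>k i. a s (- k) $ i = cnj (a s k $ i)" by (intro ballI allI re)
    show "\<forall>k. set_integrable lebesgue {0..t} (\<lambda>s. b s k)" by (intro allI bint)
    show "\<forall>s\<in>{0..t}. \<forall>k c. cdot c k = 0 \<longrightarrow>
        c \<bullet> a s k + (LINT \<tau>:{0..s}|lebesgue. 4 * pi\<^sup>2 * (norm (freq k))\<^sup>2 * (c \<bullet> a \<tau> k) + c \<bullet> b \<tau> k) = c \<bullet> fourier_coeff \<psi> k"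
      by (intro ballI allI impI ode)
    show "\<forall>k. cdot (fourier_coeff \<psi> k) k = 0" by (intro allI cdot_fourier_coeff \<psi>L)
    show "\<exists>E. ((\<lambda>k. (norm (fourier_coeff \<psi> k))\<^sup>2) has_sum E) UNIV \<and>
        (\<forall>K. finite K \<longrightarrow>
          (\<Sum>k\<in>K. (norm (a t k))\<^sup>2) + 8 * pi\<^sup>2 * (LINT s:{0..t}|lebesgue. h1_norm2 (a s)) \<le> E)"
      by (intro exI[of _ "(L2_norm \<psi>)\<^sup>2"] conjI allI impI energy Parseval_vector \<psi>L)
  qed (fact h1' conv Hint)+
  then show ?thesis by (simp only: a_def b_def)
qed

section \<open>The pointwise decay bound and the norm of Phi(2)\<close>

lemma Phi_norm_decay:
  assumes "a \<in> Phi 2" "Phi_norm 2 a \<le> r"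
  shows "decay r a"
proof
  fix k
  obtain c where a0: "a 0 = 0" and c: "\<And>k. k \<noteq> 0 \<Longrightarrow> norm (a k) \<le> c / norm (freq k) powr 2"
    using assms(1) by (auto simp: Phi_def)
  show "norm (a k) \<le> r / (norm (freq k))\<^sup>2"
  proof (cases "k = 0")
    case False
    have pos: "norm (freq k) > 0" if "k \<noteq> 0" for k using that by simp
    have "norm (freq k) powr 2 * norm (a k) \<le> c" if "k \<noteq> 0" for k
      using c[OF that] pos[OF that] by (simp add: pos_le_divide_eq mult.commute)
    \<comment> \<open>A real supremum is known to dominate its members only over a bounded set;
      membership in \<open>Phi 2\<close> supplies the bound.\<close>
    then have "bdd_above ((\<lambda>k. norm (freq k) powr 2 * norm (a k)) ` (- {0}))" by (auto intro!: bdd_aboveI[of _ c])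
    then have "norm (freq k) powr 2 * norm (a k) \<le> Phi_norm 2 a"
      unfolding Phi_norm_def using False by (intro cSUP_upper) auto
    then have "(norm (freq k))\<^sup>2 * norm (a k) \<le> r" using assms(2) pos[OF False] by simp
    then show ?thesis using pos[OF False] by (simp add: pos_le_divide_eq mult.commute)
  qed (simp add: a0)
qed

lemma decay_Phi_norm:
  assumes d: "decay r a"
  shows "a \<in> Phi 2" "Phi_norm 2 a \<le> r"
proof -
  have "a 0 = 0" using d[rule_format, of 0] by simp
  moreover have "norm (a k) \<le> r / norm (freq k) powr 2" if "k \<noteq> 0" for k
    using d that by simp
  ultimately show "a \<in> Phi 2" by (auto simp: Phi_def)
  \<comment> \<open>An upper bound controls a real supremum only over a nonempty index set.\<close>
  have "axis 1 1 \<in> - {0::int^3}" by (simp add: axis_eq_0_iff)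
  then have ne: "- {0::int^3} \<noteq> {}" by blast
  show "Phi_norm 2 a \<le> r"
    unfolding Phi_norm_def
  proof (intro cSUP_least)
    fix k :: "int^3" assume "k \<in> - {0}"
    then have "norm (freq k) > 0" by simp
    then show "norm (freq k) powr 2 * norm (a k) \<le> r"
      using d[rule_format, of k] by (simp add: pos_le_divide_eq mult.commute)
  qed (rule ne)
qed

theorem theorem3:
  shows "\<exists>\<epsilon>::real. \<epsilon> > 0 \<and>
    (\<forall>(\<psi> :: real^3 \<Rightarrow> real^3) (T :: ereal) (u :: real \<Rightarrow> real^3 \<Rightarrow> real^3).
       0 < T \<longrightarrow>
       fourier_coeff \<psi> \<in> Phi 2 \<longrightarrow>
       Phi_norm 2 (fourier_coeff \<psi>) < \<epsilon> \<longrightarrow>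
       leray_hopf T \<psi> u \<longrightarrow>
       (\<forall>t. 0 < t \<and> ereal t < T \<longrightarrow>
          fourier_coeff (u t) \<in> Phi 2 \<and> Phi_norm 2 (fourier_coeff (u t)) < \<epsilon>))"
proof -
  obtain \<epsilon> where \<epsilon>: "\<epsilon> > 0" and dec: "\<And>t r \<psi> a b. 0 \<le> t \<Longrightarrow> 0 < r \<Longrightarrow> r \<le> \<epsilon> \<Longrightarrow>
      fourier_solution t \<psi> a b \<Longrightarrow> decay r \<psi> \<Longrightarrow> decay r (a t)"
    using decay_preserved by blast
  show ?thesis
  proof (intro exI[of _ \<epsilon>] conjI allI impI \<epsilon>)
    fix \<psi> T u t
    assume \<psi>: "fourier_coeff \<psi> \<in> Phi 2" "Phi_norm 2 (fourier_coeff \<psi>) < \<epsilon>"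
      and LH: "leray_hopf T \<psi> u" and t: "0 < t \<and> ereal t < T"
    \<comment> \<open>A level strictly below \<open>\<epsilon>\<close> that is positive even for
      \<open>\<psi> = 0\<close>; invariance of the ball at this level yields the strict
      inequality.\<close>
    define r where "r = max (Phi_norm 2 (fourier_coeff \<psi>)) (\<epsilon> / 2)"
    have r: "0 < r" "r < \<epsilon>" using \<epsilon> \<psi>(2) by (auto simp: r_def)
    have "decay r (fourier_coeff \<psi>)" by (rule Phi_norm_decay[OF \<psi>(1)]) (simp add: r_def)
    moreover have "fourier_coeff \<psi> 0 = 0" using \<psi>(1) by (simp add: Phi_def)
    ultimately have "decay r (fourier_coeff (u t))"
      using dec[OF _ r(1) _ leray_hopf_fourier_solution[OF LH]] t r by simp
    from decay_Phi_norm[OF this] r(2)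
    show "fourier_coeff (u t) \<in> Phi 2" "Phi_norm 2 (fourier_coeff (u t)) < \<epsilon>" by auto
  qed
qed

end
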